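(* Let $(M,g)$ be an oriented 5-dimensional Riemannian spin manifold, $\eta$ a unit-length section of its spinor bundle and $(\omega_1,\omega_2,\omega_3)$ the 2-forms of the $\mathrm{SU}(2)$ structure $(\alpha,\omega_1,\omega_2,\omega_3)$ determined by $\eta$. Put $\varepsilon_1=1$, $\varepsilon_2=\varepsilon_3=-1$. Then for $k=1,2,3$ $$d\omega_k=\alpha\wedge\tau_2^k+\sum_{l=1}^3\tau_0^{kl}\,\alpha\wedge\omega_l+\tau_1^k\wedge\omega_k,$$ where $\tau_0^{kl}=-\tau_0^{lk}$ for $k\neq l$ and - $\tau_0^{kk}=4\lambda_1$, $\tau_0^{12}=4\lambda_2+2\phi_3$, $\tau_0^{13}=4\lambda_3-2\phi_2$, $\tau_0^{23}=4\mu-2\phi_1$; - $\tau_1^k=-2\sum_{l\neq k}\varepsilon_lJ_l\Theta_l$; - $\tau_2^1=4\,i(S_0)g$, $\tau_2^2=4\,i(S_3)\omega_3$, $\tau_2^3=-4\,i(S_2)\omega_2$.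
   Context: Spinors in dimension 5: Clifford convention $v\cdot v=-|v|^2$. $\Sigma(M)$ is the bundle associated to an irreducible real $\mathrm{Cl}_5$-module $W$ (real dimension 8), with invariant scalar product $\langle\cdot,\cdot\rangle$ for which vectors act skew-symmetrically, and spin connection $\nabla$. $\jmath_1$ is Clifford multiplication by the oriented unit volume form ($\jmath_1^2=-1$, commutes with vectors); $\jmath_2$ is a parallel isometry with $\jmath_2^2=-1$ anticommuting with Clifford multiplication by vectors; $\jmath_3=\jmath_1\jmath_2$. $\mathrm{SU}(2)$ structure of a unit spinor $\eta$: there is a rank-4 subbundle $\xi\subset TM$ such that $\xi\eta$ is the orthogonal complement of $\langle\eta,\jmath_1\eta,\jmath_2\eta,\jmath_3\eta\rangle$; define $J_k:\xi\to\xi$ by $J_k(X)\eta=\jmath_k(X\eta)$, and $\omega_k(X,Y)=g(J_kX_\xi,Y_\xi)$, $X_\xi$ the orthogonal projection to $\xi$. $R$ is the unit vector field orthogonal to $\xi$ such that $TM=\xi\oplus\langle R\rangle$ as oriented bundles, $\xi$ oriented by $\omega_1^2|_\xi$; $\alpha=g(R,\cdot)$. Decomposition of $\nabla\eta$: there are unique $S\in\mathrm{End}(\xi)$, $V_\xi\in\xi$, $\Theta_l\in\xi^*$, $\phi_l\in C^\infty(M)$ with $\nabla_X\eta=S(X_\xi)\eta+\alpha(X)V_\xi\eta+\sum_{l=1}^3(\Theta_l(X_\xi)+\alpha(X)\phi_l)\jmath_l\eta$, where $X=X_\xi+\alpha(X)R$. Moreover $S=\mu\,\mathrm{I}+\sum_lS_l+\sum_l\lambda_lJ_l+S_0$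 uniquely, with $\mu,\lambda_l$ functions, $S_k$ symmetric traceless, commuting with $J_k$ and anticommuting with $J_l$ for $l\ne k$, and $S_0$ skew-symmetric commuting with $J_1,J_2,J_3$. Conventions: forms on $\xi$ are extended by zero on $R$; for $\beta\in\xi^*$, $(J_k\beta)(X)=\beta(J_kX)$; $(i(A)\omega)(X,Y)=\omega(AX,Y)$ and $(i(A)g)(X,Y)=g(AX,Y)$ for $A\in\mathrm{End}(\xi)$. *)

theory Defs
  imports "HOL-Analysis.Analysis"
begin

section \<open>Smooth maps between Euclidean spaces\<close>

primrec Ck_on :: "nat \<Rightarrow> 'a::euclidean_space set \<Rightarrow> ('a \<Rightarrow> 'b::real_normed_vector) \<Rightarrow> bool" where
  "Ck_on 0 U f \<longleftrightarrow> continuous_on U f"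
| "Ck_on (Suc k) U f \<longleftrightarrow>
     f differentiable_on U \<and> (\<forall>v. Ck_on k U (\<lambda>x. frechet_derivative f (at x) v))"

definition smooth_on :: "'a::euclidean_space set \<Rightarrow> ('a \<Rightarrow> 'b::real_normed_vector) \<Rightarrow> bool" where
  \<comment> \<open>only used for open \<open>U\<close>\<close>
  "smooth_on U f \<longleftrightarrow> (\<forall>k. Ck_on k U f)"


section \<open>Oriented 5-manifolds\<close>

text \<open>
  A manifold is a type with a Hausdorff second countable topology together with an atlas.
  Bundles are handled by preferred trivialisations: the tangent space at \<open>x\<close> is
  the space \<open>real ^ 5\<close>, a tangent vector being represented by its components in the
  preferred chart at \<open>x\<close>. As the preferred chart jumps with \<open>x\<close>, fields may only be
  differentiated after passing to their components in one fixed chart.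
\<close>

record 'm chart =
  chart_dom :: "'m set"
  chart_map :: "'m \<Rightarrow> real ^ 5"

definition chart_inv :: "'m chart \<Rightarrow> real ^ 5 \<Rightarrow> 'm" where
  "chart_inv c = inv_into (chart_dom c) (chart_map c)"

definition is_chart :: "'m::topological_space chart \<Rightarrow> bool" where
  "is_chart c \<longleftrightarrow> open (chart_dom c) \<and> open (chart_map c ` chart_dom c) \<and>
     homeomorphism (chart_dom c) (chart_map c ` chart_dom c) (chart_map c) (chart_inv c)"

definition oriented_atlas :: "'m::{t2_space, second_countable_topology} chart set \<Rightarrow> bool" where
  "oriented_atlas A \<longleftrightarrow>
     (\<forall>c\<in>A. is_chart c) \<and> (\<Union>c\<in>A. chart_dom c) = UNIV \<and>
     (\<forall>c\<in>A. \<forall>d\<in>A.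
        smooth_on (chart_map c ` (chart_dom c \<inter> chart_dom d)) (chart_map d \<circ> chart_inv c) \<and>
        (\<forall>y\<in>chart_map c ` (chart_dom c \<inter> chart_dom d).
           det (matrix (frechet_derivative (chart_map d \<circ> chart_inv c) (at y))) > 0))"

definition chart_at :: "'m chart set \<Rightarrow> 'm \<Rightarrow> 'm chart" where
  "chart_at A x = (SOME c. c \<in> A \<and> x \<in> chart_dom c)"

text \<open>Components in the chart \<open>c\<close> of a tangent vector at \<open>x\<close>, and conversely.\<close>

definition to_coord :: "'m chart set \<Rightarrow> 'm chart \<Rightarrow> 'm \<Rightarrow> real ^ 5 \<Rightarrow> real ^ 5" where
  "to_coord A c x v =
     frechet_derivative (chart_map c \<circ> chart_inv (chart_at A x)) (at (chart_map (chart_at A x) x)) v"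

definition of_coord :: "'m chart set \<Rightarrow> 'm chart \<Rightarrow> 'm \<Rightarrow> real ^ 5 \<Rightarrow> real ^ 5" where
  "of_coord A c x a =
     frechet_derivative (chart_map (chart_at A x) \<circ> chart_inv c) (at (chart_map c x)) a"

definition smooth_map_on :: "'m chart set \<Rightarrow> 'm set \<Rightarrow> ('m \<Rightarrow> 'b::real_normed_vector) \<Rightarrow> bool" where
  "smooth_map_on A U f \<longleftrightarrow>
     (\<forall>c\<in>A. smooth_on (chart_map c ` (chart_dom c \<inter> U)) (f \<circ> chart_inv c))"

definition deriv_along :: "'m chart set \<Rightarrow> ('m \<Rightarrow> 'b::real_normed_vector) \<Rightarrow> 'm \<Rightarrow> real ^ 5 \<Rightarrow> 'b" where
  "deriv_along A f x v =
     frechet_derivative (f \<circ> chart_inv (chart_at A x)) (at (chart_map (chart_at A x) x)) v"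

definition field_coord ::
    "'m chart set \<Rightarrow> 'm chart \<Rightarrow> ('m \<Rightarrow> real ^ 5) \<Rightarrow> real ^ 5 \<Rightarrow> real ^ 5" where
  "field_coord A c X y = to_coord A c (chart_inv c y) (X (chart_inv c y))"

definition smooth_field_on :: "'m chart set \<Rightarrow> 'm set \<Rightarrow> ('m \<Rightarrow> real ^ 5) \<Rightarrow> bool" where
  "smooth_field_on A U X \<longleftrightarrow>
     (\<forall>c\<in>A. smooth_on (chart_map c ` (chart_dom c \<inter> U)) (field_coord A c X))"

definition form_coord ::
    "'m chart set \<Rightarrow> 'm chart \<Rightarrow> ('m \<Rightarrow> real ^ 5 \<Rightarrow> real ^ 5 \<Rightarrow> real)
      \<Rightarrow> real ^ 5 \<Rightarrow> real ^ 5 \<Rightarrow> real ^ 5 \<Rightarrow> real" where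
  "form_coord A c \<beta> y a b =
     \<beta> (chart_inv c y) (of_coord A c (chart_inv c y) a) (of_coord A c (chart_inv c y) b)"

definition form_deriv ::
    "'m chart set \<Rightarrow> ('m \<Rightarrow> real ^ 5 \<Rightarrow> real ^ 5 \<Rightarrow> real)
      \<Rightarrow> 'm \<Rightarrow> real ^ 5 \<Rightarrow> real ^ 5 \<Rightarrow> real ^ 5 \<Rightarrow> real" where
  \<comment> \<open>derivative in the direction \<open>v\<close> of the component \<open>(a, b)\<close> in the preferred chart at \<open>x\<close>\<close>
  "form_deriv A \<beta> x v a b =
     frechet_derivative (\<lambda>y. form_coord A (chart_at A x) \<beta> y a b)
       (at (chart_map (chart_at A x) x)) v"

definition ext_deriv ::
    "'m chart set \<Rightarrow> ('m \<Rightarrow> real ^ 5 \<Rightarrow> real ^ 5 \<Rightarrow> real)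
      \<Rightarrow> 'm \<Rightarrow> real ^ 5 \<Rightarrow> real ^ 5 \<Rightarrow> real ^ 5 \<Rightarrow> real" where
  "ext_deriv A \<beta> x u v w =
     form_deriv A \<beta> x u v w - form_deriv A \<beta> x v u w + form_deriv A \<beta> x w u v"

definition wedge_1_2 ::
    "('v \<Rightarrow> real) \<Rightarrow> ('v \<Rightarrow> 'v \<Rightarrow> real) \<Rightarrow> 'v \<Rightarrow> 'v \<Rightarrow> 'v \<Rightarrow> real" where
  "wedge_1_2 \<beta> \<gamma> u v w = \<beta> u * \<gamma> v w - \<beta> v * \<gamma> u w + \<beta> w * \<gamma> u v"

definition wedge_2_2 ::
    "('v \<Rightarrow> 'v \<Rightarrow> real) \<Rightarrow> ('v \<Rightarrow> 'v \<Rightarrow> real) \<Rightarrow> 'v \<Rightarrow> 'v \<Rightarrow> 'v \<Rightarrow> 'v \<Rightarrow> real" where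
  "wedge_2_2 \<beta> \<gamma> a b c d =
     \<beta> a b * \<gamma> c d - \<beta> a c * \<gamma> b d + \<beta> a d * \<gamma> b c
     + \<beta> b c * \<gamma> a d - \<beta> b d * \<gamma> a c + \<beta> c d * \<gamma> a b"


section \<open>Riemannian metrics and the Levi-Civita connection\<close>

definition riemannian_metric ::
    "'m chart set \<Rightarrow> ('m \<Rightarrow> real ^ 5 \<Rightarrow> real ^ 5 \<Rightarrow> real) \<Rightarrow> bool" where
  "riemannian_metric A g \<longleftrightarrow>
     (\<forall>x. bilinear (g x) \<and> (\<forall>u v. g x u v = g x v u) \<and> (\<forall>v. v \<noteq> 0 \<longrightarrow> g x v v > 0)) \<and>
     (\<forall>c\<in>A. \<forall>a b. smooth_on (chart_map c ` chart_dom c) (\<lambda>y. form_coord A c g y a b))"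

definition christoffel ::
    "'m chart set \<Rightarrow> ('m \<Rightarrow> real ^ 5 \<Rightarrow> real ^ 5 \<Rightarrow> real)
      \<Rightarrow> 'm \<Rightarrow> real ^ 5 \<Rightarrow> real ^ 5 \<Rightarrow> real ^ 5" where
  \<comment> \<open>Symmetry says that the connection is torsion-free, the last clause that it is metric.\<close>
  "christoffel A g x = (THE \<Gamma>. bilinear \<Gamma> \<and> (\<forall>u v. \<Gamma> u v = \<Gamma> v u) \<and>
     (\<forall>u a b. form_deriv A g x u a b = g x (\<Gamma> u a) b + g x a (\<Gamma> u b)))"

definition levi_civita ::
    "'m chart set \<Rightarrow> ('m \<Rightarrow> real ^ 5 \<Rightarrow> real ^ 5 \<Rightarrow> real)
      \<Rightarrow> 'm \<Rightarrow> real ^ 5 \<Rightarrow> ('m \<Rightarrow> real ^ 5) \<Rightarrow> real ^ 5" where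
  "levi_civita A g x v X =
     frechet_derivative (field_coord A (chart_at A x) X) (at (chart_map (chart_at A x) x)) v
     + christoffel A g x v (X x)"


section \<open>Clifford modules and the spin group in dimension 5\<close>

text \<open>
  By the universal property of the Clifford algebra, a real \<open>Cl\<^sub>5\<close>-module structure on \<open>'w\<close> is
  the same as a linear action of vectors \<open>cl\<close> with \<open>cl v (cl v w) = - |v|\<^sup>2 w\<close>.
\<close>

definition irreducible_clifford_module :: "(real ^ 5 \<Rightarrow> 'w::euclidean_space \<Rightarrow> 'w) \<Rightarrow> bool" where
  "irreducible_clifford_module cl \<longleftrightarrow>
     DIM('w) = 8 \<and> bilinear cl \<and>
     (\<forall>v w. cl v (cl v w) = - ((norm v)\<^sup>2 *\<^sub>R w)) \<and>
     (\<forall>v w w'. inner (cl v w) w' = - inner w (cl v w')) \<and>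
     (\<forall>V. subspace V \<and> (\<forall>v. cl v ` V \<subseteq> V) \<longrightarrow> V = {0} \<or> V = UNIV)"

text \<open>
  \<open>Spin(5)\<close> consists of the even products of unit vectors. \<open>Cl\<^sub>5\<close> is a simple algebra, so it
  acts faithfully on the module and \<open>Spin(5)\<close> can be identified with its group of operators.
\<close>

inductive_set spin_group :: "(real ^ 5 \<Rightarrow> 'w::euclidean_space \<Rightarrow> 'w) \<Rightarrow> ('w \<Rightarrow> 'w) set"
  for cl where
  "id \<in> spin_group cl"
| "s \<in> spin_group cl \<Longrightarrow> norm u = 1 \<Longrightarrow> norm v = 1 \<Longrightarrow> cl u \<circ> cl v \<circ> s \<in> spin_group cl"

definition spin_rotation ::
    "(real ^ 5 \<Rightarrow> 'w::euclidean_space \<Rightarrow> 'w) \<Rightarrow> ('w \<Rightarrow> 'w) \<Rightarrow> real ^ 5 \<Rightarrow> real ^ 5" where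
  \<comment> \<open>the double covering of \<open>SO(5)\<close>, \<open>v \<mapsto> s v s\<^sup>-\<^sup>1\<close>\<close>
  "spin_rotation cl s = (THE T. \<forall>v w. cl (T v) (s w) = s (cl v w))"


section \<open>Spin manifolds and spinors\<close>

text \<open>
  A spin structure is a lift of the bundle of oriented orthonormal frames to \<open>Spin(5)\<close>, given by
  transition functions: \<open>frame a x :: real ^ 5 \<Rightarrow> real ^ 5\<close>, for \<open>a\<close> in \<open>idx\<close> and \<open>x\<close> in
  \<open>frame_dom a\<close>, sends the standard basis to an oriented orthonormal basis of the tangent space
  at \<open>x\<close>, and \<open>trans a b\<close> is a \<open>Spin(5)\<close>-valued cocycle that lifts the change from
  \<open>frame a\<close> to \<open>frame b\<close>.
\<close>

record ('m, 'w, 'i) spin_manifold =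
  charts :: "'m chart set"
  metric :: "'m \<Rightarrow> real ^ 5 \<Rightarrow> real ^ 5 \<Rightarrow> real"
  clif :: "real ^ 5 \<Rightarrow> 'w \<Rightarrow> 'w"
  idx :: "'i set"
  frame_dom :: "'i \<Rightarrow> 'm set"
  frame :: "'i \<Rightarrow> 'm \<Rightarrow> real ^ 5 \<Rightarrow> real ^ 5"
  trans :: "'i \<Rightarrow> 'i \<Rightarrow> 'm \<Rightarrow> 'w \<Rightarrow> 'w"

definition spin_structure ::
    "('m::{t2_space, second_countable_topology}, 'w::euclidean_space, 'i) spin_manifold \<Rightarrow> bool" where
  "spin_structure M \<longleftrightarrow>
     (\<forall>a\<in>idx M. open (frame_dom M a)) \<and> (\<Union>a\<in>idx M. frame_dom M a) = UNIV \<and>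
     (\<forall>a\<in>idx M. \<forall>x\<in>frame_dom M a.
        linear (frame M a x) \<and>
        (\<forall>u v. metric M x (frame M a x u) (frame M a x v) = inner u v) \<and>
        det (matrix (frame M a x)) > 0) \<and>
     (\<forall>a\<in>idx M. \<forall>u. smooth_field_on (charts M) (frame_dom M a) (\<lambda>x. frame M a x u)) \<and>
     (\<forall>a\<in>idx M. \<forall>b\<in>idx M.
        (\<forall>x\<in>frame_dom M a \<inter> frame_dom M b.
           trans M a b x \<in> spin_group (clif M) \<and>
           frame M b x = frame M a x \<circ> spin_rotation (clif M) (trans M a b x)) \<and>
        (\<forall>w. smooth_map_on (charts M) (frame_dom M a \<inter> frame_dom M b) (\<lambda>x. trans M a b x w))) \<and>
     (\<forall>a\<in>idx M. \<forall>b\<in>idx M. \<forall>c\<in>idx M.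
        \<forall>x\<in>frame_dom M a \<inter> frame_dom M b \<inter> frame_dom M c.
           trans M a b x \<circ> trans M b c x = trans M a c x)"

definition oriented_riemannian_spin_manifold ::
    "('m::{t2_space, second_countable_topology}, 'w::euclidean_space, 'i) spin_manifold \<Rightarrow> bool" where
  "oriented_riemannian_spin_manifold M \<longleftrightarrow>
     oriented_atlas (charts M) \<and> riemannian_metric (charts M) (metric M) \<and>
     irreducible_clifford_module (clif M) \<and> spin_structure M"

text \<open>
  The spinor bundle is associated to the module \<open>'w\<close>. Its fibre at \<open>x\<close> is \<open>'w\<close> itself,
  through the preferred trivialisation at \<open>x\<close>; a spinor field is a function \<open>'m \<Rightarrow> 'w\<close>, and
  its representatives in the trivialisations are related by \<open>\<psi>\<^sub>a = trans a b \<psi>\<^sub>b\<close>.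
\<close>

definition idx_at :: "('m, 'w, 'i) spin_manifold \<Rightarrow> 'm \<Rightarrow> 'i" where
  "idx_at M x = (SOME a. a \<in> idx M \<and> x \<in> frame_dom M a)"

definition spinor_coord ::
    "('m, 'w, 'i) spin_manifold \<Rightarrow> 'i \<Rightarrow> ('m \<Rightarrow> 'w) \<Rightarrow> 'm \<Rightarrow> 'w" where
  "spinor_coord M a \<psi> x = trans M a (idx_at M x) x (\<psi> x)"

definition smooth_spinor_on ::
    "('m, 'w::euclidean_space, 'i) spin_manifold \<Rightarrow> 'm set \<Rightarrow> ('m \<Rightarrow> 'w) \<Rightarrow> bool" where
  "smooth_spinor_on M U \<psi> \<longleftrightarrow>
     (\<forall>a\<in>idx M. smooth_map_on (charts M) (frame_dom M a \<inter> U) (spinor_coord M a \<psi>))"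

definition clifford ::
    "('m, 'w, 'i) spin_manifold \<Rightarrow> 'm \<Rightarrow> real ^ 5 \<Rightarrow> 'w \<Rightarrow> 'w" where
  "clifford M x v w = clif M (inv (frame M (idx_at M x) x) v) w"

definition nabla ::
    "('m, 'w::euclidean_space, 'i) spin_manifold \<Rightarrow> 'm \<Rightarrow> real ^ 5 \<Rightarrow> ('m \<Rightarrow> 'w) \<Rightarrow> 'w" where
  \<comment> \<open>\<open>\<nabla>\<^sub>v \<psi> = d\<psi>(v) + 1/4 \<Sum>\<^sub>i\<^sub>j g(\<nabla>\<^sub>v e\<^sub>i, e\<^sub>j) e\<^sub>i e\<^sub>j \<psi>\<close>: for \<open>v\<cdot>v = - |v|\<^sup>2\<close> this is the sign
     that makes Clifford multiplication parallel.\<close>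
  "nabla M x v \<psi> =
     (let a = idx_at M x; e = (\<lambda>i y. frame M a y (axis i 1)) in
       deriv_along (charts M) (spinor_coord M a \<psi>) x v
       + (1/4) *\<^sub>R (\<Sum>i\<in>UNIV. \<Sum>j\<in>UNIV.
           metric M x (levi_civita (charts M) (metric M) x v (e i)) (e j x)
             *\<^sub>R clifford M x (e i x) (clifford M x (e j x) (\<psi> x))))"

definition volume_mult :: "('m, 'w, 'i) spin_manifold \<Rightarrow> 'm \<Rightarrow> 'w \<Rightarrow> 'w" where
  "volume_mult M x w =
     (let e = (\<lambda>i. frame M (idx_at M x) x (axis i 1)) in
       clifford M x (e 1) (clifford M x (e 2) (clifford M x (e 3)
         (clifford M x (e 4) (clifford M x (e 5) w)))))"

definition parallel_structure ::
    "('m::{t2_space, second_countable_topology}, 'w::euclidean_space, 'i) spin_manifold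
      \<Rightarrow> ('m \<Rightarrow> 'w \<Rightarrow> 'w) \<Rightarrow> bool" where
  "parallel_structure M j2 \<longleftrightarrow>
     (\<forall>x. linear (j2 x) \<and> (\<forall>w. norm (j2 x w) = norm w) \<and> (\<forall>w. j2 x (j2 x w) = - w) \<and>
        (\<forall>v w. j2 x (clifford M x v w) = - clifford M x v (j2 x w))) \<and>
     (\<forall>U \<psi>. open U \<and> smooth_spinor_on M U \<psi> \<longrightarrow>
        smooth_spinor_on M U (\<lambda>x. j2 x (\<psi> x)) \<and>
        (\<forall>x\<in>U. \<forall>v. nabla M x v (\<lambda>y. j2 y (\<psi> y)) = j2 x (nabla M x v \<psi>)))"

definition jmath ::
    "('m, 'w, 'i) spin_manifold \<Rightarrow> ('m \<Rightarrow> 'w \<Rightarrow> 'w) \<Rightarrow> nat \<Rightarrow> 'm \<Rightarrow> 'w \<Rightarrow> 'w" where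
  \<comment> \<open>meaningful for \<open>k \<in> {1, 2, 3}\<close>\<close>
  "jmath M j2 k x w =
     (if k = 1 then volume_mult M x w
      else if k = 2 then j2 x w
      else volume_mult M x (j2 x w))"


section \<open>The SU(2) structure of a unit spinor\<close>

definition linear_on_subspace ::
    "'v::real_vector set \<Rightarrow> ('v \<Rightarrow> 'u::real_vector) \<Rightarrow> bool" where
  "linear_on_subspace V f \<longleftrightarrow>
     (\<forall>u\<in>V. \<forall>v\<in>V. f (u + v) = f u + f v) \<and> (\<forall>r. \<forall>v\<in>V. f (r *\<^sub>R v) = r *\<^sub>R f v)"

definition endo_on :: "'v::real_vector set \<Rightarrow> ('v \<Rightarrow> 'v) \<Rightarrow> bool" where
  "endo_on V f \<longleftrightarrow> f ` V \<subseteq> V \<and> linear_on_subspace V f"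

definition alpha ::
    "('m, 'w, 'i) spin_manifold \<Rightarrow> ('m \<Rightarrow> real ^ 5) \<Rightarrow> 'm \<Rightarrow> real ^ 5 \<Rightarrow> real" where
  "alpha M R x X = metric M x (R x) X"

definition hor ::
    "('m, 'w, 'i) spin_manifold \<Rightarrow> ('m \<Rightarrow> real ^ 5) \<Rightarrow> 'm \<Rightarrow> real ^ 5 \<Rightarrow> real ^ 5" where
  \<comment> \<open>orthogonal projection to \<open>\<xi>\<close>, the orthogonal complement of the unit vector \<open>R x\<close>\<close>
  "hor M R x X = X - alpha M R x X *\<^sub>R R x"

definition omega ::
    "('m, 'w, 'i) spin_manifold \<Rightarrow> (nat \<Rightarrow> 'm \<Rightarrow> real ^ 5 \<Rightarrow> real ^ 5) \<Rightarrow> ('m \<Rightarrow> real ^ 5)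
      \<Rightarrow> nat \<Rightarrow> 'm \<Rightarrow> real ^ 5 \<Rightarrow> real ^ 5 \<Rightarrow> real" where
  "omega M J R k x X Y = metric M x (J k x (hor M R x X)) (hor M R x Y)"

definition unit_spinor ::
    "('m::{t2_space, second_countable_topology}, 'w::euclidean_space, 'i) spin_manifold
      \<Rightarrow> ('m \<Rightarrow> 'w) \<Rightarrow> bool" where
  "unit_spinor M \<eta> \<longleftrightarrow> smooth_spinor_on M UNIV \<eta> \<and> (\<forall>x. norm (\<eta> x) = 1)"

text \<open>
  The data \<open>\<xi>\<close>, \<open>J\<close> (on \<open>\<xi>\<close>) and \<open>R\<close> are uniquely determined by the conditions below.
  Orientations are read off from determinants of components in the preferred chart.
\<close>

definition su2_structure ::
    "('m::{t2_space, second_countable_topology}, 'w::euclidean_space, 'i) spin_manifold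
      \<Rightarrow> ('m \<Rightarrow> 'w \<Rightarrow> 'w) \<Rightarrow> ('m \<Rightarrow> 'w) \<Rightarrow> ('m \<Rightarrow> (real ^ 5) set)
      \<Rightarrow> (nat \<Rightarrow> 'm \<Rightarrow> real ^ 5 \<Rightarrow> real ^ 5) \<Rightarrow> ('m \<Rightarrow> real ^ 5) \<Rightarrow> bool" where
  "su2_structure M j2 \<eta> \<xi> J R \<longleftrightarrow> (\<forall>x.
     subspace (\<xi> x) \<and> dim (\<xi> x) = 4 \<and>
     (\<lambda>X. clifford M x X (\<eta> x)) ` \<xi> x =
       orthogonal_comp (span {\<eta> x, jmath M j2 1 x (\<eta> x), jmath M j2 2 x (\<eta> x), jmath M j2 3 x (\<eta> x)}) \<and>
     (\<forall>k\<in>{1,2,3}. \<forall>X\<in>\<xi> x. J k x X \<in> \<xi> x \<and>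
       clifford M x (J k x X) (\<eta> x) = jmath M j2 k x (clifford M x X (\<eta> x))) \<and>
     metric M x (R x) (R x) = 1 \<and> (\<forall>X\<in>\<xi> x. metric M x (R x) X = 0) \<and>
     (\<forall>X1\<in>\<xi> x. \<forall>X2\<in>\<xi> x. \<forall>X3\<in>\<xi> x. \<forall>X4\<in>\<xi> x.
       wedge_2_2 (omega M J R 1 x) (omega M J R 1 x) X1 X2 X3 X4 > 0 \<longrightarrow>
       det (vector [X1, X2, X3, X4, R x] :: real ^ 5 ^ 5) > 0))"

definition spinor_decomposition ::
    "('m, 'w::euclidean_space, 'i) spin_manifold
      \<Rightarrow> ('m \<Rightarrow> 'w \<Rightarrow> 'w) \<Rightarrow> ('m \<Rightarrow> 'w) \<Rightarrow> ('m \<Rightarrow> (real ^ 5) set) \<Rightarrow> ('m \<Rightarrow> real ^ 5)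
      \<Rightarrow> ('m \<Rightarrow> real ^ 5 \<Rightarrow> real ^ 5) \<Rightarrow> ('m \<Rightarrow> real ^ 5) \<Rightarrow> (nat \<Rightarrow> 'm \<Rightarrow> real ^ 5 \<Rightarrow> real)
      \<Rightarrow> (nat \<Rightarrow> 'm \<Rightarrow> real) \<Rightarrow> bool" where
  "spinor_decomposition M j2 \<eta> \<xi> R S V \<Theta> \<phi> \<longleftrightarrow> (\<forall>x.
     endo_on (\<xi> x) (S x) \<and> V x \<in> \<xi> x \<and> (\<forall>l\<in>{1,2,3}. linear_on_subspace (\<xi> x) (\<Theta> l x)) \<and>
     (\<forall>X. nabla M x X \<eta> =
        clifford M x (S x (hor M R x X)) (\<eta> x)
        + alpha M R x X *\<^sub>R clifford M x (V x) (\<eta> x)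
        + (\<Sum>l\<in>{1,2,3}. (\<Theta> l x (hor M R x X) + alpha M R x X * \<phi> l x) *\<^sub>R jmath M j2 l x (\<eta> x))))"

definition endo_decomposition ::
    "('m, 'w, 'i) spin_manifold \<Rightarrow> ('m \<Rightarrow> (real ^ 5) set)
      \<Rightarrow> (nat \<Rightarrow> 'm \<Rightarrow> real ^ 5 \<Rightarrow> real ^ 5) \<Rightarrow> ('m \<Rightarrow> real ^ 5) \<Rightarrow> ('m \<Rightarrow> real ^ 5 \<Rightarrow> real ^ 5)
      \<Rightarrow> ('m \<Rightarrow> real) \<Rightarrow> (nat \<Rightarrow> 'm \<Rightarrow> real) \<Rightarrow> (nat \<Rightarrow> 'm \<Rightarrow> real ^ 5 \<Rightarrow> real ^ 5)
      \<Rightarrow> ('m \<Rightarrow> real ^ 5 \<Rightarrow> real ^ 5) \<Rightarrow> bool" where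
  \<comment> \<open>The trace of \<open>Sk k x\<close> on \<open>\<xi>\<close> is that of its extension by zero, the composition with \<open>hor\<close>.\<close>
  "endo_decomposition M \<xi> J R S \<mu> lam Sk S0 \<longleftrightarrow> (\<forall>x.
     (\<forall>X\<in>\<xi> x. S x X = \<mu> x *\<^sub>R X + (\<Sum>l\<in>{1,2,3}. Sk l x X) + (\<Sum>l\<in>{1,2,3}. lam l x *\<^sub>R J l x X) + S0 x X) \<and>
     (\<forall>k\<in>{1,2,3}. endo_on (\<xi> x) (Sk k x) \<and>
        (\<forall>X\<in>\<xi> x. \<forall>Y\<in>\<xi> x. metric M x (Sk k x X) Y = metric M x X (Sk k x Y)) \<and>
        Determinants.trace (matrix (\<lambda>X. Sk k x (hor M R x X))) = 0 \<and>
        (\<forall>X\<in>\<xi> x. Sk k x (J k x X) = J k x (Sk k x X)) \<and>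
        (\<forall>l\<in>{1,2,3} - {k}. \<forall>X\<in>\<xi> x. Sk k x (J l x X) = - J l x (Sk k x X))) \<and>
     endo_on (\<xi> x) (S0 x) \<and>
     (\<forall>X\<in>\<xi> x. \<forall>Y\<in>\<xi> x. metric M x (S0 x X) Y = - metric M x X (S0 x Y)) \<and>
     (\<forall>k\<in>{1,2,3}. \<forall>X\<in>\<xi> x. S0 x (J k x X) = J k x (S0 x X)))"

definition epsilon :: "nat \<Rightarrow> real" where
  "epsilon k = (if k = 1 then 1 else - 1)"

end

theory Submission
  imports Defs
begin

text \<open>
  Because \<open>\<xi>\<eta>\<close> is orthogonal to \<open>\<eta>\<close> and the \<open>\<jmath>\<^sub>k\<eta>\<close>, the forms are \<open>\<omega>\<^sub>k(Y, Z) = \<langle>\<jmath>\<^sub>k(Y\<eta>), Z\<eta>\<rangle>\<close> on all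
  of \<open>TM\<close>. Clifford multiplication, the scalar product and the \<open>\<jmath>\<^sub>k\<close> are parallel, so
  \<open>(\<nabla>\<^sub>X\<omega>\<^sub>k)(Y, Z)\<close> depends on \<open>\<nabla>\<^sub>X\<eta>\<close> only, through a linear expression \<open>T\<^sub>k(\<nabla>\<^sub>X\<eta>)(Y, Z)\<close>, and
  \<open>d\<omega>\<^sub>k\<close> is the cyclic sum of these. The orientation condition gives \<open>R\<eta> = - \<jmath>\<^sub>1\<eta>\<close>, after which
  \<open>T\<^sub>k\<close> can be evaluated on \<open>U\<eta>\<close> for \<open>U \<in> \<xi>\<close> and on \<open>\<jmath>\<^sub>l\<eta>\<close>.
\<close>

section \<open>Clifford modules\<close>

text \<open>No smoothness of \<xi>, J or R is among the hypotheses; written through spinors, the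
  forms are differentiable because \<eta> is. The encoding is the obstacle: the preferred chart and
  frame jump from point to point, so a derivative at x is taken in the chart and frame chosen at x,
  and invariance under Spin(5) lets nearby fibres be read there. The rotation of that frame leaves
  an extra term, which the factor 1/4 of the spin connection is made to cancel.

  The sign in R\<eta> = - \<jmath>1 \<eta> makes R \<jmath>1 a symmetric involution that fixes
  \<eta> and anticommutes with \<xi>. It splits spinors into even and odd ones, so the
  \<xi>\<eta>-part of the derivative of \<eta> enters d\<omega>_k only next to a factor \<alpha>.
  Each 4 is a 2 from T_k at R times a 2 from alternating S; the 2 before \<phi>_l comes from
  T_k(\<jmath>_l \<eta>). The \<Theta>_l first occur wedged with the form of the third index;
  duality on the four-dimensional \<xi> moves them onto \<omega>_k.\<close>

lemma exhaust_5: "(i::5) = 1 \<or> i = 2 \<or> i = 3 \<or> i = 4 \<or> i = 5"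
proof (induct i)
  case (of_int z)
  then have "0 \<le> z" "z < 5" by simp_all
  then have "z = 0 \<or> z = 1 \<or> z = 2 \<or> z = 3 \<or> z = 4" by arith
  then show ?case by auto
qed

lemma vec_axis_expansion: "v = (\<Sum>i\<in>UNIV. (v $ i) *\<^sub>R axis i (1::real))"
  by (simp add: vec_eq_iff axis_def if_distrib[of "\<lambda>x. _ * x"] cong: if_cong)

lemma vector_5:
  "(vector [x1, x2, x3, x4, x5] :: ('a::zero) ^ 5) $ 1 = x1"
  "(vector [x1, x2, x3, x4, x5] :: 'a ^ 5) $ 2 = x2"
  "(vector [x1, x2, x3, x4, x5] :: 'a ^ 5) $ 3 = x3"
  "(vector [x1, x2, x3, x4, x5] :: 'a ^ 5) $ 4 = x4"
  "(vector [x1, x2, x3, x4, x5] :: 'a ^ 5) $ 5 = x5"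
  by (simp_all add: vector_def)

locale clifford_module =
  fixes cl :: "real ^ 5 \<Rightarrow> 'w::euclidean_space \<Rightarrow> 'w"
  assumes irreducible: "irreducible_clifford_module cl"
begin

lemma bilinear_cl: "bilinear cl"
  using irreducible by (simp add: irreducible_clifford_module_def)

lemma cl_cl: "cl v (cl v w) = - ((norm v)\<^sup>2 *\<^sub>R w)"
  using irreducible by (simp add: irreducible_clifford_module_def)

lemma cl_skew: "inner (cl v w) w' = - inner w (cl v w')"
  using irreducible by (simp add: irreducible_clifford_module_def)

lemmas cl_simps = bilinear_ladd[OF bilinear_cl] bilinear_radd[OF bilinear_cl]
  bilinear_lsub[OF bilinear_cl] bilinear_rsub[OF bilinear_cl]
  bilinear_lmul[OF bilinear_cl] bilinear_rmul[OF bilinear_cl]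
  bilinear_lneg[OF bilinear_cl] bilinear_rneg[OF bilinear_cl]
  bilinear_lzero[OF bilinear_cl] bilinear_rzero[OF bilinear_cl]

lemma linear_cl: "linear (cl v)"
  using bilinear_cl by (simp add: bilinear_def)

text \<open>Polarisation of \<open>cl_cl\<close> at \<open>u + v\<close>.\<close>

lemma cl_anticommute: "cl u (cl v w) = - cl v (cl u w) - (2 * inner u v) *\<^sub>R w"
proof -
  have "cl (u + v) (cl (u + v) w) = - ((norm (u + v))\<^sup>2 *\<^sub>R w)"
    by (rule cl_cl)
  then show ?thesis
    by (simp add: cl_simps cl_cl power2_norm_eq_inner inner_simps algebra_simps inner_commute scaleR_2
        eq_neg_iff_add_eq_0)
qed

lemma cl_eq_0_iff: "cl v w = 0 \<longleftrightarrow> v = 0 \<or> w = 0"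
proof
  assume "cl v w = 0"
  then have "cl v (cl v w) = 0"
    by (simp add: cl_simps)
  then show "v = 0 \<or> w = 0"
    by (simp add: cl_cl)
qed (auto simp: cl_simps)

lemma cl_eqI:
  assumes "cl u w = cl v w" "w \<noteq> 0"
  shows "u = v"
  using assms cl_eq_0_iff[of "u - v" w] by (simp add: cl_simps)

lemma inner_cl_cl: "inner (cl v w) (cl v w') = (norm v)\<^sup>2 * inner w w'"
  by (simp add: cl_skew cl_cl)

definition vol :: "'w \<Rightarrow> 'w" where
  "vol w = cl (axis 1 1) (cl (axis 2 1) (cl (axis 3 1) (cl (axis 4 1) (cl (axis 5 1) w))))"

lemma linear_vol: "linear vol"
  unfolding vol_def by (rule linearI) (simp_all add: cl_simps)

lemma cl_axis_anticommute:
  "i \<noteq> j \<Longrightarrow> cl (axis i 1) (cl (axis j 1) w) = - cl (axis j 1) (cl (axis i 1) w)"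
  using cl_anticommute[of "axis i 1" "axis j 1" w] by (simp add: inner_axis_axis)

lemma cl_axis_cl_axis: "cl (axis i 1) (cl (axis i 1) w) = - w"
  using cl_cl[of "axis i 1" w] by simp

text \<open>The dimension is odd: a basis vector anticommutes with four of the five factors of
  \<open>vol\<close> and commutes with the remaining one, so the total sign is even.\<close>

lemma vol_axis: "vol (cl (axis i 1) w) = cl (axis i 1) (vol w)"
proof -
  \<comment> \<open>Each rule lowers the disorder of the indices, so both sides reach the product in
    increasing order.\<close>
  have [simp]: "cl (axis 2 1) (cl (axis 1 1) w) = - cl (axis 1 1) (cl (axis 2 1) w)"
    "cl (axis 3 1) (cl (axis 1 1) w) = - cl (axis 1 1) (cl (axis 3 1) w)"
    "cl (axis 4 1) (cl (axis 1 1) w) = - cl (axis 1 1) (cl (axis 4 1) w)"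
    "cl (axis 5 1) (cl (axis 1 1) w) = - cl (axis 1 1) (cl (axis 5 1) w)"
    "cl (axis 3 1) (cl (axis 2 1) w) = - cl (axis 2 1) (cl (axis 3 1) w)"
    "cl (axis 4 1) (cl (axis 2 1) w) = - cl (axis 2 1) (cl (axis 4 1) w)"
    "cl (axis 5 1) (cl (axis 2 1) w) = - cl (axis 2 1) (cl (axis 5 1) w)"
    "cl (axis 4 1) (cl (axis 3 1) w) = - cl (axis 3 1) (cl (axis 4 1) w)"
    "cl (axis 5 1) (cl (axis 3 1) w) = - cl (axis 3 1) (cl (axis 5 1) w)"
    "cl (axis 5 1) (cl (axis 4 1) w) = - cl (axis 4 1) (cl (axis 5 1) w)" for w
    by (rule cl_axis_anticommute; simp)+
  show ?thesis
    using exhaust_5[of i]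
    by (elim disjE; simp add: vol_def cl_simps cl_axis_cl_axis)
qed

lemma vol_cl: "vol (cl v w) = cl v (vol w)"
proof -
  have "linear (\<lambda>v. vol (cl v w))"
    by (rule linearI) (simp_all add: cl_simps linear_add[OF linear_vol] linear_cmul[OF linear_vol])
  moreover have "linear (\<lambda>v. cl v (vol w))"
    using bilinear_cl by (simp add: bilinear_def)
  ultimately have "(\<lambda>v. vol (cl v w)) = (\<lambda>v. cl v (vol w))"
    by (rule linear_eq_stdbasis) (auto simp: Basis_vec_def vol_axis)
  then show ?thesis by metis
qed

text \<open>Five skew factors give the sign -1 and reverse their order; the reversal has ten
  inversions and costs no sign.\<close>

lemma vol_skew: "inner (vol w) w' = - inner w (vol w')"
proof -
  have "inner (vol w) w' = - inner w (cl (axis 5 1) (cl (axis 4 1) (cl (axis 3 1) (cl (axis 2 1) (cl (axis 1 1) w')))))"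
    by (simp add: vol_def cl_skew)
  also have "cl (axis 5 1) (cl (axis 4 1) (cl (axis 3 1) (cl (axis 2 1) (cl (axis 1 1) w')))) = vol w'"
    by (simp add: vol_def cl_simps cl_axis_anticommute[of 5] cl_axis_anticommute[of 4 3]
      cl_axis_anticommute[of 4 2] cl_axis_anticommute[of 4 1] cl_axis_anticommute[of 3 2] cl_axis_anticommute[of 3 1]  cl_axis_anticommute[of 2 1])
  finally show ?thesis .
qed

lemma vol_vol: "vol (vol w) = - w"
proof -
  have "vol (vol w) = cl (axis 1 1) (cl (axis 2 1) (cl (axis 3 1) (cl (axis 4 1) (cl (axis 5 1) (vol w)))))"
    by (simp add: vol_def)
  also have "\<dots> = - w"
    by (simp add: vol_def cl_simps cl_axis_cl_axis cl_axis_anticommute[of 5] cl_axis_anticommute[of 4 3]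
      cl_axis_anticommute[of 4 2] cl_axis_anticommute[of 4 1] cl_axis_anticommute[of 3 2] cl_axis_anticommute[of 3 1]  cl_axis_anticommute[of 2 1])
  finally show ?thesis .
qed

text \<open>For a unit vector, u u = -1, hence u v u = v - 2(u,v)u. This turns reflections into
  Clifford products.\<close>

lemma cl_reflection:
  assumes "norm u = 1"
  shows "cl (v - (2 * inner u v) *\<^sub>R u) w = cl u (cl v (cl u w))"
  using cl_anticommute[of u v "cl u w"] assms by (simp add: cl_simps cl_cl)

end

section \<open>Reflections and the volume element of an orthonormal basis\<close>

lemma det_reflection:
  fixes u :: "real ^ 'n"
  assumes "norm u = 1"
  shows "det (matrix (\<lambda>v. v - (2 * inner u v) *\<^sub>R u)) = - 1"
proof -
  \<comment> \<open>An arbitrary index: the reflection in \<open>u\<close> is conjugate, by a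
    rotation taking \<open>axis k 1\<close> to \<open>u\<close>, to a diagonal one.\<close>
  obtain k :: 'n where True by simp
  have "norm (axis k (1::real)) = norm u" using assms by simp
  then obtain T where T: "orthogonal_transformation T" "T (axis k (1::real)) = u"
    by (metis orthogonal_transformation_exists)
  have lT: "linear T" and li: "linear (inv T)"
    using T orthogonal_transformation_inv orthogonal_transformation_linear by blast+
  have bij: "bij T" using T orthogonal_transformation_bij by blast
  define D :: "real ^ 'n \<Rightarrow> real ^ 'n" where "D v = v - (2 * inner (axis k 1) v) *\<^sub>R axis k 1" for v
  have lD: "linear D"
    by (rule linearI) (simp_all add: D_def inner_simps algebra_simps)
  have inn: "inner (T x) (T y) = inner x y" for x y
    using T(1) by (simp add: orthogonal_transformation_def)
  have *: "v - (2 * inner u v) *\<^sub>R u = T (D (inv T v))" for v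
    using inn[of "axis k 1" "inv T v"] bij T(2)
    by (simp add: D_def linear_diff[OF lT] linear_cmul[OF lT] bij_is_surj surj_f_inv_f)
  have "D (axis j 1) = (if j = k then - axis k 1 else axis j 1)" for j
    by (auto simp: D_def inner_axis_axis scaleR_2)
  then have Da: "D (axis j 1) $ i = (if i = j then if j = k then - 1 else 1 else 0)" for i j
    by (simp add: axis_def)
  have "(\<lambda>v. v - (2 * inner u v) *\<^sub>R u) = T \<circ> D \<circ> inv T"
    using * by auto
  then have "matrix (\<lambda>v. v - (2 * inner u v) *\<^sub>R u) = matrix T ** matrix D ** matrix (inv T)"
    using lT li lD by (simp add: matrix_compose linear_compose)
  then have "det (matrix (\<lambda>v. v - (2 * inner u v) *\<^sub>R u)) = det (matrix T ** matrix (inv T)) * det (matrix D)"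
    by (simp add: det_mul)
  also have "matrix T ** matrix (inv T) = mat 1"
    using matrix_compose[OF li lT] bij by (simp add: bij_is_surj surj_iff[THEN iffD1] matrix_id_mat_1)
  also have "det (matrix D) = prod (\<lambda>i. matrix D $ i $ i) UNIV"
    by (rule det_diagonal) (auto simp: matrix_def Da)
  also have "\<dots> = (\<Prod>i\<in>UNIV. if i = k then - 1 else 1)"
    by (rule prod.cong) (auto simp: matrix_def Da)
  finally show ?thesis by simp
qed

lemma reflection_orthogonal:
  fixes u :: "'a::euclidean_space"
  assumes "norm u = 1"
  shows "orthogonal_transformation (\<lambda>v. v - (2 * inner u v) *\<^sub>R u)"
proof -
  have "inner u u = 1" using assms by (simp add: norm_eq_1)
  then show ?thesis
  unfolding orthogonal_transformation_def
  by (auto intro!: linearI simp: inner_simps algebra_simps inner_commute)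
qed

context clifford_module begin

text \<open>Induction in the manner of Cartan and Dieudonne, on the number of basis vectors that are
  moved: composing with one reflection fixes a further basis vector and changes the sign of the
  determinant.\<close>

lemma orthogonal_transformation_vol:
  assumes "orthogonal_transformation T"
  shows "cl (T (axis 1 1)) (cl (T (axis 2 1)) (cl (T (axis 3 1)) (cl (T (axis 4 1)) (cl (T (axis 5 1)) w))))
    = det (matrix T) *\<^sub>R vol w"
  using assms
proof (induction "card {i. T (axis i 1) \<noteq> axis i 1}" arbitrary: T w rule: less_induct)
  case less
  have lT: "linear T" using less.prems orthogonal_transformation_linear by blast
  show ?case
  proof (cases "\<exists>k. T (axis k 1) \<noteq> axis k 1")
    case False
    have "T = id"
      by (rule linear_eq_stdbasis[OF lT linear_id]) (use False in \<open>auto simp: Basis_vec_def\<close>)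
    then show ?thesis by (simp add: vol_def matrix_id_mat_1)
  next
    case True
    then obtain k where k: "T (axis k 1) \<noteq> axis k 1" by blast
    \<comment> \<open>\<open>T (axis k 1)\<close> and \<open>axis k 1\<close> have equal length, so
      the reflection along their difference exchanges them.\<close>
    define d where "d = T (axis k 1) - axis k 1"
    define u where "u = d /\<^sub>R norm d"
    define r where "r v = v - (2 * inner u v) *\<^sub>R u" for v
    have d0: "d \<noteq> 0" using k by (simp add: d_def)
    then have u1: "norm u = 1" by (simp add: u_def)
    have inn: "inner (T x) (T y) = inner x y" for x y
      using less.prems by (simp add: orthogonal_transformation_def)
    have oT: "orthogonal_transformation (r \<circ> T)"
      unfolding r_def by (intro orthogonal_transformation_compose reflection_orthogonal u1 less.prems)
    have lr: "linear r" unfolding r_def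
      using reflection_orthogonal[OF u1] orthogonal_transformation_linear by blast
    \<comment> \<open>A basis vector fixed by \<open>T\<close> is orthogonal to
      \<open>axis k 1\<close> and to its image, hence to \<open>d\<close>; the reflection does not
      move it.\<close>
    have fixed: "r (T (axis i 1)) = axis i 1" if "T (axis i 1) = axis i 1" for i
    proof -
      have "i \<noteq> k" using k that by auto
      then have "inner (axis k 1) (axis i (1::real)) = 0" by (simp add: inner_axis_axis)
      moreover have "inner (T (axis k 1)) (axis i 1) = inner (axis k 1) (axis i (1::real))"
        using inn[of "axis k 1" "axis i 1"] that by simp
      ultimately show ?thesis using that by (simp add: r_def u_def d_def inner_simps)
    qed
    have rk: "r (T (axis k 1)) = axis k 1"
    proof -
      have n: "inner d d = 2 * inner d (T (axis k 1))"
        using inn[of "axis k 1" "axis k 1"] by (simp add: d_def inner_simps inner_commute inner_axis_axis)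
      have "r (T (axis k 1)) = T (axis k 1) - (2 * inner d (T (axis k 1)) / (norm d)\<^sup>2) *\<^sub>R d"
        by (simp add: r_def u_def power2_eq_square divide_simps)
      also have "\<dots> = T (axis k 1) - d"
        using d0 n inner_eq_zero_iff[of d] by (simp add: power2_norm_eq_inner)
      finally show ?thesis by (simp add: d_def)
    qed
    have "{i. (r \<circ> T) (axis i 1) \<noteq> axis i 1} \<subset> {i. T (axis i 1) \<noteq> axis i 1}"
      using fixed rk k by auto
    then have "card {i. (r \<circ> T) (axis i 1) \<noteq> axis i 1} < card {i. T (axis i 1) \<noteq> axis i 1}"
      by (intro psubset_card_mono) auto
    note IH = less.hyps[OF this oT, unfolded o_def]
    have "r = (\<lambda>v. v - (2 * inner u v) *\<^sub>R u)" by (auto simp: r_def)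
    then have "det (matrix (r \<circ> T)) = - det (matrix T)"
      using det_reflection[OF u1] matrix_compose[OF lT lr] by (simp add: det_mul)
    then have dr: "det (matrix (\<lambda>x. r (T x))) = - det (matrix T)" by (simp add: o_def)
    have clr: "cl (r v) w = cl u (cl v (cl u w))" for v w
      unfolding r_def by (rule cl_reflection[OF u1])
    have uu: "cl u (cl u w) = - w" for w using cl_cl[of u w] u1 by simp
    define P where "P w = cl (T (axis 1 1)) (cl (T (axis 2 1)) (cl (T (axis 3 1)) (cl (T (axis 4 1)) (cl (T (axis 5 1)) w))))" for w
    \<comment> \<open>Each reflected factor is u T(e_i) u; the four inner pairs u u contribute
      (-1)^4, and only the outer two u remain. Conjugating by u once more recovers \<open>P\<close>,
      as \<open>vol\<close> commutes with u.\<close>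
    have "cl u (P (cl u w)) = - det (matrix T) *\<^sub>R vol w" for w
      using IH[of w] by (simp add: dr clr uu cl_simps P_def)
    then have "cl u (cl u (P (cl u (cl u w)))) = - det (matrix T) *\<^sub>R cl u (vol (cl u w))"
      by (metis cl_simps(6))
    then show ?thesis by (simp add: uu P_def cl_simps vol_cl)
  qed
qed

text \<open>Proved in one induction over the products of unit vectors. These facts let the scalar
  product, Clifford multiplication and the volume element pass to the associated bundle.\<close>

lemma spin_group_properties:
  assumes "s \<in> spin_group cl"
  shows "linear s" "inner (s x) (s y) = inner x y"
    "\<exists>T. \<forall>v w. cl (T v) (s w) = s (cl v w)"
    "linear t \<Longrightarrow> (\<And>v w. t (cl v w) = - cl v (t w)) \<Longrightarrow> t (s w) = s (t w)"
    "vol (s w) = s (vol w)"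
proof -
  have "linear s \<and> (\<forall>x y. inner (s x) (s y) = inner x y) \<and> (\<exists>T. \<forall>v w. cl (T v) (s w) = s (cl v w)) \<and>
    (\<forall>t. linear t \<and> (\<forall>v w. t (cl v w) = - cl v (t w)) \<longrightarrow> (\<forall>w. t (s w) = s (t w))) \<and>
    (\<forall>w. vol (s w) = s (vol w))"
    using assms
  proof induction
    case 1
    show ?case by (auto simp: linear_ident intro!: exI[of _ "\<lambda>x. x"])
  next
    case (2 s u v)
    obtain T where T: "\<And>v w. cl (T v) (s w) = s (cl v w)" using "2.IH" by blast
    define ru where "ru x = x - (2 * inner u x) *\<^sub>R u" for x
    define rv where "rv x = x - (2 * inner v x) *\<^sub>R v" for x
    \<comment> \<open>Each single vector intertwines up to the sign -1; factors come in pairs, so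
      the signs cancel.\<close>
    have a: "cl (ru x) (cl u w) = - cl u (cl x w)" "cl (rv x) (cl v w) = - cl v (cl x w)" for x w
      using "2.hyps" unfolding ru_def rv_def
      by (simp_all add: cl_reflection cl_cl bilinear_rneg[OF bilinear_cl])
    have "cl ((ru \<circ> rv \<circ> T) x) ((cl u \<circ> cl v \<circ> s) w) = (cl u \<circ> cl v \<circ> s) (cl x w)" for x w
      by (simp add: a T bilinear_rneg[OF bilinear_cl])
    moreover have "linear (cl u \<circ> cl v \<circ> s)"
      using "2.IH" by (intro linear_compose linear_cl) auto
    moreover have "inner ((cl u \<circ> cl v \<circ> s) x) ((cl u \<circ> cl v \<circ> s) y) = inner x y" for x y
      using "2.IH" "2.hyps" by (simp add: inner_cl_cl)
    moreover have "t ((cl u \<circ> cl v \<circ> s) w) = (cl u \<circ> cl v \<circ> s) (t w)"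
      if "linear t" "\<forall>v w. t (cl v w) = - cl v (t w)" for t w
      using "2.IH" that by (simp add: linear_neg bilinear_rneg[OF bilinear_cl])
    moreover have "vol ((cl u \<circ> cl v \<circ> s) w) = (cl u \<circ> cl v \<circ> s) (vol w)" for w
      using "2.IH" by (simp add: vol_cl)
    ultimately show ?case by blast
  qed
  then show "linear s" "inner (s x) (s y) = inner x y"
    "\<exists>T. \<forall>v w. cl (T v) (s w) = s (cl v w)"
    "linear t \<Longrightarrow> (\<And>v w. t (cl v w) = - cl v (t w)) \<Longrightarrow> t (s w) = s (t w)"
    "vol (s w) = s (vol w)"
    by blast+
qed

lemma spin_rotation_intertwines:
  assumes "s \<in> spin_group cl"
  shows "cl (spin_rotation cl s v) (s w) = s (cl v w)"
proof -
  obtain T where T: "\<forall>v w. cl (T v) (s w) = s (cl v w)"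
    using spin_group_properties(3)[OF assms] by blast
  \<comment> \<open>One spinor with nonzero image determines the rotation, since Clifford
    multiplication by a nonzero vector has no kernel.\<close>
  obtain w0 :: 'w where w0: "w0 \<in> Basis" using nonempty_Basis by blast
  then have "inner (s w0) (s w0) \<noteq> 0"
    using spin_group_properties(2)[OF assms, of w0 w0] by simp
  then have "s w0 \<noteq> 0" by auto
  have "(THE T. \<forall>v w. cl (T v) (s w) = s (cl v w)) = T"
  proof (rule the_equality[where P="\<lambda>T. \<forall>v w. cl (T v) (s w) = s (cl v w)", OF T])
    fix T' assume "\<forall>v w. cl (T' v) (s w) = s (cl v w)"
    then have "cl (T' v) (s w0) = cl (T v) (s w0)" for v using T by simp
    then have "T' v = T v" for v using \<open>s w0 \<noteq> 0\<close> by (rule cl_eqI)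
    then show "T' = T" by auto
  qed
  then show ?thesis using T by (simp add: spin_rotation_def)
qed

end

section \<open>Derivatives in charts\<close>

lemma smooth_on_imp_differentiable:
  assumes "smooth_on U f" "open U" "y \<in> U"
  shows "f differentiable (at y)"
proof -
  have "Ck_on (Suc 0) U f" using assms(1) unfolding smooth_on_def by blast
  then have "f differentiable_on U" by simp
  then show ?thesis
    using assms(2,3) differentiable_on_eq_differentiable_at by blast
qed

section \<open>Differentiation of families of bilinear maps\<close>

lemma bilinear_expand_Basis:
  fixes B :: "'a::euclidean_space \<Rightarrow> 'b::euclidean_space \<Rightarrow> 'c::real_vector"
  assumes "bilinear B"
  shows "B u v = (\<Sum>i\<in>Basis. \<Sum>j\<in>Basis. (inner u i * inner v j) *\<^sub>R B i j)"
proof -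
  have "B u v = B (\<Sum>i\<in>Basis. inner u i *\<^sub>R i) (\<Sum>j\<in>Basis. inner v j *\<^sub>R j)"
    by (simp add: euclidean_representation)
  also have "\<dots> = (\<Sum>(i,j)\<in>Basis \<times> Basis. B (inner u i *\<^sub>R i) (inner v j *\<^sub>R j))"
    by (rule bilinear_sum[OF assms])
  also have "\<dots> = (\<Sum>i\<in>Basis. \<Sum>j\<in>Basis. (inner u i * inner v j) *\<^sub>R B i j)"
    by (simp add: sum.cartesian_product bilinear_lmul[OF assms] bilinear_rmul[OF assms] mult.commute)
  finally show ?thesis .
qed

text \<open>The laws of bilinearity are identities in \<open>y\<close> near \<open>y0\<close>;
  differentiating both sides and comparing, by uniqueness of the derivative, gives the same laws for
  \<open>B'\<close>.\<close>

lemma has_derivative_bilinear_derivative: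
  fixes B :: "'x::euclidean_space \<Rightarrow> 'a::real_vector \<Rightarrow> 'b::real_vector \<Rightarrow> 'c::real_normed_vector"
  assumes "open D" "y0 \<in> D" and bil: "\<And>y. y \<in> D \<Longrightarrow> bilinear (B y)"
    and B': "\<And>a b. ((\<lambda>y. B y a b) has_derivative (\<lambda>w. B' w a b)) (at y0)"
  shows "bilinear (B' w)"
proof -
  have 1: "B' w (a + a') b = B' w a b + B' w a' b" for a a' b
  proof -
    have "((\<lambda>y. B y a b + B y a' b) has_derivative (\<lambda>w. B' w a b + B' w a' b)) (at y0)"
      by (intro has_derivative_add B')
    then have "((\<lambda>y. B y (a + a') b) has_derivative (\<lambda>w. B' w a b + B' w a' b)) (at y0)"
      by (rule has_derivative_transform_within_open[OF _ assms(1,2)]) (simp add: bil bilinear_ladd)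
    from has_derivative_unique[OF this B'] show ?thesis by metis
  qed
  have 2: "B' w a (b + b') = B' w a b + B' w a b'" for a b b'
  proof -
    have "((\<lambda>y. B y a b + B y a b') has_derivative (\<lambda>w. B' w a b + B' w a b')) (at y0)"
      by (intro has_derivative_add B')
    then have "((\<lambda>y. B y a (b + b')) has_derivative (\<lambda>w. B' w a b + B' w a b')) (at y0)"
      by (rule has_derivative_transform_within_open[OF _ assms(1,2)]) (simp add: bil bilinear_radd)
    from has_derivative_unique[OF this B'] show ?thesis by metis
  qed
  have 3: "B' w (r *\<^sub>R a) b = r *\<^sub>R B' w a b" for r a b
  proof -
    have "((\<lambda>y. r *\<^sub>R B y a b) has_derivative (\<lambda>w. r *\<^sub>R B' w a b)) (at y0)"
      by (intro has_derivative_scaleR_right B')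
    then have "((\<lambda>y. B y (r *\<^sub>R a) b) has_derivative (\<lambda>w. r *\<^sub>R B' w a b)) (at y0)"
      by (rule has_derivative_transform_within_open[OF _ assms(1,2)]) (simp add: bil bilinear_lmul)
    from has_derivative_unique[OF this B'] show ?thesis by metis
  qed
  have 4: "B' w a (r *\<^sub>R b) = r *\<^sub>R B' w a b" for r a b
  proof -
    have "((\<lambda>y. r *\<^sub>R B y a b) has_derivative (\<lambda>w. r *\<^sub>R B' w a b)) (at y0)"
      by (intro has_derivative_scaleR_right B')
    then have "((\<lambda>y. B y a (r *\<^sub>R b)) has_derivative (\<lambda>w. r *\<^sub>R B' w a b)) (at y0)"
      by (rule has_derivative_transform_within_open[OF _ assms(1,2)]) (simp add: bil bilinear_rmul)
    from has_derivative_unique[OF this B'] show ?thesis by metis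
  qed
  show ?thesis unfolding bilinear_def by (auto intro!: linearI 1 2 3 4)
qed

text \<open>Leibniz rule when \<open>B\<close> is differentiable only for fixed arguments, as is the
  case for components of a tensor: a basis expansion leaves a finite sum of products.\<close>

lemma has_derivative_bilinear_family:
  fixes B :: "'x::euclidean_space \<Rightarrow> 'a::euclidean_space \<Rightarrow> 'b::euclidean_space \<Rightarrow> 'c::real_normed_vector"
  assumes "open D" "y0 \<in> D" and bil: "\<And>y. y \<in> D \<Longrightarrow> bilinear (B y)"
    and B': "\<And>a b. ((\<lambda>y. B y a b) has_derivative (\<lambda>w. B' w a b)) (at y0)"
    and f: "(f has_derivative f') (at y0)" and h: "(h has_derivative h') (at y0)"
  shows "((\<lambda>y. B y (f y) (h y)) has_derivative
    (\<lambda>w. B' w (f y0) (h y0) + B y0 (f' w) (h y0) + B y0 (f y0) (h' w))) (at y0)"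
proof -
  have bil': "bilinear (B' w)" for w
    by (rule has_derivative_bilinear_derivative[OF assms(1-4)])
  have "((\<lambda>y. \<Sum>i\<in>Basis. \<Sum>j\<in>Basis. (inner (f y) i * inner (h y) j) *\<^sub>R B y i j) has_derivative
    (\<lambda>w. \<Sum>i\<in>Basis. \<Sum>j\<in>Basis. (inner (f y0) i * inner (h y0) j) *\<^sub>R B' w i j
      + (inner (f y0) i * inner (h' w) j + inner (f' w) i * inner (h y0) j) *\<^sub>R B y0 i j)) (at y0)"
    by (intro has_derivative_sum has_derivative_scaleR has_derivative_mult has_derivative_inner_left f h B')
  also have "(\<lambda>w. \<Sum>i\<in>Basis. \<Sum>j\<in>Basis. (inner (f y0) i * inner (h y0) j) *\<^sub>R B' w i j
      + (inner (f y0) i * inner (h' w) j + inner (f' w) i * inner (h y0) j) *\<^sub>R B y0 i j)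
    = (\<lambda>w. B' w (f y0) (h y0) + B y0 (f' w) (h y0) + B y0 (f y0) (h' w))"
    unfolding bilinear_expand_Basis[OF bil', of _ "f y0" "h y0"]
      bilinear_expand_Basis[OF bil[OF assms(2)], of "f y0" "h' _"]
      bilinear_expand_Basis[OF bil[OF assms(2)], of "f' _" "h y0"]
    by (simp add: sum.distrib algebra_simps)
  finally show ?thesis
    by (rule has_derivative_transform_within_open[OF _ assms(1,2)])
      (simp add: bil bilinear_expand_Basis[symmetric])
qed

section \<open>Charts, transition maps and components of fields\<close>

locale atlas =
  fixes A :: "'m::{t2_space, second_countable_topology} chart set"
  assumes oriented_atlas: "oriented_atlas A"
begin

lemma chart_at: "chart_at A x \<in> A" "x \<in> chart_dom (chart_at A x)"
proof -
  have "\<exists>c. c \<in> A \<and> x \<in> chart_dom c" using oriented_atlas by (auto simp: oriented_atlas_def)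
  from someI_ex[OF this] show "chart_at A x \<in> A" "x \<in> chart_dom (chart_at A x)"
    by (auto simp: chart_at_def)
qed

lemma is_chart: "c \<in> A \<Longrightarrow> is_chart c"
  using oriented_atlas by (auto simp: oriented_atlas_def)

lemma open_chart_dom: "c \<in> A \<Longrightarrow> open (chart_dom c)"
  using is_chart by (auto simp: is_chart_def)

lemma chart_inv_map: "c \<in> A \<Longrightarrow> x \<in> chart_dom c \<Longrightarrow> chart_inv c (chart_map c x) = x"
  using is_chart[of c] by (auto simp: is_chart_def homeomorphism_def)

lemma open_chart_image:
  assumes "c \<in> A" "open U"
  shows "open (chart_map c ` (chart_dom c \<inter> U))"
proof -
  have h: "homeomorphism (chart_dom c) (chart_map c ` chart_dom c) (chart_map c) (chart_inv c)"
    and o: "open (chart_map c ` chart_dom c)"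
    using is_chart[OF assms(1)] by (auto simp: is_chart_def)
  have "openin (top_of_set (chart_map c ` chart_dom c)) (chart_map c ` (chart_dom c \<inter> U))"
    by (rule homeomorphism_imp_open_map[OF h]) (simp add: assms(2) openin_open_Int)
  then show ?thesis using o openin_open_trans by blast
qed

lemma transition_differentiable:
  assumes "c \<in> A" "d \<in> A" "x \<in> chart_dom c" "x \<in> chart_dom d"
  shows "(chart_map d \<circ> chart_inv c) differentiable (at (chart_map c x))"
proof (rule smooth_on_imp_differentiable)
  show "smooth_on (chart_map c ` (chart_dom c \<inter> chart_dom d)) (chart_map d \<circ> chart_inv c)"
    using oriented_atlas assms by (auto simp: oriented_atlas_def)
  show "open (chart_map c ` (chart_dom c \<inter> chart_dom d))"
    using assms open_chart_image open_chart_dom by blast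
qed (use assms in auto)

text \<open>Chain rule for the two transition maps, whose composite is the identity near the
  point.\<close>

lemma transition_derivative:
  assumes "c \<in> A" "d \<in> A" "x \<in> chart_dom c" "x \<in> chart_dom d"
  shows "frechet_derivative (chart_map c \<circ> chart_inv d) (at (chart_map d x))
    (frechet_derivative (chart_map d \<circ> chart_inv c) (at (chart_map c x)) v) = v"
proof -
  let ?f = "chart_map d \<circ> chart_inv c" and ?h = "chart_map c \<circ> chart_inv d"
  have fx: "?f (chart_map c x) = chart_map d x" using assms by (simp add: chart_inv_map)
  have "(?f has_derivative frechet_derivative ?f (at (chart_map c x))) (at (chart_map c x))"
    "(?h has_derivative frechet_derivative ?h (at (chart_map d x))) (at (?f (chart_map c x)))"
    unfolding fx using transition_differentiable assms by (auto simp: frechet_derivative_works[symmetric])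
  from diff_chain_at[OF this]
  have 1: "(?h \<circ> ?f has_derivative
      (frechet_derivative ?h (at (chart_map d x)) \<circ> frechet_derivative ?f (at (chart_map c x)))) (at (chart_map c x))" .
  have 2: "(?h \<circ> ?f has_derivative (\<lambda>v. v)) (at (chart_map c x))"
    by (rule has_derivative_transform_within_open[OF has_derivative_ident
          open_chart_image[OF assms(1) open_chart_dom[OF assms(2)]]])
      (use assms in \<open>auto simp: chart_inv_map\<close>)
  from has_derivative_unique[OF 1 2] show ?thesis by (metis comp_apply)
qed

lemma transition_derivative_self:
  assumes "c \<in> A" "x \<in> chart_dom c"
  shows "frechet_derivative (chart_map c \<circ> chart_inv c) (at (chart_map c x)) v = v"
proof -
  have "(chart_map c \<circ> chart_inv c has_derivative (\<lambda>v. v)) (at (chart_map c x))"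
    by (rule has_derivative_transform_within_open[OF has_derivative_ident
          open_chart_image[OF assms(1) open_UNIV]])
      (use assms in \<open>auto simp: chart_inv_map\<close>)
  from frechet_derivative_at[OF this] show ?thesis by metis
qed

text \<open>Components in the preferred chart of \<open>x\<close> are the vector itself, but at
  \<open>x\<close> only: another point of this chart may prefer a different one.\<close>

lemma to_coord_chart_at: "to_coord A (chart_at A x) x v = v"
  by (simp add: to_coord_def transition_derivative_self chart_at)

lemma of_coord_chart_at: "of_coord A (chart_at A x) x v = v"
  by (simp add: of_coord_def transition_derivative_self chart_at)

lemma of_coord_to_coord:
  "c \<in> A \<Longrightarrow> x \<in> chart_dom c \<Longrightarrow> of_coord A c x (to_coord A c x v) = v"
  unfolding of_coord_def to_coord_def by (intro transition_derivative chart_at)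

lemma linear_of_coord:
  "c \<in> A \<Longrightarrow> x \<in> chart_dom c \<Longrightarrow> linear (of_coord A c x)"
  unfolding of_coord_def
  using linear_frechet_derivative[OF transition_differentiable[OF _ chart_at(1) _ chart_at(2)]] by auto

lemma form_coord_chart_at:
  "form_coord A (chart_at A x) \<beta> (chart_map (chart_at A x) x) a b = \<beta> x a b"
  by (simp add: form_coord_def chart_inv_map chart_at of_coord_chart_at)

lemma field_coord_chart_at:
  "field_coord A (chart_at A x) X (chart_map (chart_at A x) x) = X x"
  by (simp add: field_coord_def chart_inv_map chart_at to_coord_chart_at)

lemma bilinear_form_coord:
  assumes "c \<in> A" "y \<in> chart_map c ` chart_dom c" "\<And>x. bilinear (\<beta> x)"
  shows "bilinear (form_coord A c \<beta> y)"
proof -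
  have "linear (of_coord A c (chart_inv c y))"
    using assms(1,2) by (auto simp: chart_inv_map linear_of_coord)
  then show ?thesis unfolding bilinear_def form_coord_def
    by (auto intro!: linearI simp: linear_add linear_cmul bilinear_ladd[OF assms(3)]
        bilinear_radd[OF assms(3)] bilinear_lmul[OF assms(3)] bilinear_rmul[OF assms(3)])
qed

end

section \<open>The Levi-Civita connection and the spin connection\<close>

lemma has_derivative_zero_const:
  assumes "open D" "y0 \<in> D" "\<And>y. y \<in> D \<Longrightarrow> f y = c" "(f has_derivative f') (at y0)"
  shows "f' w = 0"
proof -
  have "(f has_derivative (\<lambda>_. 0)) (at y0)"
    by (rule has_derivative_transform_within_open[OF has_derivative_const[of c] assms(1,2)])
      (simp add: assms(3))
  from has_derivative_unique[OF assms(4) this] show ?thesis by metis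
qed

locale riemannian_atlas = atlas A for A :: "'m::{t2_space, second_countable_topology} chart set" +
  fixes g :: "'m \<Rightarrow> real ^ 5 \<Rightarrow> real ^ 5 \<Rightarrow> real"
  assumes riemannian_metric: "riemannian_metric A g"
begin

lemma bilinear_metric: "bilinear (g x)"
  and metric_commute: "g x u v = g x v u"
  and metric_pos: "v \<noteq> 0 \<Longrightarrow> g x v v > 0"
  using riemannian_metric by (auto simp: riemannian_metric_def)

lemmas metric_simps = bilinear_ladd[OF bilinear_metric] bilinear_radd[OF bilinear_metric]
  bilinear_lsub[OF bilinear_metric] bilinear_rsub[OF bilinear_metric]
  bilinear_lmul[OF bilinear_metric] bilinear_rmul[OF bilinear_metric]
  bilinear_lneg[OF bilinear_metric] bilinear_rneg[OF bilinear_metric]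
  bilinear_lzero[OF bilinear_metric] bilinear_rzero[OF bilinear_metric]

lemma metric_eqI:
  assumes "\<And>w. g x u w = g x v w"
  shows "u = v"
  using metric_pos[of "u - v" x] assms[of "u - v"] by (fastforce simp: metric_simps)

lemma metric_has_derivative:
  "((\<lambda>y. form_coord A (chart_at A x) g y a b) has_derivative (\<lambda>w. form_deriv A g x w a b))
    (at (chart_map (chart_at A x) x))"
proof -
  have "(\<lambda>y. form_coord A (chart_at A x) g y a b) differentiable (at (chart_map (chart_at A x) x))"
    by (rule smooth_on_imp_differentiable[where U = "chart_map (chart_at A x) ` chart_dom (chart_at A x)"])
      (use riemannian_metric chart_at[of x] open_chart_image[OF chart_at(1) open_UNIV, of x]
        in \<open>auto simp: riemannian_metric_def\<close>)
  then show ?thesis by (simp add: frechet_derivative_works form_deriv_def)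
qed

lemma bilinear_form_deriv: "bilinear (form_deriv A g x w)"
  by (rule has_derivative_bilinear_derivative[OF open_chart_image[OF chart_at(1) open_UNIV] _ _ metric_has_derivative])
    (auto intro!: bilinear_form_coord chart_at bilinear_metric)

lemma form_deriv_commute: "form_deriv A g x w a b = form_deriv A g x w b a"
  by (simp add: form_deriv_def form_coord_def metric_commute)

lemma linear_form_deriv: "linear (\<lambda>w. form_deriv A g x w a b)"
  using metric_has_derivative has_derivative_linear by blast

text \<open>The Koszul formula for coordinate fields, whose brackets vanish. The orthonormal frame
  \<open>F\<close> serves to represent linear functionals by vectors.\<close>

lemma christoffel_exists:
  fixes F :: "real ^ 5 \<Rightarrow> real ^ 5"
  assumes F: "linear F" "\<And>u v. g x (F u) (F v) = inner u v"
  shows "\<exists>!\<Gamma>. bilinear \<Gamma> \<and> (\<forall>u v. \<Gamma> u v = \<Gamma> v u) \<and>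
     (\<forall>u a b. form_deriv A g x u a b = g x (\<Gamma> u a) b + g x a (\<Gamma> u b))"
proof -
  let ?D = "form_deriv A g x"
  \<comment> \<open>Half of the Koszul combination, the value that symmetry and metric compatibility
    force on g(\<Gamma>(u, a), b).\<close>
  define K where "K u a b = (?D u a b + ?D a u b - ?D b u a) / 2" for u a b
  note D_simps = linear_add[OF linear_form_deriv] linear_cmul[OF linear_form_deriv]
    bilinear_ladd[OF bilinear_form_deriv] bilinear_radd[OF bilinear_form_deriv]
    bilinear_lmul[OF bilinear_form_deriv] bilinear_rmul[OF bilinear_form_deriv]
  have linK: "linear (K u a)" for u a
    by (rule linearI) (simp_all add: K_def D_simps algebra_simps add_divide_distrib diff_divide_distrib)
  have linK1: "linear (\<lambda>u. K u a b)" for a b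
    by (rule linearI) (simp_all add: K_def D_simps algebra_simps add_divide_distrib diff_divide_distrib)
  have linK2: "linear (\<lambda>a. K u a b)" for u b
    by (rule linearI) (simp_all add: K_def D_simps algebra_simps add_divide_distrib diff_divide_distrib)
  have "inj F"
  proof (rule injI)
    fix u v assume "F u = F v"
    then have "g x (F (u - v)) (F (u - v)) = 0"
      by (simp add: linear_diff[OF F(1)] metric_simps)
    then show "u = v" by (simp add: F(2))
  qed
  then have surj: "surj F" by (rule linear_inj_imp_surj[OF F(1)])
  \<comment> \<open>The vector that represents the functional \<open>K u a\<close>, expanded in the
    orthonormal basis \<open>F i\<close>.\<close>
  define \<Gamma> where "\<Gamma> u a = (\<Sum>i\<in>Basis. K u a (F i) *\<^sub>R F i)" for u a
  have g\<Gamma>: "g x (\<Gamma> u a) b = K u a b" for u a b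
  proof -
    obtain v where v: "b = F v" using surj by blast
    have lin: "linear (\<lambda>z. g x z b)"
      by (rule linearI) (simp_all add: metric_simps)
    have "g x (\<Gamma> u a) b = (\<Sum>i\<in>Basis. g x (K u a (F i) *\<^sub>R F i) b)"
      by (simp only: \<Gamma>_def linear_sum[OF lin])
    also have "\<dots> = (\<Sum>i\<in>Basis. K u a (F i) * inner i v)"
      by (simp add: metric_simps v F(2))
    also have "\<dots> = K u a (F (\<Sum>i\<in>Basis. inner v i *\<^sub>R i))"
      by (simp add: linear_sum[OF F(1)] linear_sum[OF linK] linear_cmul[OF F(1)] linear_cmul[OF linK]
          inner_commute mult.commute)
    finally show ?thesis by (simp add: v euclidean_representation)
  qed
  have "bilinear \<Gamma>" unfolding bilinear_def
    by (auto intro!: linearI metric_eqI[of x] simp: g\<Gamma> metric_simps linear_add[OF linK1]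
      linear_cmul[OF linK1] linear_add[OF linK2] linear_cmul[OF linK2])
  moreover have "\<Gamma> u v = \<Gamma> v u" for u v
    by (rule metric_eqI[of x]) (simp add: g\<Gamma> K_def form_deriv_commute[of x _ u v])
  moreover have "?D u a b = g x (\<Gamma> u a) b + g x a (\<Gamma> u b)" for u a b
    using form_deriv_commute[of x u a b] form_deriv_commute[of x a u b] form_deriv_commute[of x b u a]
    by (simp add: metric_commute[of x a] g\<Gamma> K_def field_simps)
  ultimately have ex: "bilinear \<Gamma> \<and> (\<forall>u v. \<Gamma> u v = \<Gamma> v u) \<and>
      (\<forall>u a b. ?D u a b = g x (\<Gamma> u a) b + g x a (\<Gamma> u b))" by blast
  have "\<Gamma>' = \<Gamma>" if \<Gamma>': "\<forall>u v. \<Gamma>' u v = \<Gamma>' v u"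
    "\<forall>u a b. ?D u a b = g x (\<Gamma>' u a) b + g x a (\<Gamma>' u b)" for \<Gamma>'
  proof (intro ext metric_eqI[of x])
    fix u a b
    \<comment> \<open>For any candidate, the same combination cancels all terms but two equal ones,
      which determines it.\<close>
    have "?D u a b + ?D a u b - ?D b u a = 2 * g x (\<Gamma>' u a) b"
      using \<Gamma>'(1)[rule_format, of a u] \<Gamma>'(1)[rule_format, of b u] \<Gamma>'(1)[rule_format, of b a]
      by (simp add: \<Gamma>'(2) metric_commute[of x u] metric_commute[of x a])
    then show "g x (\<Gamma>' u a) b = g x (\<Gamma> u a) b" by (simp add: g\<Gamma> K_def)
  qed
  then show ?thesis by (intro ex1I[of _ \<Gamma>]) (use ex in blast)+
qed

lemma christoffel:
  fixes F :: "real ^ 5 \<Rightarrow> real ^ 5"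
  assumes F: "linear F" "\<And>u v. g x (F u) (F v) = inner u v"
  shows "bilinear (christoffel A g x)" "christoffel A g x u v = christoffel A g x v u"
    "form_deriv A g x u a b = g x (christoffel A g x u a) b + g x a (christoffel A g x u b)"
  using theI'[OF christoffel_exists[OF assms]] unfolding christoffel_def[symmetric] by blast+

end

context clifford_module begin

text \<open>The operator \<open>(\<Sum>\<^sub>i\<^sub>j \<Gamma>\<^sub>i\<^sub>j e\<^sub>i e\<^sub>j) / 4\<close> is the image of the skew-symmetric matrix \<open>\<Gamma>\<close> under \<open>so(5) \<cong> spin(5)\<close>.\<close>

definition spin_lift :: "(5 \<Rightarrow> 5 \<Rightarrow> real) \<Rightarrow> 'w \<Rightarrow> 'w" where
  "spin_lift \<Gamma> w = (1/4) *\<^sub>R (\<Sum>i\<in>UNIV. \<Sum>j\<in>UNIV. \<Gamma> i j *\<^sub>R cl (axis i 1) (cl (axis j 1) w))"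

text \<open>The adjoint of e_i e_j is e_j e_i, and exchanging the indices of a skew matrix changes
  the sign. This makes the spin connection metric.\<close>

lemma spin_lift_skew:
  assumes "\<And>i j. \<Gamma> i j = - \<Gamma> j i"
  shows "inner (spin_lift \<Gamma> w) w' = - inner w (spin_lift \<Gamma> w')"
proof -
  have "4 * inner (spin_lift \<Gamma> w) w' = (\<Sum>i\<in>UNIV. \<Sum>j\<in>UNIV. \<Gamma> i j * inner w (cl (axis j 1) (cl (axis i 1) w')))"
    by (simp add: spin_lift_def inner_sum_left cl_skew)
  also have "\<dots> = (\<Sum>i\<in>UNIV. \<Sum>j\<in>UNIV. \<Gamma> j i * inner w (cl (axis i 1) (cl (axis j 1) w')))"
    by (rule sum.swap)
  also have "\<dots> = - (\<Sum>i\<in>UNIV. \<Sum>j\<in>UNIV. \<Gamma> i j * inner w (cl (axis i 1) (cl (axis j 1) w')))"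
    unfolding sum_negf[symmetric] by (intro sum.cong refl) (subst assms, simp)
  also have "\<dots> = - 4 * inner w (spin_lift \<Gamma> w')"
    by (simp add: spin_lift_def inner_sum_right)
  finally show ?thesis by simp
qed

text \<open>The commutator of a vector with the lift is the matrix applied to that vector. Moving v
  past e_i and e_j leaves two contractions, each worth 2 \<Gamma> v; the factor 1/4 in
  \<open>spin_lift\<close> normalises their sum.\<close>

lemma cl_spin_lift:
  assumes skew: "\<And>i j. \<Gamma> i j = - \<Gamma> j i"
  shows "cl v (spin_lift \<Gamma> w) = spin_lift \<Gamma> (cl v w) + cl (\<Sum>i\<in>UNIV. (\<Sum>j\<in>UNIV. \<Gamma> i j * v $ j) *\<^sub>R axis i 1) w"
proof -
  let ?e = "\<lambda>i::5. axis i (1::real)"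
  have 1: "cl v (cl (?e i) (cl (?e j) w)) = cl (?e i) (cl (?e j) (cl v w)) + (2 * v $ j) *\<^sub>R cl (?e i) w - (2 * v $ i) *\<^sub>R cl (?e j) w" for i j
    using cl_anticommute[of v "?e i" "cl (?e j) w"] cl_anticommute[of v "?e j" "w"]
    by (simp add: cl_simps inner_axis algebra_simps)
  have "4 *\<^sub>R cl v (spin_lift \<Gamma> w) = (\<Sum>i\<in>UNIV. \<Sum>j\<in>UNIV. \<Gamma> i j *\<^sub>R cl v (cl (?e i) (cl (?e j) w)))"
    by (simp add: spin_lift_def cl_simps linear_sum[OF linear_cl])
  also have "\<dots> = (\<Sum>i\<in>UNIV. \<Sum>j\<in>UNIV. \<Gamma> i j *\<^sub>R cl (?e i) (cl (?e j) (cl v w)))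
    + (\<Sum>i\<in>UNIV. \<Sum>j\<in>UNIV. (2 * \<Gamma> i j * v $ j) *\<^sub>R cl (?e i) w)
    - (\<Sum>i\<in>UNIV. \<Sum>j\<in>UNIV. (2 * \<Gamma> i j * v $ i) *\<^sub>R cl (?e j) w)"
    by (simp add: 1 sum.distrib sum_subtractf algebra_simps)
  also have "(\<Sum>i\<in>UNIV. \<Sum>j\<in>UNIV. (2 * \<Gamma> i j * v $ i) *\<^sub>R cl (?e j) w)
     = (\<Sum>i\<in>UNIV. \<Sum>j\<in>UNIV. (2 * \<Gamma> j i * v $ j) *\<^sub>R cl (?e i) w)"
    by (rule sum.swap)
  also have "\<dots> = - (\<Sum>i\<in>UNIV. \<Sum>j\<in>UNIV. (2 * \<Gamma> i j * v $ j) *\<^sub>R cl (?e i) w)"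
    unfolding sum_negf[symmetric] by (intro sum.cong refl) (subst skew, simp)
  also have "(\<Sum>i\<in>UNIV. \<Sum>j\<in>UNIV. (2 * \<Gamma> i j * v $ j) *\<^sub>R cl (?e i) w)
    = 2 *\<^sub>R cl (\<Sum>i\<in>UNIV. (\<Sum>j\<in>UNIV. \<Gamma> i j * v $ j) *\<^sub>R ?e i) w"
  proof -
    have "linear (\<lambda>v. cl v w)" using bilinear_cl by (simp add: bilinear_def)
    note S = linear_sum[OF this]
    show ?thesis
      by (simp add: S cl_simps scaleR_sum_right scaleR_sum_left mult.assoc sum_distrib_left)
  qed
  finally have "4 *\<^sub>R cl v (spin_lift \<Gamma> w) = 4 *\<^sub>R (spin_lift \<Gamma> (cl v w) + cl (\<Sum>i\<in>UNIV. (\<Sum>j\<in>UNIV. \<Gamma> i j * v $ j) *\<^sub>R ?e i) w)"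
    using scaleR_left_distrib[of 2 2, symmetric] by (simp add: spin_lift_def algebra_simps)
  then show ?thesis by simp
qed

end

section \<open>Exterior derivatives of forms built from spinors\<close>

locale spin_manifold =
  fixes M :: "('m::{t2_space, second_countable_topology}, 'w::euclidean_space, 'i) spin_manifold"
  assumes spin_manifold: "oriented_riemannian_spin_manifold M"

sublocale spin_manifold \<subseteq> riemannian_atlas "charts M" "metric M"
  using spin_manifold by unfold_locales (auto simp: oriented_riemannian_spin_manifold_def)

sublocale spin_manifold \<subseteq> clifford_module "clif M"
  using spin_manifold by unfold_locales (auto simp: oriented_riemannian_spin_manifold_def)

context spin_manifold begin

section \<open>Frames, transition functions and bundle operations\<close>

lemma spin_structure: "spin_structure M"
  using spin_manifold by (auto simp: oriented_riemannian_spin_manifold_def)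

lemma spin_structureD:
  shows "\<forall>a\<in>idx M. open (frame_dom M a)" "(\<Union>a\<in>idx M. frame_dom M a) = UNIV"
    "\<forall>a\<in>idx M. \<forall>x\<in>frame_dom M a. linear (frame M a x) \<and>
        (\<forall>u v. metric M x (frame M a x u) (frame M a x v) = inner u v) \<and> det (matrix (frame M a x)) > 0"
    "\<forall>a\<in>idx M. \<forall>u. smooth_field_on (charts M) (frame_dom M a) (\<lambda>x. frame M a x u)"
    "\<forall>a\<in>idx M. \<forall>b\<in>idx M.
        (\<forall>x\<in>frame_dom M a \<inter> frame_dom M b.
           trans M a b x \<in> spin_group (clif M) \<and>
           frame M b x = frame M a x \<circ> spin_rotation (clif M) (trans M a b x)) \<and>
        (\<forall>w. smooth_map_on (charts M) (frame_dom M a \<inter> frame_dom M b) (\<lambda>x. trans M a b x w))"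
    "\<forall>a\<in>idx M. \<forall>b\<in>idx M. \<forall>c\<in>idx M. \<forall>x\<in>frame_dom M a \<inter> frame_dom M b \<inter> frame_dom M c.
           trans M a b x \<circ> trans M b c x = trans M a c x"
  using spin_structure unfolding spin_structure_def by - (elim conjE, assumption)+

lemma idx_at: "idx_at M x \<in> idx M" "x \<in> frame_dom M (idx_at M x)"
proof -
  have "\<exists>a. a \<in> idx M \<and> x \<in> frame_dom M a"
    using spin_structureD(2) by blast
  from someI_ex[OF this] show "idx_at M x \<in> idx M" "x \<in> frame_dom M (idx_at M x)"
    by (auto simp: idx_at_def)
qed

lemma open_frame_dom: "a \<in> idx M \<Longrightarrow> open (frame_dom M a)"
  using spin_structureD(1) by blast

lemma frame:
  assumes "a \<in> idx M" "x \<in> frame_dom M a"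
  shows "linear (frame M a x)" "metric M x (frame M a x u) (frame M a x v) = inner u v"
    "det (matrix (frame M a x)) > 0"
  using spin_structureD(3) assms by blast+

lemma bij_frame:
  assumes "a \<in> idx M" "x \<in> frame_dom M a"
  shows "bij (frame M a x)"
proof -
  have "inj (frame M a x)"
  proof (rule injI)
    fix u v assume "frame M a x u = frame M a x v"
    then have "metric M x (frame M a x (u - v)) (frame M a x (u - v)) = 0"
      by (simp add: linear_diff[OF frame(1)[OF assms]] metric_simps)
    then show "u = v" by (simp add: frame(2)[OF assms])
  qed
  then show ?thesis
    by (simp add: bij_def linear_inj_imp_surj[OF frame(1)[OF assms]])
qed

lemma frame_inv [simp]:
  assumes "a \<in> idx M" "x \<in> frame_dom M a"
  shows "frame M a x (inv (frame M a x) v) = v" "inv (frame M a x) (frame M a x v) = v"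
  using bij_frame[OF assms] by (simp_all add: bij_is_inj bij_is_surj surj_f_inv_f)

lemma linear_inv_frame:
  assumes "a \<in> idx M" "x \<in> frame_dom M a"
  shows "linear (inv (frame M a x))"
proof (rule linearI)
  let ?F = "frame M a x"
  note bij = bij_frame[OF assms, THEN bij_is_inj]
  show "inv ?F (u + v) = inv ?F u + inv ?F v" for u v
    by (rule injD[OF bij]) (simp add: linear_add[OF frame(1)[OF assms]] assms)
  show "inv ?F (r *\<^sub>R v) = r *\<^sub>R inv ?F v" for r v
    by (rule injD[OF bij]) (simp add: linear_cmul[OF frame(1)[OF assms]] assms)
qed

lemma trans_spin_group:
  assumes "a \<in> idx M" "b \<in> idx M" "x \<in> frame_dom M a" "x \<in> frame_dom M b"
  shows "trans M a b x \<in> spin_group (clif M)"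
    "frame M b x = frame M a x \<circ> spin_rotation (clif M) (trans M a b x)"
  using spin_structureD(5) assms by blast+

text \<open>The cocycle condition makes this map idempotent, and an injective idempotent map is the
  identity.\<close>

lemma trans_self:
  assumes "a \<in> idx M" "x \<in> frame_dom M a"
  shows "trans M a a x w = w"
proof -
  have s: "trans M a a x \<in> spin_group (clif M)" using trans_spin_group assms by blast
  have "trans M a a x (trans M a a x w) = trans M a a x w"
    using spin_structureD(6)[rule_format, of a a a x] assms by (simp add: fun_eq_iff)
  then have "trans M a a x (trans M a a x w - w) = 0"
    using spin_group_properties(1)[OF s] by (simp add: linear_diff)
  then have "inner (trans M a a x w - w) (trans M a a x w - w) = 0"
    using spin_group_properties(2)[OF s] by (metis inner_zero_left)
  then show ?thesis by simp
qed

lemma spinor_coord_idx_at: "spinor_coord M (idx_at M x) \<psi> x = \<psi> x"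
  by (simp add: spinor_coord_def trans_self idx_at)

text \<open>Fibrewise Clifford multiplication is defined through the preferred frame; equivariance
  gives it the same expression in every trivialisation.\<close>

lemma trans_clifford:
  assumes "a \<in> idx M" "x \<in> frame_dom M a"
  shows "trans M a (idx_at M x) x (clifford M x v w)
    = clif M (inv (frame M a x) v) (trans M a (idx_at M x) x w)"
proof -
  let ?s = "trans M a (idx_at M x) x" and ?F = "frame M (idx_at M x) x"
  note s = trans_spin_group[OF assms(1) idx_at(1) assms(2) idx_at(2)]
  have "frame M a x (spin_rotation (clif M) ?s (inv ?F v)) = v"
    using s(2) frame_inv(1)[OF idx_at] by (metis comp_apply)
  then have "spin_rotation (clif M) ?s (inv ?F v) = inv (frame M a x) v"
    using frame_inv(2)[OF assms] by metis
  then show ?thesis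
    using spin_rotation_intertwines[OF s(1), of "inv ?F v" w] by (simp add: clifford_def)
qed

text \<open>Replaces the preferred frames, which vary with the point, by one frame \<open>a\<close>
  on a neighbourhood, so that the expression can be differentiated.\<close>

lemma inner_clifford_eq:
  assumes "a \<in> idx M" "x \<in> frame_dom M a"
  shows "inner (clifford M x u (\<sigma> x)) (clifford M x v (\<psi> x)) =
    inner (clif M (inv (frame M a x) u) (spinor_coord M a \<sigma> x))
      (clif M (inv (frame M a x) v) (spinor_coord M a \<psi> x))"
  using spin_group_properties(2)[OF trans_spin_group(1)[OF assms(1) idx_at(1) assms(2) idx_at(2)]]
  by (metis trans_clifford[OF assms] spinor_coord_def)

lemma volume_mult: "volume_mult M x w = vol w"
  by (simp add: volume_mult_def vol_def clifford_def idx_at)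

lemma linear_clifford: "linear (clifford M x u)"
  using linear_cl by (simp add: clifford_def[abs_def])

lemma bilinear_clifford: "bilinear (clifford M x)"
  unfolding bilinear_def clifford_def
  by (auto intro!: linearI simp: cl_simps linear_add[OF linear_inv_frame[OF idx_at]]
      linear_cmul[OF linear_inv_frame[OF idx_at]])

lemma metric_inv_frame:
  "metric M x u v = inner (inv (frame M (idx_at M x) x) u) (inv (frame M (idx_at M x) x) v)"
  using frame(2)[OF idx_at, of x "inv (frame M (idx_at M x) x) u" "inv (frame M (idx_at M x) x) v"]
  by (simp add: idx_at)

lemma christoffel_M:
  "bilinear (christoffel (charts M) (metric M) x)"
  "christoffel (charts M) (metric M) x u v = christoffel (charts M) (metric M) x v u"
  "form_deriv (charts M) (metric M) x u a b =
    metric M x (christoffel (charts M) (metric M) x u a) b + metric M x a (christoffel (charts M) (metric M) x u b)"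
  by (rule christoffel[OF frame(1,2)[OF idx_at]])+

text \<open>Only first derivatives at one point enter, and this notion passes to the image under
  \<open>vol\<close> without an argument about higher derivatives.\<close>

definition spinor_differentiable_at :: "('m \<Rightarrow> 'w) \<Rightarrow> 'm \<Rightarrow> bool" where
  "spinor_differentiable_at \<psi> x \<longleftrightarrow> (\<lambda>y. spinor_coord M (idx_at M x) \<psi> (chart_inv (chart_at (charts M) x) y))
     differentiable (at (chart_map (chart_at (charts M) x) x))"

lemma coord_neighbourhood:
  "open (chart_map (chart_at (charts M) x) ` (chart_dom (chart_at (charts M) x) \<inter> frame_dom M (idx_at M x)))"
  "chart_map (chart_at (charts M) x) x \<in> chart_map (chart_at (charts M) x) ` (chart_dom (chart_at (charts M) x) \<inter> frame_dom M (idx_at M x))"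
  using open_chart_image[OF chart_at(1) open_frame_dom[OF idx_at(1)]] chart_at(2) idx_at(2) by auto

lemma smooth_spinor_differentiable:
  assumes "smooth_spinor_on M UNIV \<psi>"
  shows "spinor_differentiable_at \<psi> x"
proof -
  have "smooth_on (chart_map (chart_at (charts M) x) ` (chart_dom (chart_at (charts M) x) \<inter> frame_dom M (idx_at M x)))
    (spinor_coord M (idx_at M x) \<psi> \<circ> chart_inv (chart_at (charts M) x))"
    using assms idx_at(1) chart_at(1) by (auto simp: smooth_spinor_on_def smooth_map_on_def)
  from smooth_on_imp_differentiable[OF this coord_neighbourhood] show ?thesis
    by (simp add: spinor_differentiable_at_def o_def)
qed

text \<open>\<open>vol\<close> is the same constant operator in all trivialisations, because it
  commutes with Spin(5), and it commutes with the products e_i e_j of the connection term.\<close>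

lemma vol_parallel:
  assumes "spinor_differentiable_at \<psi> x"
  shows "spinor_differentiable_at (\<lambda>x. vol (\<psi> x)) x"
    "nabla M x v (\<lambda>x. vol (\<psi> x)) = vol (nabla M x v \<psi>)"
proof -
  define c where "c = chart_at (charts M) x"
  define a where "a = idx_at M x"
  let ?D = "chart_map c ` (chart_dom c \<inter> frame_dom M a)"
  define f where "f \<psi> y = spinor_coord M a \<psi> (chart_inv c y)" for \<psi> y
  have D: "open ?D" "chart_map c x \<in> ?D" using coord_neighbourhood by (simp_all add: c_def a_def)
  have f: "(f \<psi> has_derivative frechet_derivative (f \<psi>) (at (chart_map c x))) (at (chart_map c x))"
    using assms by (simp add: spinor_differentiable_at_def frechet_derivative_works c_def a_def f_def[abs_def])
  have a: "a \<in> idx M" by (simp add: a_def idx_at)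
  have "bounded_linear vol" using linear_vol by (simp add: linear_conv_bounded_linear)
  from bounded_linear.has_derivative[OF this f]
  have der: "(f (\<lambda>x. vol (\<psi> x)) has_derivative (\<lambda>v. vol (frechet_derivative (f \<psi>) (at (chart_map c x)) v))) (at (chart_map c x))"
  proof (rule has_derivative_transform_within_open[OF _ D])
    fix y assume "y \<in> ?D"
    then have "chart_inv c y \<in> frame_dom M a" by (auto simp: c_def chart_inv_map chart_at)
    then show "vol (f \<psi> y) = f (\<lambda>x. vol (\<psi> x)) y"
      by (simp add: f_def spinor_coord_def spin_group_properties(5)[OF trans_spin_group(1)] a idx_at)
  qed
  then show "spinor_differentiable_at (\<lambda>x. vol (\<psi> x)) x"
    by (auto simp: spinor_differentiable_at_def f_def[abs_def] c_def a_def differentiable_def)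
  have d: "frechet_derivative (f (\<lambda>x. vol (\<psi> x))) (at (chart_map c x)) v = vol (frechet_derivative (f \<psi>) (at (chart_map c x)) v)"
    using frechet_derivative_at[OF der] by metis
  show "nabla M x v (\<lambda>x. vol (\<psi> x)) = vol (nabla M x v \<psi>)"
    using d unfolding nabla_def Let_def deriv_along_def c_def[symmetric] a_def[symmetric] o_def f_def[abs_def]
    by (simp add: linear_add[OF linear_vol] linear_cmul[OF linear_vol] linear_sum[OF linear_vol] clifford_def vol_cl)
qed

text \<open>Leibniz rule for Clifford multiplication and the scalar product, both parallel. The
  Christoffel terms convert the coordinate derivative of the form into a covariant one.\<close>

lemma form_deriv_clifford_form:
  assumes \<sigma>: "spinor_differentiable_at \<sigma> x" and \<psi>: "spinor_differentiable_at \<psi> x"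
  defines "\<Gamma> \<equiv> christoffel (charts M) (metric M)"
  shows "form_deriv (charts M) (\<lambda>x u v. inner (clifford M x u (\<sigma> x)) (clifford M x v (\<psi> x))) x w u v =
      inner (clifford M x (\<Gamma> x w u) (\<sigma> x)) (clifford M x v (\<psi> x))
    + inner (clifford M x u (\<sigma> x)) (clifford M x (\<Gamma> x w v) (\<psi> x))
    + inner (clifford M x u (nabla M x w \<sigma>)) (clifford M x v (\<psi> x))
    + inner (clifford M x u (\<sigma> x)) (clifford M x v (nabla M x w \<psi>))"
proof -
  let ?A = "charts M" and ?g = "metric M"
  define c where "c = chart_at ?A x"
  define a where "a = idx_at M x"
  define y0 where "y0 = chart_map c x"
  define D where "D = chart_map c ` (chart_dom c \<inter> frame_dom M a)"
  have cA: "c \<in> ?A" and xc: "x \<in> chart_dom c" using chart_at by (simp_all add: c_def)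
  have a: "a \<in> idx M" "x \<in> frame_dom M a" using idx_at by (simp_all add: a_def)
  have D: "open D" "y0 \<in> D"
    using open_chart_image[OF cA open_frame_dom[OF a(1)]] xc a by (auto simp: D_def y0_def)
  have inD: "chart_inv c y \<in> chart_dom c" "chart_inv c y \<in> frame_dom M a" "y \<in> chart_map c ` chart_dom c" if "y \<in> D" for y
    using that cA by (auto simp: D_def chart_inv_map)
  have y0x: "chart_inv c y0 = x" using cA xc by (simp add: y0_def chart_inv_map)
  define G where "G = form_coord ?A c ?g"
  define e where "e i y = frame M a y (axis i 1)" for i y
  define f where "f i y = field_coord ?A c (e i) y" for i y
  define f' where "f' i = frechet_derivative (f i) (at y0)" for i
  \<comment> \<open>Components, in the frame \<open>a\<close>, of the coordinate vector field with
    constant components \<open>u\<close>.\<close>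
  define E where "E y u = inv (frame M a (chart_inv c y)) (of_coord ?A c (chart_inv c y) u)" for y u
  have bilG: "bilinear (G y)" if "y \<in> D" for y
    unfolding G_def by (rule bilinear_form_coord[OF cA inD(3)[OF that] bilinear_metric])
  have dG: "((\<lambda>y. G y u v) has_derivative (\<lambda>w. form_deriv ?A ?g x w u v)) (at y0)" for u v
    using metric_has_derivative[of x u v] by (simp add: G_def c_def y0_def)
  have df: "(f i has_derivative f' i) (at y0)" for i
  proof -
    have "smooth_field_on ?A (frame_dom M a) (e i)"
      using spin_structureD(4) a by (simp add: e_def[abs_def])
    then have "smooth_on D (field_coord ?A c (e i))"
      using cA by (simp add: smooth_field_on_def D_def)
    then show ?thesis
      using smooth_on_imp_differentiable[OF _ D] by (simp add: f'_def f_def[abs_def] frechet_derivative_works[symmetric])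
  qed
  have G_y0: "G y0 u v = ?g x u v" for u v
    by (simp add: G_def y0_def c_def form_coord_chart_at)
  have f_y0: "f i y0 = e i x" for i
    by (simp add: f_def y0_def c_def field_coord_chart_at)
  have E_y0: "E y0 u = inv (frame M a x) u" for u
    by (simp add: E_def y0x) (simp add: c_def of_coord_chart_at)
  have of_f: "of_coord ?A c (chart_inv c y) (f i y) = e i (chart_inv c y)" if "y \<in> D" for i y
    using of_coord_to_coord[OF cA inD(1)[OF that]] by (simp add: f_def field_coord_def)
  \<comment> \<open>Metric products with the frame vectors replace the inverse of the frame, so no
    inverse has to be differentiated.\<close>
  have E_eq: "E y u = (\<Sum>i\<in>UNIV. G y (f i y) u *\<^sub>R axis i 1)" if "y \<in> D" for y u
  proof -
    have "G y (f i y) u = E y u $ i" for i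
    proof -
      have "G y (f i y) u = ?g (chart_inv c y) (frame M a (chart_inv c y) (axis i 1)) (frame M a (chart_inv c y) (E y u))"
        using inD(2)[OF that] a by (simp add: G_def form_coord_def of_f that E_def e_def)
      also have "\<dots> = inner (axis i 1) (E y u)"
        by (rule frame(2)[OF a(1) inD(2)[OF that]])
      finally show ?thesis by (simp add: inner_axis')
    qed
    then show ?thesis using vec_axis_expansion[of "E y u"] by simp
  qed
  have nab: "levi_civita ?A ?g x w (e i) = f' i w + \<Gamma> x w (e i x)" for w i
    by (simp add: levi_civita_def f'_def f_def[abs_def] \<Gamma>_def c_def y0_def)
  have met: "form_deriv ?A ?g x u a b = ?g x (\<Gamma> x u a) b + ?g x a (\<Gamma> x u b)" for u a b
    unfolding \<Gamma>_def by (rule christoffel_M(3))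
  define A where "A w u = (\<Sum>i\<in>UNIV. ?g x (levi_civita ?A ?g x w (e i)) u *\<^sub>R (axis i 1 :: real ^ 5))" for w u
  have dE: "((\<lambda>y. E y u) has_derivative (\<lambda>w. inv (frame M a x) (\<Gamma> x w u) + A w u)) (at y0)" for u
  proof -
    have "((\<lambda>y. \<Sum>i\<in>UNIV. G y (f i y) u *\<^sub>R (axis i 1 :: real ^ 5)) has_derivative
       (\<lambda>w. \<Sum>i\<in>UNIV. (form_deriv ?A ?g x w (f i y0) u + G y0 (f' i w) u + G y0 (f i y0) 0) *\<^sub>R axis i 1)) (at y0)"
      by (intro has_derivative_sum has_derivative_scaleR_left
        has_derivative_bilinear_family[OF D bilG dG df has_derivative_const])
    also have "(\<lambda>w. \<Sum>i\<in>UNIV. (form_deriv ?A ?g x w (f i y0) u + G y0 (f' i w) u + G y0 (f i y0) 0) *\<^sub>R (axis i 1 :: real ^ 5))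
      = (\<lambda>w. inv (frame M a x) (\<Gamma> x w u) + A w u)" (is "?l = ?r")
    proof
      fix w
      \<comment> \<open>The derivative of the metric is g(\<Gamma> e_i, u) + g(e_i, \<Gamma> u). Its
        first term completes the derivative of the frame vector to the covariant one; the second
        gives the frame components of \<Gamma> u.\<close>
      have "?l w = (\<Sum>i\<in>UNIV. ?g x (e i x) (\<Gamma> x w u) *\<^sub>R axis i 1) + A w u"
        by (simp add: f_y0 G_y0 met nab A_def metric_simps algebra_simps sum.distrib)
      moreover have "?g x (e i x) (\<Gamma> x w u) = inv (frame M a x) (\<Gamma> x w u) $ i" for i
        using metric_inv_frame[of x "e i x" "\<Gamma> x w u"] a by (simp add: a_def[symmetric] e_def inner_axis')
      ultimately show "?l w = ?r w" using vec_axis_expansion[of "inv (frame M a x) (\<Gamma> x w u)"] by simp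
    qed
    finally show ?thesis
      by (rule has_derivative_transform_within_open[OF _ D]) (simp add: E_eq)
  qed
  define \<gamma> where "\<gamma> i j = ?g x (levi_civita ?A ?g x w (e i)) (e j x)" for i j
  \<comment> \<open>The products g(e_i, e_j) are constant; differentiating them shows that the
    connection matrix is skew.\<close>
  have skew: "\<gamma> i j = - \<gamma> j i" for i j
  proof -
    have "((\<lambda>y. G y (f i y) (f j y)) has_derivative (\<lambda>w. form_deriv ?A ?g x w (f i y0) (f j y0)
        + G y0 (f' i w) (f j y0) + G y0 (f i y0) (f' j w))) (at y0)"
      by (rule has_derivative_bilinear_family[OF D bilG dG df df])
    then have "form_deriv ?A ?g x w (f i y0) (f j y0)
        + G y0 (f' i w) (f j y0) + G y0 (f i y0) (f' j w) = 0"
    proof (rule has_derivative_zero_const[OF D, rotated])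
      fix y assume y: "y \<in> D"
      show "G y (f i y) (f j y) = inner (axis i 1) (axis j (1::real))"
        using frame(2)[OF a(1) inD(2)[OF y]] y by (simp add: G_def form_coord_def of_f e_def)
    qed
    then show ?thesis
      by (simp add: f_y0 G_y0 met \<gamma>_def nab metric_simps metric_commute[of x "e i x"])
  qed
  \<comment> \<open>The frame-rotation term is the connection matrix applied to the components of u,
    exactly the vector produced by \<open>cl_spin_lift\<close>.\<close>
  have A_eq: "A w u = (\<Sum>i\<in>UNIV. (\<Sum>j\<in>UNIV. \<gamma> i j * inv (frame M a x) u $ j) *\<^sub>R axis i 1)" for u
  proof -
    have "u = frame M a x (inv (frame M a x) u)" using a by simp
    also have "\<dots> = (\<Sum>j\<in>UNIV. (inv (frame M a x) u $ j) *\<^sub>R e j x)"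
      unfolding e_def linear_cmul[OF frame(1)[OF a], symmetric] linear_sum[OF frame(1)[OF a], symmetric]
        vec_axis_expansion[symmetric] ..
    finally have u: "u = (\<Sum>j\<in>UNIV. (inv (frame M a x) u $ j) *\<^sub>R e j x)" .
    have "?g x z u = (\<Sum>j\<in>UNIV. ?g x z (e j x) * inv (frame M a x) u $ j)" for z
      by (subst u, subst linear_sum[of "?g x z"])
        (simp_all add: bilinear_metric[unfolded bilinear_def] metric_simps mult.commute)
    then show ?thesis by (simp add: A_def \<gamma>_def)
  qed
  define P where "P \<psi> y = spinor_coord M a \<psi> (chart_inv c y)" for \<psi> y
  define P' where "P' \<psi> = frechet_derivative (P \<psi>) (at y0)" for \<psi>
  have P_y0: "P \<psi> y0 = \<psi> x" for \<psi> by (simp add: P_def y0x a_def spinor_coord_idx_at)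
  have dP: "(P \<psi> has_derivative P' \<psi>) (at y0)" if "spinor_differentiable_at \<psi> x" for \<psi>
    using that by (simp add: P'_def P_def[abs_def] spinor_differentiable_at_def frechet_derivative_works a_def c_def y0_def)
  have clif_e: "clifford M x (e i x) \<phi> = clif M (axis i 1) \<phi>" for i \<phi>
    using a by (simp add: clifford_def a_def[symmetric] e_def)
  have nabla: "nabla M x w \<psi> = P' \<psi> w + spin_lift \<gamma> (\<psi> x)" for \<psi>
    unfolding nabla_def Let_def a_def[symmetric] deriv_along_def c_def[symmetric] y0_def[symmetric]
      e_def[symmetric] spin_lift_def P'_def P_def[abs_def] o_def \<gamma>_def clif_e ..
  have cliff: "clifford M x u \<phi> = clif M (inv (frame M a x) u) \<phi>" for u \<phi>
    by (simp add: clifford_def a_def)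
  interpret cl: bounded_bilinear "clif M"
    using bilinear_cl by (simp add: bilinear_conv_bounded_bilinear)
  have "((\<lambda>y. inner (clif M (E y u) (P \<sigma> y)) (clif M (E y v) (P \<psi> y))) has_derivative
    (\<lambda>w. inner (clif M (E y0 u) (P \<sigma> y0)) (clif M (E y0 v) (P' \<psi> w) + clif M (inv (frame M a x) (\<Gamma> x w v) + A w v) (P \<psi> y0))
       + inner (clif M (E y0 u) (P' \<sigma> w) + clif M (inv (frame M a x) (\<Gamma> x w u) + A w u) (P \<sigma> y0)) (clif M (E y0 v) (P \<psi> y0)))) (at y0)"
    by (intro has_derivative_inner cl.FDERIV dE dP \<sigma> \<psi>)
  then have "((\<lambda>y. form_coord ?A c (\<lambda>x u v. inner (clifford M x u (\<sigma> x)) (clifford M x v (\<psi> x))) y u v) has_derivative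
    (\<lambda>w. inner (clif M (E y0 u) (P \<sigma> y0)) (clif M (E y0 v) (P' \<psi> w) + clif M (inv (frame M a x) (\<Gamma> x w v) + A w v) (P \<psi> y0))
       + inner (clif M (E y0 u) (P' \<sigma> w) + clif M (inv (frame M a x) (\<Gamma> x w u) + A w u) (P \<sigma> y0)) (clif M (E y0 v) (P \<psi> y0)))) (at y0)"
    by (rule has_derivative_transform_within_open[OF _ D])
      (simp add: form_coord_def inner_clifford_eq[OF a(1) inD(2)] E_def P_def)
  from fun_cong[OF frechet_derivative_at[OF this], of w, symmetric]
  have main: "form_deriv ?A (\<lambda>x u v. inner (clifford M x u (\<sigma> x)) (clifford M x v (\<psi> x))) x w u v =
    inner (clif M (E y0 u) (\<sigma> x)) (clif M (E y0 v) (P' \<psi> w) + clif M (inv (frame M a x) (\<Gamma> x w v) + A w v) (\<psi> x))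
       + inner (clif M (E y0 u) (P' \<sigma> w) + clif M (inv (frame M a x) (\<Gamma> x w u) + A w u) (\<sigma> x)) (clif M (E y0 v) (\<psi> x))"
    unfolding form_deriv_def c_def[symmetric] y0_def[symmetric] P_y0 .
  \<comment> \<open>The rotation of the frame is absorbed into the spin connection. What is left
    over is the lift applied to the whole product; in the scalar product of the two factors these
    remainders cancel, because the lift is skew.\<close>
  have lift: "clif M (E y0 u) (P' \<psi> w) + clif M (A w u) (\<psi> x)
    = clif M (E y0 u) (nabla M x w \<psi>) - spin_lift \<gamma> (clif M (E y0 u) (\<psi> x))" for \<psi> u
    using cl_spin_lift[OF skew, where v = "E y0 u" and w = "\<psi> x"] by (simp add: nabla cl_simps A_eq E_y0)
  have l1: "clif M (E y0 u) (P' \<psi> w) + clif M (inv (frame M a x) (\<Gamma> x w u) + A w u) (\<psi> x) =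
    clif M (E y0 u) (nabla M x w \<psi>) - spin_lift \<gamma> (clif M (E y0 u) (\<psi> x)) + clif M (inv (frame M a x) (\<Gamma> x w u)) (\<psi> x)" for \<psi> u
    using lift[of u \<psi>] by (simp add: cl_simps algebra_simps)
  show ?thesis
    unfolding main l1
    using spin_lift_skew[OF skew, where w = "clif M (E y0 u) (\<sigma> x)" and w' = "clif M (E y0 v) (\<psi> x)"]
    by (simp add: inner_simps cliff E_y0)
qed

text \<open>Of the six Christoffel terms of the cyclic sum, four cancel by symmetry of the symbols
  (no torsion), and the remaining pair by skewness of the form.\<close>

lemma ext_deriv_clifford_form:
  assumes "spinor_differentiable_at \<sigma> x" "spinor_differentiable_at \<psi> x"
    and skew: "\<And>u v. inner (clifford M x u (\<sigma> x)) (clifford M x v (\<psi> x)) = - inner (clifford M x v (\<sigma> x)) (clifford M x u (\<psi> x))"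
  defines "D \<equiv> \<lambda>w u v. inner (clifford M x u (nabla M x w \<sigma>)) (clifford M x v (\<psi> x))
    + inner (clifford M x u (\<sigma> x)) (clifford M x v (nabla M x w \<psi>))"
  shows "ext_deriv (charts M) (\<lambda>x u v. inner (clifford M x u (\<sigma> x)) (clifford M x v (\<psi> x))) x u v w
    = D u v w - D v u w + D w u v"
  using skew[of v "christoffel (charts M) (metric M) x u w"]
  by (simp add: ext_deriv_def form_deriv_clifford_form[OF assms(1,2)] D_def christoffel_M(2)[of x v u]
      christoffel_M(2)[of x w u] christoffel_M(2)[of x w v])

end

section \<open>The algebra of an SU(2) structure at a point\<close>

text \<open>The geometry at one point, freed of charts and frames. \<open>normal_expansion\<close>
  and \<open>hor_in\<close> carry the dimension counts, and the sign in \<open>cl_R\<close> carries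
  the orientation.\<close>

locale su2_point =
  fixes cl :: "'v::real_vector \<Rightarrow> 'w::real_inner \<Rightarrow> 'w" and g :: "'v \<Rightarrow> 'v \<Rightarrow> real"
    and j1 j2 j3 :: "'w \<Rightarrow> 'w" and \<eta> :: 'w and \<xi> :: "'v set"
    and J1 J2 J3 :: "'v \<Rightarrow> 'v" and R :: 'v
  assumes bilinear_cl: "bilinear cl"
    and bilinear_g: "bilinear g" and g_commute: "g u v = g v u" and g_pos: "v \<noteq> 0 \<Longrightarrow> g v v > 0"
    and cl_cl: "cl v (cl v w) = - (g v v *\<^sub>R w)"
    and cl_skew: "inner (cl v w) w' = - inner w (cl v w')"
    and linear_j1: "linear j1" and linear_j2: "linear j2" and j3: "j3 w = j1 (j2 w)"
    and j1_j1: "j1 (j1 w) = - w" and j2_j2: "j2 (j2 w) = - w" and j2_j1: "j2 (j1 w) = - j1 (j2 w)"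
    and j1_skew: "inner (j1 w) w' = - inner w (j1 w')"
    and j2_skew: "inner (j2 w) w' = - inner w (j2 w')"
    and cl_j1: "cl v (j1 w) = j1 (cl v w)" and cl_j2: "cl v (j2 w) = - j2 (cl v w)"
    and unit: "inner \<eta> \<eta> = 1"
    and subspace: "subspace \<xi>"
    and J_closed: "X \<in> \<xi> \<Longrightarrow> J1 X \<in> \<xi>" "X \<in> \<xi> \<Longrightarrow> J2 X \<in> \<xi>" "X \<in> \<xi> \<Longrightarrow> J3 X \<in> \<xi>"
    and cl_J: "X \<in> \<xi> \<Longrightarrow> cl (J1 X) \<eta> = j1 (cl X \<eta>)" "X \<in> \<xi> \<Longrightarrow> cl (J2 X) \<eta> = j2 (cl X \<eta>)"
      "X \<in> \<xi> \<Longrightarrow> cl (J3 X) \<eta> = j3 (cl X \<eta>)"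
    and normal_expansion: "(\<And>X. X \<in> \<xi> \<Longrightarrow> inner w (cl X \<eta>) = 0) \<Longrightarrow>
      w = inner w \<eta> *\<^sub>R \<eta> + inner w (j1 \<eta>) *\<^sub>R j1 \<eta> + inner w (j2 \<eta>) *\<^sub>R j2 \<eta> + inner w (j3 \<eta>) *\<^sub>R j3 \<eta>"
    and cl_R: "cl R \<eta> = - j1 \<eta>" and g_R_R: "g R R = 1" and g_R: "X \<in> \<xi> \<Longrightarrow> g R X = 0"
    and hor_in: "X - g R X *\<^sub>R R \<in> \<xi>"
begin

lemmas cl_simps = bilinear_ladd[OF bilinear_cl] bilinear_radd[OF bilinear_cl]
  bilinear_lsub[OF bilinear_cl] bilinear_rsub[OF bilinear_cl]
  bilinear_lmul[OF bilinear_cl] bilinear_rmul[OF bilinear_cl]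
  bilinear_lneg[OF bilinear_cl] bilinear_rneg[OF bilinear_cl]
  bilinear_lzero[OF bilinear_cl] bilinear_rzero[OF bilinear_cl]

lemmas g_simps = bilinear_ladd[OF bilinear_g] bilinear_radd[OF bilinear_g]
  bilinear_lsub[OF bilinear_g] bilinear_rsub[OF bilinear_g]
  bilinear_lmul[OF bilinear_g] bilinear_rmul[OF bilinear_g]
  bilinear_lneg[OF bilinear_g] bilinear_rneg[OF bilinear_g]
  bilinear_lzero[OF bilinear_g] bilinear_rzero[OF bilinear_g]

lemma linear_j3: "linear j3"
  using linear_compose[OF linear_j2 linear_j1] by (simp add: j3[abs_def] o_def)

lemmas j_simps = linear_add[OF linear_j1] linear_add[OF linear_j2] linear_add[OF linear_j3]
  linear_diff[OF linear_j1] linear_diff[OF linear_j2] linear_diff[OF linear_j3]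
  linear_neg[OF linear_j1] linear_neg[OF linear_j2] linear_neg[OF linear_j3]
  linear_cmul[OF linear_j1] linear_cmul[OF linear_j2] linear_cmul[OF linear_j3]

lemma j_table:
  "j1 (j1 w) = - w" "j2 (j2 w) = - w" "j3 (j3 w) = - w"
  "j1 (j2 w) = j3 w" "j2 (j3 w) = j1 w" "j3 (j1 w) = j2 w"
  "j2 (j1 w) = - j3 w" "j3 (j2 w) = - j1 w" "j1 (j3 w) = - j2 w"
  by (simp_all add: j3 j1_j1 j2_j2 j2_j1 linear_neg[OF linear_j1] linear_neg[OF linear_j2])

lemma j3_skew: "inner (j3 w) w' = - inner w (j3 w')"
  by (metis j1_skew j2_skew j_table(4) j_table(7) inner_minus_right minus_minus)

lemma cl_j3: "cl v (j3 w) = - j3 (cl v w)"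
  by (simp add: j3 cl_j1 cl_j2 linear_neg[OF linear_j1])

lemmas cl_j = cl_j1 cl_j2 cl_j3
lemmas j_skew = j1_skew j2_skew j3_skew

lemma cl_anticommute: "cl u (cl v w) = - cl v (cl u w) - (2 * g u v) *\<^sub>R w"
proof -
  have "cl (u + v) (cl (u + v) w) = - (g (u + v) (u + v) *\<^sub>R w)"
    by (rule cl_cl)
  then show ?thesis
    by (simp add: cl_simps cl_cl g_simps algebra_simps g_commute[of v u] eq_neg_iff_add_eq_0 scaleR_2)
qed

lemma inner_cl_cl: "inner (cl u \<eta>) (cl v \<eta>) = g u v"
proof -
  have "inner (cl u \<eta>) (cl v \<eta>) = - inner \<eta> (cl u (cl v \<eta>))" by (rule cl_skew)
  also have "\<dots> = inner \<eta> (cl v (cl u \<eta>)) + 2 * g u v"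
    by (subst cl_anticommute) (simp add: inner_simps unit)
  also have "inner \<eta> (cl v (cl u \<eta>)) = - inner (cl u \<eta>) (cl v \<eta>)"
    using cl_skew[of v \<eta> "cl u \<eta>"] by (simp add: inner_commute)
  finally show ?thesis by simp
qed

lemma cl_eqI: "cl u \<eta> = cl v \<eta> \<Longrightarrow> u = v"
  using inner_cl_cl[of "u - v" "u - v"] g_pos[of "u - v"] by (fastforce simp: cl_simps)

definition hor :: "'v \<Rightarrow> 'v" where "hor X = X - g R X *\<^sub>R R"

lemma hor_in_\<xi>: "hor X \<in> \<xi>"
  by (simp add: hor_def hor_in)

lemma hor_decomp: "X = hor X + g R X *\<^sub>R R"
  by (simp add: hor_def)

definition om1 :: "'v \<Rightarrow> 'v \<Rightarrow> real" where "om1 Y Z = inner (j1 (cl Y \<eta>)) (cl Z \<eta>)"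
definition om2 :: "'v \<Rightarrow> 'v \<Rightarrow> real" where "om2 Y Z = inner (j2 (cl Y \<eta>)) (cl Z \<eta>)"
definition om3 :: "'v \<Rightarrow> 'v \<Rightarrow> real" where "om3 Y Z = inner (j3 (cl Y \<eta>)) (cl Z \<eta>)"

lemmas om_defs = om1_def om2_def om3_def

lemma om_skew: "om1 Y Z = - om1 Z Y" "om2 Y Z = - om2 Z Y" "om3 Y Z = - om3 Z Y"
  using j_skew[of "cl Y \<eta>" "cl Z \<eta>"] by (simp_all add: om_defs inner_commute)

lemma om_linear:
  "om1 (X + Y) Z = om1 X Z + om1 Y Z" "om1 (r *\<^sub>R X) Z = r * om1 X Z"
  "om2 (X + Y) Z = om2 X Z + om2 Y Z" "om2 (r *\<^sub>R X) Z = r * om2 X Z"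
  "om3 (X + Y) Z = om3 X Z + om3 Y Z" "om3 (r *\<^sub>R X) Z = r * om3 X Z"
  "om1 Z (X + Y) = om1 Z X + om1 Z Y" "om1 Z (r *\<^sub>R X) = r * om1 Z X"
  "om2 Z (X + Y) = om2 Z X + om2 Z Y" "om2 Z (r *\<^sub>R X) = r * om2 Z X"
  "om3 Z (X + Y) = om3 Z X + om3 Z Y" "om3 Z (r *\<^sub>R X) = r * om3 Z X"
  by (simp_all add: om_defs cl_simps j_simps inner_simps)

text \<open>X, X \<jmath>2 and X \<jmath>3 are skew, a product of anticommuting skew operators being
  skew. X \<jmath>1 is symmetric instead, and there orthogonality to R = - \<jmath>1 on \<eta> is
  needed.\<close>

lemma \<xi>_orthogonal:
  assumes "X \<in> \<xi>"
  shows "inner (cl X \<eta>) \<eta> = 0" "inner (cl X \<eta>) (j1 \<eta>) = 0"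
    "inner (cl X \<eta>) (j2 \<eta>) = 0" "inner (cl X \<eta>) (j3 \<eta>) = 0"
proof -
  show "inner (cl X \<eta>) \<eta> = 0"
    using cl_skew[of X \<eta> \<eta>] by (simp add: inner_commute)
  show "inner (cl X \<eta>) (j1 \<eta>) = 0"
    using inner_cl_cl[of X R] g_R[OF assms] g_commute[of X R] by (simp add: cl_R)
  show "inner (cl X \<eta>) (j2 \<eta>) = 0"
    using cl_skew[of X \<eta> "j2 \<eta>"] j2_skew[of \<eta> "cl X \<eta>"] by (simp add: cl_j inner_commute)
  show "inner (cl X \<eta>) (j3 \<eta>) = 0"
    using cl_skew[of X \<eta> "j3 \<eta>"] j3_skew[of \<eta> "cl X \<eta>"] by (simp add: cl_j inner_commute)
qed

lemma om_R: "om1 R Y = 0" "om2 R Y = 0" "om3 R Y = 0" "om1 Y R = 0" "om2 Y R = 0" "om3 Y R = 0"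
proof -
  have 1: "om1 R (hor Y) = 0" "om2 R (hor Y) = 0" "om3 R (hor Y) = 0" for Y
    using \<xi>_orthogonal[OF hor_in_\<xi>, of Y]
    by (simp_all add: om_defs cl_R j_simps j_table inner_commute)
  have 2: "om1 R R = 0" "om2 R R = 0" "om3 R R = 0"
    using om_skew[of R R] by simp_all
  show 3: "om1 R Y = 0" "om2 R Y = 0" "om3 R Y = 0" for Y
    by (subst hor_decomp[of Y], simp add: om_linear 1 2 del: add_uminus_conv_diff)+
  show "om1 Y R = 0" "om2 Y R = 0" "om3 Y R = 0"
    using 3[of Y] om_skew[of R Y] by simp_all
qed

lemma om_hor:
  "om1 (hor Y) Z = om1 Y Z" "om2 (hor Y) Z = om2 Y Z" "om3 (hor Y) Z = om3 Y Z"
  "om1 Y (hor Z) = om1 Y Z" "om2 Y (hor Z) = om2 Y Z" "om3 Y (hor Z) = om3 Y Z"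
  using om_linear om_R hor_decomp
  by (metis add.right_neutral mult_zero_right)+

section \<open>The quaternionic structure of the horizontal space\<close>

lemma g_J:
  assumes "U \<in> \<xi>"
  shows "g (J1 U) Z = om1 U Z" "g (J2 U) Z = om2 U Z" "g (J3 U) Z = om3 U Z"
  using assms by (simp_all add: inner_cl_cl[symmetric] cl_J om_defs)

lemma J_add:
  assumes "X \<in> \<xi>" "Y \<in> \<xi>"
  shows "J1 (X + Y) = J1 X + J1 Y" "J2 (X + Y) = J2 X + J2 Y" "J3 (X + Y) = J3 X + J3 Y"
  using assms subspace by (auto intro!: cl_eqI simp: cl_J cl_simps j_simps subspace_add)

lemma J_scale:
  assumes "X \<in> \<xi>"
  shows "J1 (r *\<^sub>R X) = r *\<^sub>R J1 X" "J2 (r *\<^sub>R X) = r *\<^sub>R J2 X" "J3 (r *\<^sub>R X) = r *\<^sub>R J3 X"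
  using assms subspace by (auto intro!: cl_eqI simp: cl_J cl_simps j_simps subspace_scale)

lemma J_table:
  assumes "X \<in> \<xi>"
  shows "J1 (J1 X) = - X" "J2 (J2 X) = - X" "J3 (J3 X) = - X"
    "J1 (J2 X) = J3 X" "J2 (J3 X) = J1 X" "J3 (J1 X) = J2 X"
    "J2 (J1 X) = - J3 X" "J3 (J2 X) = - J1 X" "J1 (J3 X) = - J2 X"
  using assms by (auto intro!: cl_eqI simp: cl_J J_closed cl_simps j_table)

lemma om_J:
  assumes "U \<in> \<xi>"
  shows "om1 (J1 U) Z = - g U Z" "om2 (J2 U) Z = - g U Z" "om3 (J3 U) Z = - g U Z"
    "om1 (J2 U) Z = om3 U Z" "om2 (J3 U) Z = om1 U Z" "om3 (J1 U) Z = om2 U Z"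
    "om2 (J1 U) Z = - om3 U Z" "om3 (J2 U) Z = - om1 U Z" "om1 (J3 U) Z = - om2 U Z"
  using assms by (simp_all add: om_defs cl_J j_table inner_cl_cl)

text \<open>R \<jmath>1 is a symmetric involution that fixes \<eta> and anticommutes with horizontal
  vectors. Two horizontal factors give an eigenvector for +1, one factor an eigenvector for
  -1.\<close>

lemma \<xi>_products_orthogonal:
  assumes "Y \<in> \<xi>" "U \<in> \<xi>" "Z \<in> \<xi>"
  shows "inner (cl Y (cl U \<eta>)) (cl Z \<eta>) = 0"
proof -
  have anti: "cl R (cl X w) = - cl X (cl R w)" if "X \<in> \<xi>" for X w
    using cl_anticommute[of R X w] that by (simp add: g_R)
  have "cl R (j1 (cl Y (cl U \<eta>))) = cl Y (cl U \<eta>)"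
    using assms by (simp add: cl_j anti cl_simps j_simps cl_R j_table)
  then have "inner (cl Y (cl U \<eta>)) (cl Z \<eta>) = inner (cl R (j1 (cl Y (cl U \<eta>)))) (cl Z \<eta>)"
    by simp
  also have "\<dots> = inner (cl Y (cl U \<eta>)) (j1 (cl R (cl Z \<eta>)))"
    using cl_skew j1_skew by simp
  also have "j1 (cl R (cl Z \<eta>)) = - cl Z \<eta>"
    using assms by (simp add: cl_j anti cl_simps j_simps cl_R j_table)
  finally show ?thesis by simp
qed

text \<open>XY\<eta> is orthogonal to \<xi>\<eta>, hence a combination of \<eta> and the \<jmath>_k
  \<eta>. Multiplying by X again returns Y and shows that \<xi> is a quaternionic line generated by
  any nonzero X.\<close>

lemma \<xi>_expansion:
  assumes "X \<in> \<xi>" "Y \<in> \<xi>"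
  shows "g X X *\<^sub>R Y = g X Y *\<^sub>R X + om1 X Y *\<^sub>R J1 X + om2 X Y *\<^sub>R J2 X + om3 X Y *\<^sub>R J3 X"
proof (rule cl_eqI)
  let ?w = "cl X (cl Y \<eta>)"
  have "inner ?w \<eta> = - g X Y"
    using cl_skew[of X "cl Y \<eta>" \<eta>] by (simp add: inner_cl_cl g_commute)
  moreover have "inner ?w (j1 \<eta>) = - om1 X Y"
    using cl_skew[of X "cl Y \<eta>" "j1 \<eta>"] by (simp add: cl_j om_defs inner_commute)
  moreover have "inner ?w (j2 \<eta>) = om2 X Y"
    using cl_skew[of X "cl Y \<eta>" "j2 \<eta>"] by (simp add: cl_j om_defs inner_commute)
  moreover have "inner ?w (j3 \<eta>) = om3 X Y"
    using cl_skew[of X "cl Y \<eta>" "j3 \<eta>"] by (simp add: cl_j om_defs inner_commute)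
  ultimately have "?w = - g X Y *\<^sub>R \<eta> + - om1 X Y *\<^sub>R j1 \<eta> + om2 X Y *\<^sub>R j2 \<eta> + om3 X Y *\<^sub>R j3 \<eta>"
    using normal_expansion[OF \<xi>_products_orthogonal[OF assms]] by simp
  then have "cl X ?w = cl X (- g X Y *\<^sub>R \<eta> + - om1 X Y *\<^sub>R j1 \<eta> + om2 X Y *\<^sub>R j2 \<eta> + om3 X Y *\<^sub>R j3 \<eta>)"
    by (rule arg_cong)
  then have "g X X *\<^sub>R cl Y \<eta> = g X Y *\<^sub>R cl X \<eta> + om1 X Y *\<^sub>R j1 (cl X \<eta>) + om2 X Y *\<^sub>R j2 (cl X \<eta>) + om3 X Y *\<^sub>R j3 (cl X \<eta>)"
    by (simp add: cl_cl cl_simps cl_j) (metis (no_types, lifting) add.inverse_inverse minus_add_distrib scaleR_minus_right add_uminus_conv_diff diff_minus_eq_add)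
  then show "cl (g X X *\<^sub>R Y) \<eta> = cl (g X Y *\<^sub>R X + om1 X Y *\<^sub>R J1 X + om2 X Y *\<^sub>R J2 X + om3 X Y *\<^sub>R J3 X) \<eta>"
    using assms by (simp add: cl_simps cl_J)
qed

lemma \<xi>_coordinates:
  assumes "X \<in> \<xi>" "X \<noteq> 0" "Y \<in> \<xi>"
  obtains a b c d where "Y = a *\<^sub>R X + b *\<^sub>R J1 X + c *\<^sub>R J2 X + d *\<^sub>R J3 X"
proof -
  have n: "g X X \<noteq> 0" using g_pos[OF assms(2)] by simp
  have "Y = (1 / g X X) *\<^sub>R (g X X *\<^sub>R Y)" using n by simp
  also have "\<dots> = (g X Y / g X X) *\<^sub>R X + (om1 X Y / g X X) *\<^sub>R J1 X + (om2 X Y / g X X) *\<^sub>R J2 X + (om3 X Y / g X X) *\<^sub>R J3 X"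
    unfolding \<xi>_expansion[OF assms(1,3)] by (simp add: algebra_simps)
  finally show ?thesis using that by blast
qed

text \<open>In dimension 4 all forms \<open>(\<beta> \<circ> J\<^sub>k) \<and> \<omega>\<^sub>k\<close> are the Hodge dual of \<open>\<beta>\<close>, hence independent of \<open>k\<close>.\<close>

lemma wedge_J_om:
  assumes \<beta>: "linear_on_subspace \<xi> \<beta>" and "X \<in> \<xi>" "Y \<in> \<xi>" "Z \<in> \<xi>"
  shows "wedge_1_2 (\<lambda>X. \<beta> (J2 X)) om2 X Y Z = wedge_1_2 (\<lambda>X. \<beta> (J1 X)) om1 X Y Z"
    "wedge_1_2 (\<lambda>X. \<beta> (J3 X)) om3 X Y Z = wedge_1_2 (\<lambda>X. \<beta> (J1 X)) om1 X Y Z"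
proof -
  have add: "\<beta> (U + V) = \<beta> U + \<beta> V" if "U \<in> \<xi>" "V \<in> \<xi>" for U V
    using \<beta> that by (simp add: linear_on_subspace_def)
  have scale: "\<beta> (r *\<^sub>R U) = r * \<beta> U" if "U \<in> \<xi>" for U r
    using \<beta> that by (simp add: linear_on_subspace_def)
  have neg: "\<beta> (- U) = - \<beta> U" if "U \<in> \<xi>" for U
    using scale[OF that, of "- 1"] by simp
  have diff: "\<beta> (U - V) = \<beta> U - \<beta> V" if "U \<in> \<xi>" "V \<in> \<xi>" for U V
    using add[of U "- V"] that neg[of V] subspace_neg[OF subspace] by simp
  note sub = subspace_diff[OF subspace] subspace_add[OF subspace] subspace_scale[OF subspace] subspace_neg[OF subspace]
  have "wedge_1_2 (\<lambda>X. \<beta> (J2 X)) om2 X Y Z = wedge_1_2 (\<lambda>X. \<beta> (J1 X)) om1 X Y Z \<and>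
    wedge_1_2 (\<lambda>X. \<beta> (J3 X)) om3 X Y Z = wedge_1_2 (\<lambda>X. \<beta> (J1 X)) om1 X Y Z"
  proof (cases "X = 0")
    case True
    have "J1 0 = 0" "J2 0 = 0" "J3 0 = 0" "\<beta> 0 = 0" "om1 0 V = 0" "om2 0 V = 0" "om3 0 V = 0" for V
      using J_scale[of 0 0] om_linear(2,4,6)[of 0 0 V] subspace_0[OF subspace] scale[of 0 0] by simp_all
    then show ?thesis by (simp add: wedge_1_2_def True)
  next
    case False
    have JX: "J1 X \<in> \<xi>" "J2 X \<in> \<xi>" "J3 X \<in> \<xi>" using J_closed assms(2) by auto
    have om0: "om1 X X = 0" "om2 X X = 0" "om3 X X = 0" using om_skew[of X X] by simp_all
    have gJ: "g X (J1 X) = 0" "g X (J2 X) = 0" "g X (J3 X) = 0"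
      by (simp_all add: g_commute[of X] g_J assms(2) om0)
    have omXJ: "om1 X (J1 X) = g X X" "om2 X (J2 X) = g X X" "om3 X (J3 X) = g X X"
      "om1 X (J2 X) = 0" "om1 X (J3 X) = 0" "om2 X (J1 X) = 0" "om2 X (J3 X) = 0" "om3 X (J1 X) = 0" "om3 X (J2 X) = 0"
      using om_skew[of X "J1 X"] om_skew[of X "J2 X"] om_skew[of X "J3 X"]
      by (simp_all add: om_J assms(2) om0)
    have \<beta>J: "\<beta> (J1 (a *\<^sub>R X + b *\<^sub>R J1 X + c *\<^sub>R J2 X + d *\<^sub>R J3 X)) = a * \<beta> (J1 X) - b * \<beta> X + c * \<beta> (J3 X) - d * \<beta> (J2 X)"
      "\<beta> (J2 (a *\<^sub>R X + b *\<^sub>R J1 X + c *\<^sub>R J2 X + d *\<^sub>R J3 X)) = a * \<beta> (J2 X) - b * \<beta> (J3 X) - c * \<beta> X + d * \<beta> (J1 X)"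
      "\<beta> (J3 (a *\<^sub>R X + b *\<^sub>R J1 X + c *\<^sub>R J2 X + d *\<^sub>R J3 X)) = a * \<beta> (J3 X) + b * \<beta> (J2 X) - c * \<beta> (J1 X) - d * \<beta> X"
      for a b c d
      by (simp_all add: J_add J_scale J_table add diff scale neg sub JX assms(2))
    have omX: "om1 X (a *\<^sub>R X + b *\<^sub>R J1 X + c *\<^sub>R J2 X + d *\<^sub>R J3 X) = g X X * b"
      "om2 X (a *\<^sub>R X + b *\<^sub>R J1 X + c *\<^sub>R J2 X + d *\<^sub>R J3 X) = g X X * c"
      "om3 X (a *\<^sub>R X + b *\<^sub>R J1 X + c *\<^sub>R J2 X + d *\<^sub>R J3 X) = g X X * d"
      for a b c d
      by (simp_all add: om_linear omXJ om0)
    have gX: "g X (a *\<^sub>R X + b *\<^sub>R J1 X + c *\<^sub>R J2 X + d *\<^sub>R J3 X) = g X X * a"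
      for a b c d
      by (simp add: g_simps gJ)
    \<comment> \<open>In quaternionic coordinates relative to X the claim becomes a polynomial
      identity in the coordinates of Y and Z and the values of \<beta> on X and the J_k X.\<close>
    obtain a b c d where Y: "Y = a *\<^sub>R X + b *\<^sub>R J1 X + c *\<^sub>R J2 X + d *\<^sub>R J3 X"
      using \<xi>_coordinates[OF assms(2) False assms(3)] .
    obtain a' b' c' d' where Z: "Z = a' *\<^sub>R X + b' *\<^sub>R J1 X + c' *\<^sub>R J2 X + d' *\<^sub>R J3 X"
      using \<xi>_coordinates[OF assms(2) False assms(4)] .
    have om: "om1 Y Z = a * om1 X Z - b * g X Z + c * om3 X Z - d * om2 X Z"
      "om2 Y Z = a * om2 X Z - b * om3 X Z - c * g X Z + d * om1 X Z"
      "om3 Y Z = a * om3 X Z + b * om2 X Z - c * om1 X Z - d * g X Z"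
      by (simp_all add: Y om_linear om_J assms(2))
    have Z': "om1 X Z = g X X * b'" "om2 X Z = g X X * c'" "om3 X Z = g X X * d'" "g X Z = g X X * a'"
      unfolding Z by (rule omX gX)+
    have Y': "om1 X Y = g X X * b" "om2 X Y = g X X * c" "om3 X Y = g X X * d"
      unfolding Y by (rule omX)+
    show ?thesis
      unfolding wedge_1_2_def om Z' Y' unfolding Y Z \<beta>J by (simp add: algebra_simps)
  qed
  then show "wedge_1_2 (\<lambda>X. \<beta> (J2 X)) om2 X Y Z = wedge_1_2 (\<lambda>X. \<beta> (J1 X)) om1 X Y Z"
    "wedge_1_2 (\<lambda>X. \<beta> (J3 X)) om3 X Y Z = wedge_1_2 (\<lambda>X. \<beta> (J1 X)) om1 X Y Z" by auto
qed

lemma linear_on_J: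
  assumes "linear_on_subspace \<xi> \<beta>"
  shows "linear_on_subspace \<xi> (\<lambda>X. \<beta> (J1 X))" "linear_on_subspace \<xi> (\<lambda>X. \<beta> (J2 X))"
    "linear_on_subspace \<xi> (\<lambda>X. \<beta> (J3 X))"
  using assms by (simp_all add: linear_on_subspace_def J_add J_scale J_closed)

text \<open>The duality is applied to \<beta> composed with each J_m, and the quaternion relations
  then remove one J. This carries \<Theta>_l wedged with the third form over to J_l \<Theta>_l
  wedged with \<omega>_k.\<close>

lemma wedge_J_om_eq:
  assumes \<beta>: "linear_on_subspace \<xi> \<beta>" and V: "X \<in> \<xi>" "Y \<in> \<xi>" "Z \<in> \<xi>"
  shows "wedge_1_2 (\<lambda>X. \<beta> (J2 X)) om1 X Y Z = - wedge_1_2 \<beta> om3 X Y Z"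
    "wedge_1_2 (\<lambda>X. \<beta> (J3 X)) om1 X Y Z = wedge_1_2 \<beta> om2 X Y Z"
    "wedge_1_2 (\<lambda>X. \<beta> (J1 X)) om2 X Y Z = wedge_1_2 \<beta> om3 X Y Z"
    "wedge_1_2 (\<lambda>X. \<beta> (J3 X)) om2 X Y Z = - wedge_1_2 \<beta> om1 X Y Z"
    "wedge_1_2 (\<lambda>X. \<beta> (J1 X)) om3 X Y Z = - wedge_1_2 \<beta> om2 X Y Z"
    "wedge_1_2 (\<lambda>X. \<beta> (J2 X)) om3 X Y Z = wedge_1_2 \<beta> om1 X Y Z"
proof -
  have neg: "\<beta> (- U) = - \<beta> U" if "U \<in> \<xi>" for U
    using \<beta> that scaleR_minus1_left[of U] unfolding linear_on_subspace_def by (metis real_scaleR_def mult_minus1)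
  note eqs = wedge_J_om[OF linear_on_J(1)[OF \<beta>] V] wedge_J_om[OF linear_on_J(2)[OF \<beta>] V]
    wedge_J_om[OF linear_on_J(3)[OF \<beta>] V]
  show "wedge_1_2 (\<lambda>X. \<beta> (J2 X)) om1 X Y Z = - wedge_1_2 \<beta> om3 X Y Z"
    "wedge_1_2 (\<lambda>X. \<beta> (J3 X)) om1 X Y Z = wedge_1_2 \<beta> om2 X Y Z"
    "wedge_1_2 (\<lambda>X. \<beta> (J1 X)) om2 X Y Z = wedge_1_2 \<beta> om3 X Y Z"
    "wedge_1_2 (\<lambda>X. \<beta> (J3 X)) om2 X Y Z = - wedge_1_2 \<beta> om1 X Y Z"
    "wedge_1_2 (\<lambda>X. \<beta> (J1 X)) om3 X Y Z = - wedge_1_2 \<beta> om2 X Y Z"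
    "wedge_1_2 (\<lambda>X. \<beta> (J2 X)) om3 X Y Z = wedge_1_2 \<beta> om1 X Y Z"
    using eqs unfolding wedge_1_2_def by (simp_all add: V J_table J_closed neg)
qed

text \<open>The covariant derivative of \<open>\<omega>\<^sub>k\<close> is \<open>T\<^sub>k\<close> evaluated on that of \<open>\<eta>\<close>.\<close>

definition T1 :: "'w \<Rightarrow> 'v \<Rightarrow> 'v \<Rightarrow> real" where
  "T1 \<psi> Y Z = inner (j1 (cl Y \<psi>)) (cl Z \<eta>) - inner (j1 (cl Z \<psi>)) (cl Y \<eta>)"
definition T2 :: "'w \<Rightarrow> 'v \<Rightarrow> 'v \<Rightarrow> real" where
  "T2 \<psi> Y Z = inner (j2 (cl Y \<psi>)) (cl Z \<eta>) - inner (j2 (cl Z \<psi>)) (cl Y \<eta>)"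
definition T3 :: "'w \<Rightarrow> 'v \<Rightarrow> 'v \<Rightarrow> real" where
  "T3 \<psi> Y Z = inner (j3 (cl Y \<psi>)) (cl Z \<eta>) - inner (j3 (cl Z \<psi>)) (cl Y \<eta>)"

lemmas T_defs = T1_def T2_def T3_def

lemma T_linear:
  "T1 (\<psi> + \<psi>') Y Z = T1 \<psi> Y Z + T1 \<psi>' Y Z" "T1 (r *\<^sub>R \<psi>) Y Z = r * T1 \<psi> Y Z"
  "T2 (\<psi> + \<psi>') Y Z = T2 \<psi> Y Z + T2 \<psi>' Y Z" "T2 (r *\<^sub>R \<psi>) Y Z = r * T2 \<psi> Y Z"
  "T3 (\<psi> + \<psi>') Y Z = T3 \<psi> Y Z + T3 \<psi>' Y Z" "T3 (r *\<^sub>R \<psi>) Y Z = r * T3 \<psi> Y Z"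
  by (simp_all add: T_defs cl_simps j_simps inner_simps algebra_simps)

text \<open>Moving \<eta> towards \<jmath>_l \<eta> fixes \<omega>_l and rotates the other two forms
  into each other. This is the source of the \<phi>-terms and of their antisymmetry.\<close>

lemma T_j:
  "T1 (j1 \<eta>) Y Z = 0" "T1 (j2 \<eta>) Y Z = - 2 * om3 Y Z" "T1 (j3 \<eta>) Y Z = 2 * om2 Y Z"
  "T2 (j1 \<eta>) Y Z = - 2 * om3 Y Z" "T2 (j2 \<eta>) Y Z = 0" "T2 (j3 \<eta>) Y Z = - 2 * om1 Y Z"
  "T3 (j1 \<eta>) Y Z = 2 * om2 Y Z" "T3 (j2 \<eta>) Y Z = 2 * om1 Y Z" "T3 (j3 \<eta>) Y Z = 0"
  using om_skew[of Y Z] g_commute[of Y Z]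
  by (simp_all add: T_defs cl_j j_simps j_table om_defs inner_cl_cl)

text \<open>Moving \<jmath>_k across the scalar product leaves a product of two horizontal vectors
  on \<eta>, paired with an element of \<xi>\<eta>.\<close>

lemma T_\<xi>_horizontal:
  assumes "U \<in> \<xi>" "Y \<in> \<xi>" "Z \<in> \<xi>"
  shows "T1 (cl U \<eta>) Y Z = 0" "T2 (cl U \<eta>) Y Z = 0" "T3 (cl U \<eta>) Y Z = 0"
  using assms by (simp_all add: T_defs j_skew cl_J[symmetric] \<xi>_products_orthogonal J_closed)

text \<open>As U is orthogonal to R, RU\<eta> = - UR\<eta> = \<jmath>1 U\<eta>. Both terms of T_k
  then contribute equally, which gives the factor 2.\<close>

lemma T_\<xi>_R:
  assumes "U \<in> \<xi>" "Y \<in> \<xi>"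
  shows "T1 (cl U \<eta>) Y R = 2 * g U Y" "T2 (cl U \<eta>) Y R = 2 * om3 U Y" "T3 (cl U \<eta>) Y R = - 2 * om2 U Y"
proof -
  have "cl R (cl U \<eta>) = j1 (cl U \<eta>)"
    using cl_anticommute[of R U \<eta>] assms(1) by (simp add: g_R cl_R cl_simps cl_j)
  then show "T1 (cl U \<eta>) Y R = 2 * g U Y" "T2 (cl U \<eta>) Y R = 2 * om3 U Y" "T3 (cl U \<eta>) Y R = - 2 * om2 U Y"
    by (simp_all add: T_defs cl_R j_table om_defs j_simps j_skew cl_skew cl_j cl_simps inner_cl_cl[symmetric])
qed

lemma T_\<xi>:
  assumes "U \<in> \<xi>"
  shows "T1 (cl U \<eta>) Y Z = 2 * (g R Z * g U Y - g R Y * g U Z)"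
    "T2 (cl U \<eta>) Y Z = 2 * (g R Z * om3 U Y - g R Y * om3 U Z)"
    "T3 (cl U \<eta>) Y Z = - 2 * (g R Z * om2 U Y - g R Y * om2 U Z)"
proof -
  have lin: "T1 \<psi> (Y + a *\<^sub>R R) (Z + b *\<^sub>R R) = T1 \<psi> Y Z + b * T1 \<psi> Y R - a * T1 \<psi> Z R"
    "T2 \<psi> (Y + a *\<^sub>R R) (Z + b *\<^sub>R R) = T2 \<psi> Y Z + b * T2 \<psi> Y R - a * T2 \<psi> Z R"
    "T3 \<psi> (Y + a *\<^sub>R R) (Z + b *\<^sub>R R) = T3 \<psi> Y Z + b * T3 \<psi> Y R - a * T3 \<psi> Z R" for \<psi> Y Z a b
    by (simp_all add: T_defs cl_simps j_simps inner_simps algebra_simps)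
  have gU: "g U (hor W) = g U W" for W
    using g_R[OF assms] by (simp add: hor_def g_simps g_commute[of U R])
  show "T1 (cl U \<eta>) Y Z = 2 * (g R Z * g U Y - g R Y * g U Z)"
    "T2 (cl U \<eta>) Y Z = 2 * (g R Z * om3 U Y - g R Y * om3 U Z)"
    "T3 (cl U \<eta>) Y Z = - 2 * (g R Z * om2 U Y - g R Y * om2 U Z)"
    using lin[of "cl U \<eta>" "hor Y" "g R Y" "hor Z" "g R Z"] assms
    by (simp_all add: hor_decomp[symmetric] T_\<xi>_horizontal T_\<xi>_R hor_in_\<xi> gU om_hor algebra_simps)
qed

end

section \<open>Contributions of the components of S\<close>

locale su2_decomposition = su2_point cl g j1 j2 j3 \<eta> \<xi> J1 J2 J3 R
  for cl :: "'v::real_vector \<Rightarrow> 'w::real_inner \<Rightarrow> 'w" and g j1 j2 j3 \<eta> \<xi> J1 J2 J3 R +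
  fixes S S0 S1 S2 S3 :: "'v \<Rightarrow> 'v" and \<mu> l1 l2 l3 :: real
  assumes S: "X \<in> \<xi> \<Longrightarrow> S X = \<mu> *\<^sub>R X + (S1 X + S2 X + S3 X) + (l1 *\<^sub>R J1 X + l2 *\<^sub>R J2 X + l3 *\<^sub>R J3 X) + S0 X"
    and closed: "X \<in> \<xi> \<Longrightarrow> S0 X \<in> \<xi>" "X \<in> \<xi> \<Longrightarrow> S1 X \<in> \<xi>" "X \<in> \<xi> \<Longrightarrow> S2 X \<in> \<xi>" "X \<in> \<xi> \<Longrightarrow> S3 X \<in> \<xi>"
    and symm: "X \<in> \<xi> \<Longrightarrow> Y \<in> \<xi> \<Longrightarrow> g (S1 X) Y = g X (S1 Y)"
      "X \<in> \<xi> \<Longrightarrow> Y \<in> \<xi> \<Longrightarrow> g (S2 X) Y = g X (S2 Y)"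
      "X \<in> \<xi> \<Longrightarrow> Y \<in> \<xi> \<Longrightarrow> g (S3 X) Y = g X (S3 Y)"
      "X \<in> \<xi> \<Longrightarrow> Y \<in> \<xi> \<Longrightarrow> g (S0 X) Y = - g X (S0 Y)"
    and S_J2: "X \<in> \<xi> \<Longrightarrow> S1 (J2 X) = - J2 (S1 X)" "X \<in> \<xi> \<Longrightarrow> S2 (J2 X) = J2 (S2 X)"
      "X \<in> \<xi> \<Longrightarrow> S3 (J2 X) = - J2 (S3 X)" "X \<in> \<xi> \<Longrightarrow> S0 (J2 X) = J2 (S0 X)"
    and S_J3: "X \<in> \<xi> \<Longrightarrow> S1 (J3 X) = - J3 (S1 X)" "X \<in> \<xi> \<Longrightarrow> S2 (J3 X) = - J3 (S2 X)"
      "X \<in> \<xi> \<Longrightarrow> S3 (J3 X) = J3 (S3 X)" "X \<in> \<xi> \<Longrightarrow> S0 (J3 X) = J3 (S0 X)"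
begin

lemma S_in_\<xi>: "X \<in> \<xi> \<Longrightarrow> S X \<in> \<xi>"
  using subspace by (simp add: S closed J_closed subspace_add subspace_scale)

text \<open>Alternation removes the symmetric components, the multiple of the identity and the S_k,
  and doubles the skew ones, the J_l and S_0.\<close>

lemma skew_part_S:
  assumes "Y \<in> \<xi>" "Z \<in> \<xi>"
  shows "g (S Y) Z - g (S Z) Y = 2 * (l1 * om1 Y Z + l2 * om2 Y Z + l3 * om3 Y Z) + 2 * g (S0 Y) Z"
  using symm[OF assms] om_skew[of Y Z]
    g_commute[of Y "S0 Z"] g_commute[of Y "S1 Z"] g_commute[of Y "S2 Z"] g_commute[of Y "S3 Z"] g_commute[of Y Z]
  by (simp add: S assms g_simps g_J algebra_simps)

text \<open>A symmetric S_k composed with J_m is skew if the two commute and symmetric if they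
  anticommute; for the skew S_0, which commutes with J_m, the composition is symmetric. Hence
  \<omega>_3 retains S_3 and \<omega>_2 retains S_2.\<close>

lemma om_S_S:
  assumes "Y \<in> \<xi>" "Z \<in> \<xi>"
  shows "om3 (S1 Z) Y = om3 (S1 Y) Z" "om3 (S2 Z) Y = om3 (S2 Y) Z" "om3 (S3 Z) Y = - om3 (S3 Y) Z" "om3 (S0 Z) Y = om3 (S0 Y) Z"
    "om2 (S1 Z) Y = om2 (S1 Y) Z" "om2 (S3 Z) Y = om2 (S3 Y) Z" "om2 (S2 Z) Y = - om2 (S2 Y) Z" "om2 (S0 Z) Y = om2 (S0 Y) Z"
proof -
  note c = assms closed J_closed
  have 3: "g (J3 (S1 Z)) Y = - g (J3 Z) (S1 Y)" "g (J3 (S2 Z)) Y = - g (J3 Z) (S2 Y)"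
    "g (J3 (S3 Z)) Y = g (J3 Z) (S3 Y)" "g (J3 (S0 Z)) Y = - g (J3 Z) (S0 Y)"
    using symm[of "J3 Z" Y] by (simp_all add: c S_J3 g_simps)
  have 2: "g (J2 (S1 Z)) Y = - g (J2 Z) (S1 Y)" "g (J2 (S3 Z)) Y = - g (J2 Z) (S3 Y)"
    "g (J2 (S2 Z)) Y = g (J2 Z) (S2 Y)" "g (J2 (S0 Z)) Y = - g (J2 Z) (S0 Y)"
    using symm[of "J2 Z" Y] by (simp_all add: c S_J2 g_simps)
  have sk: "g (J3 Z) U = - om3 U Z" "g (J2 Z) U = - om2 U Z" for U
    using om_skew[of Z U] by (simp_all add: g_J assms)
  show "om3 (S1 Z) Y = om3 (S1 Y) Z" "om3 (S2 Z) Y = om3 (S2 Y) Z" "om3 (S3 Z) Y = - om3 (S3 Y) Z" "om3 (S0 Z) Y = om3 (S0 Y) Z"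
    "om2 (S1 Z) Y = om2 (S1 Y) Z" "om2 (S3 Z) Y = om2 (S3 Y) Z" "om2 (S2 Z) Y = - om2 (S2 Y) Z" "om2 (S0 Z) Y = om2 (S0 Y) Z"
    using 2 3 unfolding sk by (simp_all add: g_J c)
qed

text \<open>Among I and the J_l, the one equal to J_m turns \<omega>_m into a multiple of the metric
  and is lost by alternation; the other three yield the three forms.\<close>

lemma om_S:
  assumes "Y \<in> \<xi>" "Z \<in> \<xi>"
  shows "om3 (S Y) Z - om3 (S Z) Y = 2 * (\<mu> * om3 Y Z + l1 * om2 Y Z - l2 * om1 Y Z) + 2 * om3 (S3 Y) Z"
    "om2 (S Y) Z - om2 (S Z) Y = 2 * (\<mu> * om2 Y Z - l1 * om3 Y Z + l3 * om1 Y Z) + 2 * om2 (S2 Y) Z"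
  using om_skew[of Y Z] g_commute[of Z Y]
  by (simp_all add: S assms om_linear om_J om_S_S[OF assms] algebra_simps)

text \<open>\<open>N X\<close> stands for the derivative of \<eta> along X. The V-terms carry two
  factors \<alpha> and cancel in the cyclic sum.\<close>

theorem d_om:
  assumes N: "\<And>X. N X = cl (S (hor X)) \<eta> + g R X *\<^sub>R cl V \<eta> +
      ((\<Theta>1 (hor X) + g R X * \<phi>1) *\<^sub>R j1 \<eta> + (\<Theta>2 (hor X) + g R X * \<phi>2) *\<^sub>R j2 \<eta> + (\<Theta>3 (hor X) + g R X * \<phi>3) *\<^sub>R j3 \<eta>)"
    and V: "V \<in> \<xi>"
    and \<Theta>: "linear_on_subspace \<xi> \<Theta>1" "linear_on_subspace \<xi> \<Theta>2" "linear_on_subspace \<xi> \<Theta>3"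
  shows "T1 (N X) Y Z - T1 (N Y) X Z + T1 (N Z) X Y =
      wedge_1_2 (g R) (\<lambda>X Y. 4 * g (S0 (hor X)) (hor Y)) X Y Z
      + (4 * l1 * wedge_1_2 (g R) om1 X Y Z + (4 * l2 + 2 * \<phi>3) * wedge_1_2 (g R) om2 X Y Z
        + (4 * l3 - 2 * \<phi>2) * wedge_1_2 (g R) om3 X Y Z)
      + wedge_1_2 (\<lambda>X. 2 * (\<Theta>2 (J2 (hor X)) + \<Theta>3 (J3 (hor X)))) om1 X Y Z"
    "T2 (N X) Y Z - T2 (N Y) X Z + T2 (N Z) X Y =
      wedge_1_2 (g R) (\<lambda>X Y. 4 * om3 (S3 (hor X)) Y) X Y Z
      + (- (4 * l2 + 2 * \<phi>3) * wedge_1_2 (g R) om1 X Y Z + 4 * l1 * wedge_1_2 (g R) om2 X Y Z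
        + (4 * \<mu> - 2 * \<phi>1) * wedge_1_2 (g R) om3 X Y Z)
      + wedge_1_2 (\<lambda>X. - 2 * (\<Theta>1 (J1 (hor X)) - \<Theta>3 (J3 (hor X)))) om2 X Y Z"
    "T3 (N X) Y Z - T3 (N Y) X Z + T3 (N Z) X Y =
      wedge_1_2 (g R) (\<lambda>X Y. - 4 * om2 (S2 (hor X)) Y) X Y Z
      + (- (4 * l3 - 2 * \<phi>2) * wedge_1_2 (g R) om1 X Y Z + - (4 * \<mu> - 2 * \<phi>1) * wedge_1_2 (g R) om2 X Y Z
        + 4 * l1 * wedge_1_2 (g R) om3 X Y Z)
      + wedge_1_2 (\<lambda>X. - 2 * (\<Theta>1 (J1 (hor X)) - \<Theta>2 (J2 (hor X)))) om3 X Y Z"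
proof -
  have g_hor: "g U (hor W) = g U W" if "U \<in> \<xi>" for U W
    using g_R[OF that] by (simp add: hor_def g_simps g_commute[of U R])
  note h = hor_in_\<xi>
  have S': "g (S (hor Y)) Z - g (S (hor Z)) Y = 2 * (l1 * om1 Y Z + l2 * om2 Y Z + l3 * om3 Y Z) + 2 * g (S0 (hor Y)) (hor Z)"
    "om3 (S (hor Y)) Z - om3 (S (hor Z)) Y = 2 * (\<mu> * om3 Y Z + l1 * om2 Y Z - l2 * om1 Y Z) + 2 * om3 (S3 (hor Y)) Z"
    "om2 (S (hor Y)) Z - om2 (S (hor Z)) Y = 2 * (\<mu> * om2 Y Z - l1 * om3 Y Z + l3 * om1 Y Z) + 2 * om2 (S2 (hor Y)) Z" for Y Z
    using skew_part_S[of "hor Y" "hor Z"] om_S[of "hor Y" "hor Z"] h by (simp_all add: om_hor g_hor S_in_\<xi>)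
  \<comment> \<open>By \<open>T_\<xi>\<close>, the S-terms of the cyclic sum occur with a factor
    \<alpha>, so the alternation identities are prepared with this factor.\<close>
  have m: "g R X * (g (S (hor Y)) Z - g (S (hor Z)) Y) = g R X * (2 * (l1 * om1 Y Z + l2 * om2 Y Z + l3 * om3 Y Z) + 2 * g (S0 (hor Y)) (hor Z))"
    "g R X * (om3 (S (hor Y)) Z - om3 (S (hor Z)) Y) = g R X * (2 * (\<mu> * om3 Y Z + l1 * om2 Y Z - l2 * om1 Y Z) + 2 * om3 (S3 (hor Y)) Z)"
    "g R X * (om2 (S (hor Y)) Z - om2 (S (hor Z)) Y) = g R X * (2 * (\<mu> * om2 Y Z - l1 * om3 Y Z + l3 * om1 Y Z) + 2 * om2 (S2 (hor Y)) Z)" for X Y Z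
    by (simp_all only: S')
  \<comment> \<open>The duality holds for horizontal vectors; since the forms ignore R, projecting
    the arguments changes only those of the \<Theta>_l, which are projected already.\<close>
  note W = wedge_J_om_eq[OF _ h h h, of _ X Y Z, unfolded wedge_1_2_def om_hor]
  note unf = N T_linear T_\<xi>[OF S_in_\<xi>[OF h]] T_\<xi>[OF V] T_j wedge_1_2_def
  show "T1 (N X) Y Z - T1 (N Y) X Z + T1 (N Z) X Y =
      wedge_1_2 (g R) (\<lambda>X Y. 4 * g (S0 (hor X)) (hor Y)) X Y Z
      + (4 * l1 * wedge_1_2 (g R) om1 X Y Z + (4 * l2 + 2 * \<phi>3) * wedge_1_2 (g R) om2 X Y Z
        + (4 * l3 - 2 * \<phi>2) * wedge_1_2 (g R) om3 X Y Z)
      + wedge_1_2 (\<lambda>X. 2 * (\<Theta>2 (J2 (hor X)) + \<Theta>3 (J3 (hor X)))) om1 X Y Z"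
    using m(1)[of X Y Z] m(1)[of Y X Z] m(1)[of Z X Y] W(1)[OF \<Theta>(2)] W(2)[OF \<Theta>(3)]
    unfolding unf by (simp add: algebra_simps)
  show "T2 (N X) Y Z - T2 (N Y) X Z + T2 (N Z) X Y =
      wedge_1_2 (g R) (\<lambda>X Y. 4 * om3 (S3 (hor X)) Y) X Y Z
      + (- (4 * l2 + 2 * \<phi>3) * wedge_1_2 (g R) om1 X Y Z + 4 * l1 * wedge_1_2 (g R) om2 X Y Z
        + (4 * \<mu> - 2 * \<phi>1) * wedge_1_2 (g R) om3 X Y Z)
      + wedge_1_2 (\<lambda>X. - 2 * (\<Theta>1 (J1 (hor X)) - \<Theta>3 (J3 (hor X)))) om2 X Y Z"
    using m(2)[of X Y Z] m(2)[of Y X Z] m(2)[of Z X Y] W(3)[OF \<Theta>(1)] W(4)[OF \<Theta>(3)]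
    unfolding unf by (simp add: algebra_simps)
  show "T3 (N X) Y Z - T3 (N Y) X Z + T3 (N Z) X Y =
      wedge_1_2 (g R) (\<lambda>X Y. - 4 * om2 (S2 (hor X)) Y) X Y Z
      + (- (4 * l3 - 2 * \<phi>2) * wedge_1_2 (g R) om1 X Y Z + - (4 * \<mu> - 2 * \<phi>1) * wedge_1_2 (g R) om2 X Y Z
        + 4 * l1 * wedge_1_2 (g R) om3 X Y Z)
      + wedge_1_2 (\<lambda>X. - 2 * (\<Theta>1 (J1 (hor X)) - \<Theta>2 (J2 (hor X)))) om3 X Y Z"
    using m(3)[of X Y Z] m(3)[of Y X Z] m(3)[of Z X Y] W(5)[OF \<Theta>(1)] W(6)[OF \<Theta>(2)]
    unfolding unf by (simp add: algebra_simps)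
qed

end

section \<open>The SU(2) structure of a unit spinor\<close>

declare One_nat_def [simp del]

context spin_manifold begin

lemma clifford_cl: "clifford M x v (clifford M x v w) = - (metric M x v v *\<^sub>R w)"
  by (simp add: clifford_def cl_cl metric_inv_frame power2_norm_eq_inner)

lemma clifford_anticommute: "clifford M x u (clifford M x v w) = - clifford M x v (clifford M x u w) - (2 * metric M x u v) *\<^sub>R w"
  unfolding clifford_def metric_inv_frame by (rule cl_anticommute)

lemma clifford_skew: "inner (clifford M x v w) w' = - inner w (clifford M x v w')"
  by (simp add: clifford_def cl_skew)

lemma inner_clifford_clifford: "inner (clifford M x u w) (clifford M x v w) = metric M x u v * inner w w"
proof -
  have "inner (clifford M x u w) (clifford M x v w) = - inner w (clifford M x u (clifford M x v w))"
    by (rule clifford_skew)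
  also have "\<dots> = inner w (clifford M x v (clifford M x u w)) + 2 * metric M x u v * inner w w"
    by (subst clifford_anticommute) (simp add: inner_simps)
  also have "inner w (clifford M x v (clifford M x u w)) = - inner (clifford M x u w) (clifford M x v w)"
    using clifford_skew[of x v w "clifford M x u w"] by (simp add: inner_commute)
  finally show ?thesis by simp
qed

lemma clifford_frame: "clif M v w = clifford M x (frame M (idx_at M x) x v) w"
  by (simp add: clifford_def idx_at)

text \<open>Reconciles two readings of orientation: the volume element uses the preferred frame, the
  hypothesis a determinant of chart components.\<close>

lemma oriented_orthonormal_volume:
  assumes orth: "\<And>i j. metric M x (b $ i) (b $ j) = (if i = j then 1 else 0)"
    and det: "det (b :: real ^ 5 ^ 5) > 0"
  shows "clifford M x (b $ 1) (clifford M x (b $ 2) (clifford M x (b $ 3) (clifford M x (b $ 4) (clifford M x (b $ 5) w)))) = vol w"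
proof -
  let ?F = "frame M (idx_at M x) x"
  \<comment> \<open>The transpose has the basis vectors as columns, so \<open>L\<close> sends the
    standard basis to \<open>b\<close>; \<open>T\<close> below expresses them in the frame.\<close>
  define L where "L = (*v) (transpose b)"
  define T where "T v = inv ?F (L v)" for v
  have lin: "linear L"
    by (simp add: L_def)
  have lT: "linear T"
    using linear_compose[OF lin linear_inv_frame[OF idx_at]] by (simp add: T_def[abs_def] o_def)
  have axis: "L (axis i 1) = b $ i" for i
    unfolding L_def by (simp only: matrix_vector_mult_basis column_transpose row_def vec_lambda_eta)
  have inner_T: "inner (T u) (T v) = inner u v" for u v
  proof -
    have "bilinear (\<lambda>u v. inner (T u) (T v))"
      unfolding bilinear_def by (auto intro!: linearI simp: linear_add[OF lT] linear_cmul[OF lT] inner_simps)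
    moreover have "bilinear (\<lambda>u v. inner u (v :: real ^ 5))"
      unfolding bilinear_def by (auto intro!: linearI simp: inner_simps)
    moreover have "inner (T i) (T j) = inner i j" if "i \<in> Basis" "j \<in> Basis" for i j
      using that orth by (auto simp: Basis_vec_def T_def axis metric_inv_frame inner_axis_axis)
    ultimately show ?thesis by (rule bilinear_eq_stdbasis[THEN fun_cong, THEN fun_cong])
  qed
  then have oT: "orthogonal_transformation T"
    by (simp add: orthogonal_transformation_def lT)
  have "?F \<circ> T = L"
    by (auto simp: T_def idx_at)
  then have "matrix L = matrix ?F ** matrix T"
    using matrix_compose[OF lT frame(1)[OF idx_at]] by metis
  moreover have "matrix L = transpose b"
    unfolding L_def by (rule matrix_of_matrix_vector_mul)
  \<comment> \<open>The frame has positive determinant, so \<open>T\<close> does as well; being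
    orthogonal, it has determinant 1.\<close>
  ultimately have "det b = det (matrix ?F) * det (matrix T)"
    by (metis det_mul det_transpose)
  then have "det (matrix T) > 0"
    using det frame(3)[OF idx_at[of x]] by (simp add: zero_less_mult_iff)
  then have "det (matrix T) = 1"
    using orthogonal_transformation_det[OF oT] by simp
  then show ?thesis
    using orthogonal_transformation_vol[OF oT, of w] by (simp add: T_def axis clifford_def)
qed

end

section \<open>From the manifold to the algebra at a point\<close>

locale su2_manifold = spin_manifold M for M :: "('m::{t2_space, second_countable_topology}, 'w::euclidean_space, 'i) spin_manifold" +
  fixes j2 :: "'m \<Rightarrow> 'w \<Rightarrow> 'w" and \<eta> :: "'m \<Rightarrow> 'w"
    and \<xi> :: "'m \<Rightarrow> (real ^ 5) set" and J :: "nat \<Rightarrow> 'm \<Rightarrow> real ^ 5 \<Rightarrow> real ^ 5"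
    and R :: "'m \<Rightarrow> real ^ 5"
  assumes parallel_structure: "parallel_structure M j2"
    and unit_spinor: "unit_spinor M \<eta>"
    and su2_structure: "su2_structure M j2 \<eta> \<xi> J R"
begin

definition j3 :: "'m \<Rightarrow> 'w \<Rightarrow> 'w" where "j3 x w = vol (j2 x w)"

lemma jmath: "jmath M j2 1 x w = vol w" "jmath M j2 2 x w = j2 x w" "jmath M j2 3 x w = j3 x w"
  by (simp_all add: jmath_def volume_mult j3_def)

lemma linear_j2: "linear (j2 x)" and norm_j2: "norm (j2 x w) = norm w" and j2_j2: "j2 x (j2 x w) = - w"
  and j2_clifford: "j2 x (clifford M x v w) = - clifford M x v (j2 x w)"
  using parallel_structure unfolding parallel_structure_def by simp_all

lemma j2_skew: "inner (j2 x w) w' = - inner w (j2 x w')"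
proof -
  have "orthogonal_transformation (j2 x)"
    using linear_j2 norm_j2 by (simp add: orthogonal_transformation)
  then have "inner (j2 x (j2 x w)) (j2 x w') = inner (j2 x w) w'"
    by (simp add: orthogonal_transformation_def)
  then show ?thesis by (simp add: j2_j2)
qed

text \<open>\<open>j2\<close> anticommutes with each of the five vector factors, an odd
  number.\<close>

lemma j2_vol: "j2 x (vol w) = - vol (j2 x w)"
  by (simp add: vol_def clifford_frame[of _ _ x] j2_clifford linear_neg[OF linear_clifford])

lemma vol_clifford: "clifford M x v (vol w) = vol (clifford M x v w)"
  by (simp add: clifford_def vol_cl)

lemma unit: "inner (\<eta> x) (\<eta> x) = 1"
  using unit_spinor by (simp add: unit_spinor_def norm_eq_1)

lemma \<eta>_differentiable: "spinor_differentiable_at \<eta> x"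
  using unit_spinor smooth_spinor_differentiable by (simp add: unit_spinor_def)

lemma j3_skew: "inner (j3 x w) w' = - inner w (j3 x w')"
  by (simp add: j3_def vol_skew j2_skew j2_vol)

lemma j_orthogonal: "inner w (vol w) = 0" "inner w (j2 x w) = 0" "inner w (vol (j2 x w)) = 0"
  using vol_skew[of w w] j2_skew[of x w w] j3_skew[of x w w] by (simp_all add: inner_commute j3_def)

lemma j2_parallel:
  "spinor_differentiable_at (\<lambda>x. j2 x (\<eta> x)) x"
  "nabla M x v (\<lambda>x. j2 x (\<eta> x)) = j2 x (nabla M x v \<eta>)"
  using parallel_structure unit_spinor smooth_spinor_differentiable
  unfolding parallel_structure_def unit_spinor_def by (metis open_UNIV UNIV_I)+

lemma j3_parallel:
  "spinor_differentiable_at (\<lambda>x. j3 x (\<eta> x)) x"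
  "nabla M x v (\<lambda>x. j3 x (\<eta> x)) = j3 x (nabla M x v \<eta>)"
  using vol_parallel[OF j2_parallel(1)] by (simp_all add: j3_def j2_parallel(2))

lemma su2_structureD:
  "subspace (\<xi> x)" "dim (\<xi> x) = 4"
  "(\<lambda>X. clifford M x X (\<eta> x)) ` \<xi> x = orthogonal_comp (span {\<eta> x, vol (\<eta> x), j2 x (\<eta> x), j3 x (\<eta> x)})"
  "X \<in> \<xi> x \<Longrightarrow> J 1 x X \<in> \<xi> x" "X \<in> \<xi> x \<Longrightarrow> J 2 x X \<in> \<xi> x" "X \<in> \<xi> x \<Longrightarrow> J 3 x X \<in> \<xi> x"
  "X \<in> \<xi> x \<Longrightarrow> clifford M x (J 1 x X) (\<eta> x) = vol (clifford M x X (\<eta> x))"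
  "X \<in> \<xi> x \<Longrightarrow> clifford M x (J 2 x X) (\<eta> x) = j2 x (clifford M x X (\<eta> x))"
  "X \<in> \<xi> x \<Longrightarrow> clifford M x (J 3 x X) (\<eta> x) = j3 x (clifford M x X (\<eta> x))"
  "metric M x (R x) (R x) = 1" "X \<in> \<xi> x \<Longrightarrow> metric M x (R x) X = 0"
  "\<lbrakk>X1 \<in> \<xi> x; X2 \<in> \<xi> x; X3 \<in> \<xi> x; X4 \<in> \<xi> x;
    wedge_2_2 (omega M J R 1 x) (omega M J R 1 x) X1 X2 X3 X4 > 0\<rbrakk> \<Longrightarrow> det (vector [X1, X2, X3, X4, R x] :: real ^ 5 ^ 5) > 0"
  using su2_structure[unfolded su2_structure_def, rule_format, of x] by (simp_all add: jmath)

text \<open>The double orthogonal complement of a span is the span itself, and its four generators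
  are orthonormal.\<close>

lemma normal_expansion:
  assumes "\<And>X. X \<in> \<xi> x \<Longrightarrow> inner w (clifford M x X (\<eta> x)) = 0"
  shows "w = inner w (\<eta> x) *\<^sub>R \<eta> x + inner w (vol (\<eta> x)) *\<^sub>R vol (\<eta> x)
    + inner w (j2 x (\<eta> x)) *\<^sub>R j2 x (\<eta> x) + inner w (j3 x (\<eta> x)) *\<^sub>R j3 x (\<eta> x)"
proof -
  let ?U = "span {\<eta> x, vol (\<eta> x), j2 x (\<eta> x), j3 x (\<eta> x)}"
  have "w \<in> orthogonal_comp ((\<lambda>X. clifford M x X (\<eta> x)) ` \<xi> x)"
    using assms by (auto simp: orthogonal_comp_def orthogonal_def inner_commute)
  then have "w \<in> orthogonal_comp (orthogonal_comp ?U)"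
    by (simp only: su2_structureD(3))
  then have "w \<in> ?U" by (simp add: orthogonal_comp_self)
  then obtain a b c d where w: "w = a *\<^sub>R \<eta> x + b *\<^sub>R vol (\<eta> x) + c *\<^sub>R j2 x (\<eta> x) + d *\<^sub>R j3 x (\<eta> x)"
    by (auto simp: span_insert algebra_simps)
  have "inner w (\<eta> x) = a" "inner w (vol (\<eta> x)) = b" "inner w (j2 x (\<eta> x)) = c" "inner w (j3 x (\<eta> x)) = d"
    by (simp_all add: w j3_def inner_simps vol_skew j2_skew vol_vol j2_j2 j2_vol linear_neg[OF linear_vol] j_orthogonal unit)
  then show ?thesis using w by simp
qed

lemma metric_eq_inner: "metric M x u v = inner (clifford M x u (\<eta> x)) (clifford M x v (\<eta> x))"
  by (simp add: inner_clifford_clifford unit)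

text \<open>Dimension count: the unit vector R is outside \<xi>, so together with the
  four-dimensional \<xi> it spans the tangent space.\<close>

lemma horizontal_in_\<xi>: "X - metric M x (R x) X *\<^sub>R R x \<in> \<xi> x"
proof -
  have "R x \<notin> \<xi> x" using su2_structureD(10,11) by fastforce
  then have "dim (insert (R x) (\<xi> x)) = DIM(real ^ 5)"
    using su2_structureD(1,2) by (simp add: dim_insert span_eq_iff[THEN iffD2])
  then have "X \<in> span (insert (R x) (\<xi> x))"
    using dim_eq_full by blast
  then obtain k where "X - k *\<^sub>R R x \<in> \<xi> x"
    using su2_structureD(1) by (auto simp: span_insert span_eq_iff[THEN iffD2])
  moreover from su2_structureD(11)[OF this] have "metric M x (R x) X = k"
    by (simp add: metric_simps su2_structureD(10))
  ultimately show ?thesis by simp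
qed

lemma hor_\<xi>: "X \<in> \<xi> x \<Longrightarrow> Defs.hor M R x X = X"
  by (simp add: hor_def alpha_def su2_structureD(11))

text \<open>Orthogonality determines R\<eta> up to a factor c on \<open>vol (\<eta> x)\<close>.
  Evaluating the Clifford product of an adapted oriented basis in two ways yields -c = 1.\<close>

lemma clifford_R: "clifford M x (R x) (\<eta> x) = - vol (\<eta> x)"
proof -
  obtain X0 where X0: "X0 \<in> \<xi> x" "X0 \<noteq> 0"
    using su2_structureD(2)[of x] by (metis dim_eq_0 singletonI subsetI zero_neq_numeral)
  define X where "X = (1 / sqrt (metric M x X0 X0)) *\<^sub>R X0"
  have X: "X \<in> \<xi> x" using X0 su2_structureD(1) by (simp add: X_def subspace_scale)
  have gX: "metric M x X X = 1"
    using metric_pos[OF X0(2), of x] by (simp add: X_def metric_simps real_sqrt_mult[symmetric] divide_simps)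
  have Xw: "clifford M x X (clifford M x X w) = - w" for w
    by (simp add: clifford_cl gX)
  let ?w = "clifford M x X (\<eta> x)"
  have w1: "inner ?w ?w = 1" using gX by (simp add: metric_eq_inner)
  note closed = su2_structureD(4-6)[OF X]
  note J = su2_structureD(7-9)[OF X]
  have J1J2: "clifford M x (J 1 x (J 2 x X)) (\<eta> x) = j3 x ?w" "clifford M x (J 1 x (J 1 x X)) (\<eta> x) = - ?w"
    by (simp_all add: su2_structureD(7) closed J j3_def vol_vol)
  note inn = vol_skew j2_skew vol_vol j2_j2 j2_vol linear_neg[OF linear_vol] j_orthogonal w1 j3_def
  let ?b = "vector [X, J 1 x X, J 2 x X, J 3 x X, R x] :: real ^ 5 ^ 5"
  have "metric M x (?b $ i) (?b $ j) = (if i = j then 1 else 0)" for i j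
  proof -
    have a: "metric M x (R x) Y = 0" "metric M x Y (R x) = 0" if "Y \<in> \<xi> x" for Y
      using su2_structureD(11)[OF that] metric_commute by metis+
    have b: "metric M x X (J 1 x X) = 0" "metric M x X (J 2 x X) = 0" "metric M x X (J 3 x X) = 0"
      "metric M x (J 1 x X) X = 0" "metric M x (J 2 x X) X = 0" "metric M x (J 3 x X) X = 0"
      "metric M x (J 1 x X) (J 1 x X) = 1" "metric M x (J 2 x X) (J 2 x X) = 1" "metric M x (J 3 x X) (J 3 x X) = 1"
      "metric M x (J 1 x X) (J 2 x X) = 0" "metric M x (J 1 x X) (J 3 x X) = 0" "metric M x (J 2 x X) (J 3 x X) = 0"
      "metric M x (J 2 x X) (J 1 x X) = 0" "metric M x (J 3 x X) (J 1 x X) = 0" "metric M x (J 3 x X) (J 2 x X) = 0"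
      by (simp_all add: metric_eq_inner J inn)
    show ?thesis
      using exhaust_5[of i] exhaust_5[of j]
      by (elim disjE) (simp_all add: vector_5 a b closed X gX su2_structureD(10))
  qed
  \<comment> \<open>The pairs (X, J_1 X) and (J_2 X, J_3 X) both have \<omega>_1-value 1, and their
    product is counted twice. Positivity shows that the basis completed by R is oriented.\<close>
  moreover have "wedge_2_2 (omega M J R 1 x) (omega M J R 1 x) X (J 1 x X) (J 2 x X) (J 3 x X) = 2"
    by (simp add: wedge_2_2_def omega_def hor_\<xi> X closed) (simp add: metric_eq_inner J J1J2 inn)
  then have "det ?b > 0"
    by (intro su2_structureD(12) X closed) simp
  ultimately have "clifford M x X (clifford M x (J 1 x X) (clifford M x (J 2 x X)
      (clifford M x (J 3 x X) (clifford M x (R x) (\<eta> x))))) = vol (\<eta> x)"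
    using oriented_orthonormal_volume[of x ?b "\<eta> x"] by (simp add: vector_5)
  moreover define c where "c = inner (clifford M x (R x) (\<eta> x)) (vol (\<eta> x))"
  \<comment> \<open>R\<eta> is orthogonal to \<xi>\<eta> since R is normal to \<xi>, and to \<eta>,
    \<jmath>2 \<eta>, \<jmath>3 \<eta> by skewness.\<close>
  have R: "clifford M x (R x) (\<eta> x) = c *\<^sub>R vol (\<eta> x)"
  proof -
    let ?r = "clifford M x (R x) (\<eta> x)"
    have "inner ?r (\<eta> x) = 0"
      using clifford_skew[of x "R x" "\<eta> x" "\<eta> x"] by (simp add: inner_commute)
    moreover have "inner ?r (j2 x (\<eta> x)) = 0"
      using clifford_skew[of x "R x" "\<eta> x" "j2 x (\<eta> x)"] j2_clifford[of x "R x" "\<eta> x"] j2_skew[of x "\<eta> x" ?r]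
      by (simp add: inner_commute)
    moreover have "inner ?r (j3 x (\<eta> x)) = 0"
      using clifford_skew[of x "R x" "\<eta> x" "j3 x (\<eta> x)"] j3_skew[of x "\<eta> x" ?r]
      by (simp add: inner_commute j3_def vol_clifford j2_clifford linear_neg[OF linear_vol] linear_neg[OF linear_clifford])
    moreover have "inner ?r (clifford M x Y (\<eta> x)) = 0" if "Y \<in> \<xi> x" for Y
      using su2_structureD(11)[OF that] by (simp add: metric_eq_inner)
    ultimately show ?thesis
      using normal_expansion[of x ?r] by (simp add: c_def)
  qed
  have anti: "clifford M x (J 2 x X) ?w = - j2 x (\<eta> x)"
  proof -
    have "metric M x (J 2 x X) X = 0" by (simp add: metric_eq_inner J inn)
    then show ?thesis
      using clifford_anticommute[of x "J 2 x X" X "\<eta> x"] j2_clifford[of x X ?w] Xw[of "\<eta> x"]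
      by (simp add: J linear_neg[OF linear_j2])
  qed
  \<comment> \<open>The product is evaluated from the inside: the factors J_3 X, J_2 X and finally X
    J_1 X lead from c vol \<eta> to - c vol \<eta>.\<close>
  have "clifford M x (J 3 x X) (c *\<^sub>R vol (\<eta> x)) = - c *\<^sub>R j2 x ?w"
    by (simp add: linear_cmul[OF linear_clifford] vol_clifford J j3_def vol_vol)
  moreover have "clifford M x (J 2 x X) (- c *\<^sub>R j2 x ?w) = c *\<^sub>R \<eta> x"
  proof -
    have "clifford M x (J 2 x X) (j2 x ?w) = - j2 x (clifford M x (J 2 x X) ?w)"
      by (simp add: j2_clifford)
    then have "clifford M x (J 2 x X) (j2 x ?w) = - \<eta> x"
      by (simp add: anti linear_neg[OF linear_j2] j2_j2)
    then show ?thesis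
      by (simp add: linear_cmul[OF linear_clifford] linear_neg[OF linear_clifford])
  qed
  moreover have "clifford M x X (clifford M x (J 1 x X) (c *\<^sub>R \<eta> x)) = - c *\<^sub>R vol (\<eta> x)"
    by (simp add: linear_cmul[OF linear_clifford] J vol_clifford Xw linear_neg[OF linear_vol])
  ultimately have "- c *\<^sub>R vol (\<eta> x) = vol (\<eta> x)"
    by (simp add: R)
  then have "c *\<^sub>R vol (\<eta> x) + vol (\<eta> x) = c *\<^sub>R vol (\<eta> x) + - c *\<^sub>R vol (\<eta> x)"
    by simp
  then have "(c + 1) *\<^sub>R vol (\<eta> x) = 0"
    by (simp add: scaleR_left_distrib)
  moreover have "vol (\<eta> x) \<noteq> 0"
    using vol_vol[of "\<eta> x"] unit[of x] linear_0[OF linear_vol] by auto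
  ultimately have "c = - 1" by simp
  then show ?thesis using R by simp
qed

lemma clifford_j2: "clifford M x v (j2 x w) = - j2 x (clifford M x v w)"
  by (simp add: j2_clifford)

lemma su2_point: "su2_point (clifford M x) (metric M x) vol (j2 x) (j3 x) (\<eta> x) (\<xi> x) (J 1 x) (J 2 x) (J 3 x) (R x)"
  by (rule su2_point.intro)
    (rule bilinear_clifford bilinear_metric metric_commute metric_pos clifford_cl clifford_skew linear_vol linear_j2
      j3_def vol_vol j2_j2 j2_vol vol_skew j2_skew vol_clifford clifford_j2 unit su2_structureD(1,4-11)
      clifford_R horizontal_in_\<xi> normal_expansion; assumption?)+

sublocale pt: su2_point "clifford M x" "metric M x" vol "j2 x" "j3 x" "\<eta> x" "\<xi> x" "J 1 x" "J 2 x" "J 3 x" "R x" for x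
  by (rule su2_point)

lemma hor_eq: "Defs.hor M R x X = pt.hor x X"
  by (simp add: Defs.hor_def pt.hor_def alpha_def)

lemma omega_eq:
  "omega M J R 1 x Y Z = pt.om1 x Y Z" "omega M J R 2 x Y Z = pt.om2 x Y Z" "omega M J R 3 x Y Z = pt.om3 x Y Z"
  by (simp_all add: omega_def hor_eq pt.g_J pt.hor_in_\<xi> pt.om_hor)

lemma ext_deriv_omega:
  "ext_deriv (charts M) (omega M J R 1) x X Y Z =
    pt.T1 x (nabla M x X \<eta>) Y Z - pt.T1 x (nabla M x Y \<eta>) X Z + pt.T1 x (nabla M x Z \<eta>) X Y"
  "ext_deriv (charts M) (omega M J R 2) x X Y Z =
    pt.T2 x (nabla M x X \<eta>) Y Z - pt.T2 x (nabla M x Y \<eta>) X Z + pt.T2 x (nabla M x Z \<eta>) X Y"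
  "ext_deriv (charts M) (omega M J R 3) x X Y Z =
    pt.T3 x (nabla M x X \<eta>) Y Z - pt.T3 x (nabla M x Y \<eta>) X Z + pt.T3 x (nabla M x Z \<eta>) X Y"
proof -
  have o1: "omega M J R 1 = (\<lambda>x u v. inner (clifford M x u (vol (\<eta> x))) (clifford M x v (\<eta> x)))"
    by (intro ext) (simp add: omega_eq pt.om1_def vol_clifford)
  \<comment> \<open>For k = 2, 3 the structure is placed on the second spinor: the sign of skewness
    and that of anticommuting with vectors then cancel. For k = 1 it commutes with vectors and stays
    on the first.\<close>
  have o2: "omega M J R 2 = (\<lambda>x u v. inner (clifford M x u (\<eta> x)) (clifford M x v (j2 x (\<eta> x))))"
    by (intro ext) (simp add: omega_eq pt.om2_def pt.cl_j2 j2_skew)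
  have o3: "omega M J R 3 = (\<lambda>x u v. inner (clifford M x u (\<eta> x)) (clifford M x v (j3 x (\<eta> x))))"
    by (intro ext) (simp add: omega_eq pt.om3_def pt.cl_j3 j3_skew)
  have t1: "inner (clifford M x Y (vol N)) (clifford M x Z (\<eta> x)) + inner (clifford M x Y (vol (\<eta> x))) (clifford M x Z N)
    = pt.T1 x N Y Z" for N Y Z
    using vol_skew[of "clifford M x Z N" "clifford M x Y (\<eta> x)"] inner_commute[of "vol (clifford M x Y (\<eta> x))" "clifford M x Z N"]
    by (simp add: pt.T1_def vol_clifford)
  have t2: "inner (clifford M x Y N) (clifford M x Z (j2 x (\<eta> x))) + inner (clifford M x Y (\<eta> x)) (clifford M x Z (j2 x N))
    = pt.T2 x N Y Z" for N Y Z
    using j2_skew[of x "clifford M x Y N" "clifford M x Z (\<eta> x)"] inner_commute[of "clifford M x Y (\<eta> x)" "j2 x (clifford M x Z N)"]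
    by (simp add: pt.T2_def pt.cl_j2)
  have t3: "inner (clifford M x Y N) (clifford M x Z (j3 x (\<eta> x))) + inner (clifford M x Y (\<eta> x)) (clifford M x Z (j3 x N))
    = pt.T3 x N Y Z" for N Y Z
    using j3_skew[of x "clifford M x Y N" "clifford M x Z (\<eta> x)"] inner_commute[of "clifford M x Y (\<eta> x)" "j3 x (clifford M x Z N)"]
    by (simp add: pt.T3_def pt.cl_j3)
  have sk: "omega M J R 1 x u v = - omega M J R 1 x v u" "omega M J R 2 x u v = - omega M J R 2 x v u"
    "omega M J R 3 x u v = - omega M J R 3 x v u" for u v
    using pt.om_skew[of x u v] by (simp_all add: omega_eq)
  show "ext_deriv (charts M) (omega M J R 1) x X Y Z =
    pt.T1 x (nabla M x X \<eta>) Y Z - pt.T1 x (nabla M x Y \<eta>) X Z + pt.T1 x (nabla M x Z \<eta>) X Y"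
    unfolding o1
    by (subst ext_deriv_clifford_form[OF vol_parallel(1)[OF \<eta>_differentiable] \<eta>_differentiable sk(1)[unfolded o1]])
      (simp add: vol_parallel(2)[OF \<eta>_differentiable] t1)
  show "ext_deriv (charts M) (omega M J R 2) x X Y Z =
    pt.T2 x (nabla M x X \<eta>) Y Z - pt.T2 x (nabla M x Y \<eta>) X Z + pt.T2 x (nabla M x Z \<eta>) X Y"
    unfolding o2
    by (subst ext_deriv_clifford_form[OF \<eta>_differentiable j2_parallel(1) sk(2)[unfolded o2]])
      (simp add: j2_parallel(2) t2)
  show "ext_deriv (charts M) (omega M J R 3) x X Y Z =
    pt.T3 x (nabla M x X \<eta>) Y Z - pt.T3 x (nabla M x Y \<eta>) X Z + pt.T3 x (nabla M x Z \<eta>) X Y"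
    unfolding o3
    by (subst ext_deriv_clifford_form[OF \<eta>_differentiable j3_parallel(1) sk(3)[unfolded o3]])
      (simp add: j3_parallel(2) t3)
qed

end

section \<open>The torsion forms\<close>

theorem proposition4p18:
  fixes M :: "('m::{t2_space, second_countable_topology}, 'w::euclidean_space, 'i) spin_manifold"
    and j2 :: "'m \<Rightarrow> 'w \<Rightarrow> 'w" and \<eta> :: "'m \<Rightarrow> 'w"
    and \<xi> :: "'m \<Rightarrow> (real ^ 5) set" and J :: "nat \<Rightarrow> 'm \<Rightarrow> real ^ 5 \<Rightarrow> real ^ 5"
    and R :: "'m \<Rightarrow> real ^ 5" and V :: "'m \<Rightarrow> real ^ 5"
    and S :: "'m \<Rightarrow> real ^ 5 \<Rightarrow> real ^ 5" and S0 :: "'m \<Rightarrow> real ^ 5 \<Rightarrow> real ^ 5"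
    and Sk :: "nat \<Rightarrow> 'm \<Rightarrow> real ^ 5 \<Rightarrow> real ^ 5"
    and \<Theta> :: "nat \<Rightarrow> 'm \<Rightarrow> real ^ 5 \<Rightarrow> real" and \<phi> lam :: "nat \<Rightarrow> 'm \<Rightarrow> real" and \<mu> :: "'m \<Rightarrow> real"
  assumes "oriented_riemannian_spin_manifold M"
    and "parallel_structure M j2"
    and "unit_spinor M \<eta>"
    and "su2_structure M j2 \<eta> \<xi> J R"
    and "spinor_decomposition M j2 \<eta> \<xi> R S V \<Theta> \<phi>"
    and "endo_decomposition M \<xi> J R S \<mu> lam Sk S0"
  shows "\<exists>(\<tau>0 :: nat \<Rightarrow> nat \<Rightarrow> 'm \<Rightarrow> real) (\<tau>1 :: nat \<Rightarrow> 'm \<Rightarrow> real ^ 5 \<Rightarrow> real)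
           (\<tau>2 :: nat \<Rightarrow> 'm \<Rightarrow> real ^ 5 \<Rightarrow> real ^ 5 \<Rightarrow> real).
     (\<forall>k\<in>{1,2,3}. \<forall>x X Y Z.
        ext_deriv (charts M) (omega M J R k) x X Y Z =
          wedge_1_2 (alpha M R x) (\<tau>2 k x) X Y Z
          + (\<Sum>l\<in>{1,2,3}. \<tau>0 k l x * wedge_1_2 (alpha M R x) (omega M J R l x) X Y Z)
          + wedge_1_2 (\<tau>1 k x) (omega M J R k x) X Y Z) \<and>
     (\<forall>k\<in>{1,2,3}. \<forall>l\<in>{1,2,3}. k \<noteq> l \<longrightarrow> (\<forall>x. \<tau>0 k l x = - \<tau>0 l k x)) \<and>
     (\<forall>x. (\<forall>k\<in>{1,2,3}. \<tau>0 k k x = 4 * lam 1 x) \<and>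
        \<tau>0 1 2 x = 4 * lam 2 x + 2 * \<phi> 3 x \<and>
        \<tau>0 1 3 x = 4 * lam 3 x - 2 * \<phi> 2 x \<and>
        \<tau>0 2 3 x = 4 * \<mu> x - 2 * \<phi> 1 x) \<and>
     (\<forall>k\<in>{1,2,3}. \<forall>x X.
        \<tau>1 k x X = - 2 * (\<Sum>l\<in>{1,2,3} - {k}. epsilon l * \<Theta> l x (J l x (hor M R x X)))) \<and>
     (\<forall>x X Y.
        \<tau>2 1 x X Y = 4 * metric M x (S0 x (hor M R x X)) (hor M R x Y) \<and>
        \<tau>2 2 x X Y = 4 * omega M J R 3 x (Sk 3 x (hor M R x X)) Y \<and>
        \<tau>2 3 x X Y = - 4 * omega M J R 2 x (Sk 2 x (hor M R x X)) Y)"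
proof -
  interpret su2_manifold M j2 \<eta> \<xi> J R
    using assms(1-4) by unfold_locales
  have sum3: "(\<Sum>l\<in>{1,2,3}. f l) = f 1 + f 2 + f (3::nat)" for f :: "nat \<Rightarrow> 'b::comm_monoid_add"
    by (simp add: add.assoc)
  have endo: "su2_decomposition (clifford M x) (metric M x) vol (j2 x) (j3 x) (\<eta> x) (\<xi> x) (J 1 x) (J 2 x) (J 3 x) (R x)
      (S x) (S0 x) (Sk 1 x) (Sk 2 x) (Sk 3 x) (\<mu> x) (lam 1 x) (lam 2 x) (lam 3 x)" for x
    using assms(6)[unfolded endo_decomposition_def, rule_format, of x]
    by (intro su2_decomposition.intro su2_point su2_decomposition_axioms.intro)
      (auto simp: sum3 endo_on_def)
  have spinor: "V x \<in> \<xi> x" "linear_on_subspace (\<xi> x) (\<Theta> 1 x)" "linear_on_subspace (\<xi> x) (\<Theta> 2 x)" "linear_on_subspace (\<xi> x) (\<Theta> 3 x)"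
    "nabla M x X \<eta> = clifford M x (S x (pt.hor x X)) (\<eta> x) + metric M x (R x) X *\<^sub>R clifford M x (V x) (\<eta> x) +
      ((\<Theta> 1 x (pt.hor x X) + metric M x (R x) X * \<phi> 1 x) *\<^sub>R vol (\<eta> x)
       + (\<Theta> 2 x (pt.hor x X) + metric M x (R x) X * \<phi> 2 x) *\<^sub>R j2 x (\<eta> x)
       + (\<Theta> 3 x (pt.hor x X) + metric M x (R x) X * \<phi> 3 x) *\<^sub>R j3 x (\<eta> x))" for x X
    using assms(5)[unfolded spinor_decomposition_def, rule_format, of x]
    by (simp_all add: sum3 jmath hor_eq alpha_def)
  note main = su2_decomposition.d_om[OF endo spinor(5) spinor(1-4)]
  \<comment> \<open>The diagonal and upper entries are the prescribed ones, the lower ones their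
    negatives; among indices 1, 2, 3 the last branch is the pair (3, 2).\<close>
  define \<tau>0 :: "nat \<Rightarrow> nat \<Rightarrow> 'm \<Rightarrow> real" where "\<tau>0 k l x =
    (if k = l then 4 * lam 1 x
     else if (k, l) = (1, 2) then 4 * lam 2 x + 2 * \<phi> 3 x
     else if (k, l) = (2, 1) then - (4 * lam 2 x + 2 * \<phi> 3 x)
     else if (k, l) = (1, 3) then 4 * lam 3 x - 2 * \<phi> 2 x
     else if (k, l) = (3, 1) then - (4 * lam 3 x - 2 * \<phi> 2 x)
     else if (k, l) = (2, 3) then 4 * \<mu> x - 2 * \<phi> 1 x
     else - (4 * \<mu> x - 2 * \<phi> 1 x))" for k l x
  define \<tau>1 :: "nat \<Rightarrow> 'm \<Rightarrow> real ^ 5 \<Rightarrow> real" where "\<tau>1 k x X =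
    - 2 * (\<Sum>l\<in>{1,2,3} - {k}. epsilon l * \<Theta> l x (J l x (Defs.hor M R x X)))" for k x X
  define \<tau>2 :: "nat \<Rightarrow> 'm \<Rightarrow> real ^ 5 \<Rightarrow> real ^ 5 \<Rightarrow> real" where "\<tau>2 k x X Y =
    (if k = 1 then 4 * metric M x (S0 x (Defs.hor M R x X)) (Defs.hor M R x Y)
     else if k = 2 then 4 * omega M J R 3 x (Sk 3 x (Defs.hor M R x X)) Y
     else - 4 * omega M J R 2 x (Sk 2 x (Defs.hor M R x X)) Y)" for k x X Y
  have sets: "{1,2,3} - {1::nat} = {2,3}" "{1,2,3} - {2::nat} = {1,3}" "{1,2,3} - {3::nat} = {1,2}"
    by auto
  \<comment> \<open>For k = 1 both signs are -1 and cancel the leading minus; for k = 2, 3 the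
    remaining indices have opposite signs, hence the differences.\<close>
  have \<tau>1: "\<tau>1 1 x = (\<lambda>X. 2 * (\<Theta> 2 x (J 2 x (pt.hor x X)) + \<Theta> 3 x (J 3 x (pt.hor x X))))"
    "\<tau>1 2 x = (\<lambda>X. - 2 * (\<Theta> 1 x (J 1 x (pt.hor x X)) - \<Theta> 3 x (J 3 x (pt.hor x X))))"
    "\<tau>1 3 x = (\<lambda>X. - 2 * (\<Theta> 1 x (J 1 x (pt.hor x X)) - \<Theta> 2 x (J 2 x (pt.hor x X))))" for x
    by (auto simp: \<tau>1_def sets epsilon_def hor_eq)
  have \<tau>2: "\<tau>2 1 x = (\<lambda>X Y. 4 * metric M x (S0 x (pt.hor x X)) (pt.hor x Y))"
    "\<tau>2 2 x = (\<lambda>X Y. 4 * pt.om3 x (Sk 3 x (pt.hor x X)) Y)"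
    "\<tau>2 3 x = (\<lambda>X Y. - 4 * pt.om2 x (Sk 2 x (pt.hor x X)) Y)" for x
    by (intro ext; simp add: \<tau>2_def omega_eq hor_eq)+
  have om: "omega M J R 1 x = pt.om1 x" "omega M J R 2 x = pt.om2 x" "omega M J R 3 x = pt.om3 x"
    "alpha M R x = metric M x (R x)" for x
    by (intro ext; simp add: omega_eq alpha_def)+
  have "ext_deriv (charts M) (omega M J R k) x X Y Z =
          wedge_1_2 (alpha M R x) (\<tau>2 k x) X Y Z
          + (\<Sum>l\<in>{1,2,3}. \<tau>0 k l x * wedge_1_2 (alpha M R x) (omega M J R l x) X Y Z)
          + wedge_1_2 (\<tau>1 k x) (omega M J R k x) X Y Z" if k: "k \<in> {1,2,3}" for k x X Y Z
  proof -
    consider "k = 1" | "k = 2" | "k = 3" using k by auto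
    then show ?thesis
      by cases (simp_all add: ext_deriv_omega main sum3 \<tau>0_def \<tau>1 \<tau>2 om)
  qed
  moreover have "\<tau>0 k l x = - \<tau>0 l k x" if "k \<in> {1,2,3}" "l \<in> {1,2,3}" "k \<noteq> l" for k l x
    using that by (elim insertE emptyE) (simp_all add: \<tau>0_def)
  moreover have "\<tau>0 k k x = 4 * lam 1 x" "\<tau>0 1 2 x = 4 * lam 2 x + 2 * \<phi> 3 x"
    "\<tau>0 1 3 x = 4 * lam 3 x - 2 * \<phi> 2 x" "\<tau>0 2 3 x = 4 * \<mu> x - 2 * \<phi> 1 x" for k x
    by (simp_all add: \<tau>0_def)
  moreover have "\<tau>2 1 x X Y = 4 * metric M x (S0 x (Defs.hor M R x X)) (Defs.hor M R x Y)"
    "\<tau>2 2 x X Y = 4 * omega M J R 3 x (Sk 3 x (Defs.hor M R x X)) Y"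
    "\<tau>2 3 x X Y = - 4 * omega M J R 2 x (Sk 2 x (Defs.hor M R x X)) Y" for x X Y
    by (simp_all add: \<tau>2_def)
  ultimately show ?thesis
    by (intro exI[of _ \<tau>0] exI[of _ \<tau>1] exI[of _ \<tau>2] conjI ballI allI impI \<tau>1_def)
qed

end
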